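(* Let $W$ be a reflexive Banach space with a scaling $(u,t)\mapsto u_t$ with exponent $s>0$, let $I$ and $\mathcal M$ be as in the context, and let $\Phi$ be a $C^1$-functional on $W$. If $\Phi$ has a scaled local linking near the origin in dimension $k\ge1$, then $C^k(\Phi,0)$ is nontrivial.
   Context: A scaling on a reflexive (real) Banach space $W$ is a continuous map $W\times[0,\infty)\to W$, $(u,t)\mapsto u_t$, such that: $(u_{t_1})_{t_2}=u_{t_1t_2}$ for all $u\in W$, $t_1,t_2\ge0$; $(\tau u)_t=\tau u_t$ for all $u\in W$, $\tau\in\mathbb R$, $t\ge0$; $u_0=0$ and $u_1=u$ for all $u\in W$; $u_t$ is bounded on bounded sets in $W\times[0,\infty)$; and there is $s>0$ (fixed from now on) with $\|u_t\|=O(t^s)$ as $t\to\infty$, uniformly in $u$ on bounded sets. $I\in C(W,\mathbb R)$ is an even functional satisfying $I(u_t)=t^sI(u)$ for all $u\in W$, $t\ge0$, and $I(u)>0$ for all $u\in W\setminus\{0\}$. Set $\mathcal M=\{u\in W:I(u)=1\}$. It is assumed that $\mathcal M$ is bounded and that each ray $\{tu:t\ge0\}$, $u\ne0$, starting from the origin intersects $\mathcal M$ at exactly one point. Cohomological index (Fadell–Rabinowitz): for a symmetric set $A\subset W\setminus\{0\}$ (i.e. $-A=A$), let $\overline A=A/\mathbb Z_2$ be the quotient identifying $u$ and $-u$, let $f:\overline A\to\mathbb{RP}^\infty$ be its classifying map and $f^*:H^*(\mathbb{RP}^\infty)\to H^*(\overline A)$ the induced homomorphism of Alexander–Spanier cohomology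 rings with $\mathbb Z_2$ coefficients. Then $i(\emptyset)=0$ and, for $A\ne\emptyset$, $i(A)=\sup\{m\ge1: f^*(\omega^{m-1})\ne0\}$, where $\omega\in H^1(\mathbb{RP}^\infty)$ is the generator of $H^*(\mathbb{RP}^\infty)=\mathbb Z_2[\omega]$. $\Phi$ has a scaled local linking near the origin in dimension $k\ge1$ if there are disjoint nonempty closed symmetric subsets $A_0$ and $B_0$ of $\mathcal M$ with $i(A_0)=i(\mathcal M\setminus B_0)=k$ and $\rho>0$ such that $\Phi(u_t)\le0$ for all $u\in A_0$, $0\le t\le\rho$, and $\Phi(u_t)>0$ for all $u\in B_0$, $0<t\le\rho$. Critical groups at the origin: $C^l(\Phi,0)=H^l(\Phi^0,\Phi^0\setminus\{0\})$, $l\ge0$, where $\Phi^0=\{u\in W:\Phi(u)\le0\}$ and $H^*$ is (Alexander–Spanier) cohomology with $\mathbb Z_2$ coefficients. *)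

theory Defs
  imports
    "HOL-Analysis.Analysis"
    "HOL-Algebra.Elementary_Groups"
    "HOL-Library.Z2"
    "HOL-Library.Extended_Nat"
begin

section \<open>Alexander--Spanier cohomology with coefficients in the field of two elements\<close>

text \<open>
  A \<open>q\<close>-cochain of \<open>X\<close> is a function on \<open>(q+1)\<close>-tuples of points of \<open>X\<close>, here a function on
  lists of which only the values at lists of length \<open>q+1\<close> over \<open>topspace X\<close> matter: all other
  values are ignored by \<open>locally_zero\<close>, and locally zero cochains are divided out.
\<close>

type_synonym 'a cochain = "'a list \<Rightarrow> bit"

definition locally_zero :: "nat \<Rightarrow> 'a topology \<Rightarrow> 'a cochain \<Rightarrow> bool" where
  "locally_zero q X \<phi> \<longleftrightarrow>
     (\<forall>x\<in>topspace X. \<exists>U. openin X U \<and> x \<in> U \<and>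
        (\<forall>xs. length xs = Suc q \<and> set xs \<subseteq> U \<longrightarrow> \<phi> xs = 0))"

text \<open>The signs of the usual formula are irrelevant in characteristic two.\<close>

definition coboundary :: "'a cochain \<Rightarrow> 'a cochain" where
  "coboundary \<phi> xs = (\<Sum>i<length xs. \<phi> (take i xs @ drop (Suc i) xs))"

definition cochain_group :: "'a cochain monoid" where
  "cochain_group = \<lparr>carrier = UNIV, mult = (\<lambda>\<phi> \<psi> xs. \<phi> xs + \<psi> xs), one = (\<lambda>xs. 0)\<rparr>"

text \<open>
  The Alexander--Spanier complex of the pair \<open>(X, A)\<close> consists of the cochains of \<open>X\<close> whose
  restriction to \<open>A\<close> is locally zero, modulo the cochains that are locally zero on \<open>X\<close>. The next
  two sets are the preimages, among the cochains of \<open>X\<close>, of the cocycles and of the coboundaries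
  of this quotient complex, so that their quotient is its cohomology.
\<close>

definition cocycles :: "nat \<Rightarrow> 'a topology \<Rightarrow> 'a set \<Rightarrow> 'a cochain set" where
  "cocycles q X A =
     {\<phi>. locally_zero q (subtopology X A) \<phi> \<and> locally_zero (Suc q) X (coboundary \<phi>)}"

definition coboundaries :: "nat \<Rightarrow> 'a topology \<Rightarrow> 'a set \<Rightarrow> 'a cochain set" where
  "coboundaries q X A =
     (case q of
        0 \<Rightarrow> {\<phi>. locally_zero 0 X \<phi>}
      | Suc p \<Rightarrow> {\<phi>. \<exists>\<psi>. locally_zero p (subtopology X A) \<psi> \<and>
                      locally_zero q X (\<lambda>xs. \<phi> xs - coboundary \<psi> xs)})"

definition cohomology :: "nat \<Rightarrow> 'a topology \<Rightarrow> 'a set \<Rightarrow> 'a cochain set monoid" where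
  "cohomology q X A = (cochain_group\<lparr>carrier := cocycles q X A\<rparr>) Mod (coboundaries q X A)"

abbreviation cohomology_class :: "nat \<Rightarrow> 'a topology \<Rightarrow> 'a set \<Rightarrow> 'a cochain \<Rightarrow> 'a cochain set" where
  "cohomology_class q X A \<phi> \<equiv> coboundaries q X A #>\<^bsub>cochain_group\<^esub> \<phi>"

text \<open>
  Unit, cup product and induced homomorphisms, needed for absolute cohomology only. The unions
  are over representatives; all of them give the same class.
\<close>

definition cup_cochain :: "nat \<Rightarrow> 'a cochain \<Rightarrow> 'a cochain \<Rightarrow> 'a cochain" where
  "cup_cochain p \<phi> \<psi> xs = \<phi> (take (Suc p) xs) * \<psi> (drop p xs)"

definition cup :: "nat \<Rightarrow> nat \<Rightarrow> 'a topology \<Rightarrow> 'a cochain set \<Rightarrow> 'a cochain set \<Rightarrow> 'a cochain set" where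
  "cup p q X a b = (\<Union>\<phi>\<in>a. \<Union>\<psi>\<in>b. cohomology_class (p + q) X {} (cup_cochain p \<phi> \<psi>))"

definition induced :: "nat \<Rightarrow> 'a topology \<Rightarrow> ('a \<Rightarrow> 'b) \<Rightarrow> 'b cochain set \<Rightarrow> 'a cochain set" where
  "induced q X f a = (\<Union>\<phi>\<in>a. cohomology_class q X {} (\<lambda>xs. \<phi> (map f xs)))"

text \<open>\<open>cup_power X w n\<close> is the \<open>n\<close>-th cup power, in degree \<open>n\<close>, of a class \<open>w\<close> of degree one.\<close>

primrec cup_power :: "'a topology \<Rightarrow> 'a cochain set \<Rightarrow> nat \<Rightarrow> 'a cochain set" where
  "cup_power X w 0 = cohomology_class 0 X {} (\<lambda>xs. 1)"
| "cup_power X w (Suc n) = cup n 1 X (cup_power X w n) w"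

subsection \<open>The cohomology groups are well defined\<close>

text \<open>This library rule turns sums in \<^typ>\<open>bit\<close> into case distinctions.\<close>

declare add_bit_eq_xor [simp del]

lemma bit_add_self [simp]: "b + b = 0" "b + (b + c) = c" for b c :: bit
  by (cases b; cases c; simp)+

lemma comm_group_cochain_group: "comm_group (cochain_group :: 'a cochain monoid)"
proof (rule comm_groupI)
  fix \<phi> :: "'a cochain"
  have "\<phi> \<otimes>\<^bsub>cochain_group\<^esub> \<phi> = \<one>\<^bsub>cochain_group\<^esub>" "\<phi> \<in> carrier cochain_group"
    by (simp_all add: cochain_group_def)
  then show "\<exists>\<psi>\<in>carrier cochain_group. \<psi> \<otimes>\<^bsub>cochain_group\<^esub> \<phi> = \<one>\<^bsub>cochain_group\<^esub>"
    by blast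
qed (auto simp: cochain_group_def add.assoc add.commute)

lemma cochain_group_simps [simp]:
  "carrier cochain_group = UNIV"
  "\<phi> \<otimes>\<^bsub>cochain_group\<^esub> \<psi> = (\<lambda>xs. \<phi> xs + \<psi> xs)"
  "\<one>\<^bsub>cochain_group\<^esub> = (\<lambda>xs. 0)"
  by (simp_all add: cochain_group_def)

lemma inv_cochain_group [simp]: "inv\<^bsub>cochain_group\<^esub> \<phi> = \<phi>"
  by (rule group.inv_equality[OF comm_group.axioms(2)[OF comm_group_cochain_group]])
    (auto simp: fun_eq_iff)

lemma locally_zero_0 [simp]: "locally_zero q X (\<lambda>xs. 0)"
  by (auto simp: locally_zero_def)

lemma locally_zero_add:
  assumes "locally_zero q X \<phi>" "locally_zero q X \<psi>"
  shows "locally_zero q X (\<lambda>xs. \<phi> xs + \<psi> xs)"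
  unfolding locally_zero_def
proof
  fix x assume "x \<in> topspace X"
  then obtain U V where
    "openin X U" "x \<in> U" "\<And>xs. length xs = Suc q \<Longrightarrow> set xs \<subseteq> U \<Longrightarrow> \<phi> xs = 0"
    "openin X V" "x \<in> V" "\<And>xs. length xs = Suc q \<Longrightarrow> set xs \<subseteq> V \<Longrightarrow> \<psi> xs = 0"
    using assms unfolding locally_zero_def by meson
  then show "\<exists>U. openin X U \<and> x \<in> U \<and>
      (\<forall>xs. length xs = Suc q \<and> set xs \<subseteq> U \<longrightarrow> \<phi> xs + \<psi> xs = 0)"
    by (intro exI[of _ "U \<inter> V"]) auto
qed

lemma locally_zero_subtopology:
  assumes "locally_zero q X \<phi>"
  shows "locally_zero q (subtopology X A) \<phi>"
  unfolding locally_zero_def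
proof
  fix x assume x: "x \<in> topspace (subtopology X A)"
  then obtain U where
    "openin X U" "x \<in> U" "\<And>xs. length xs = Suc q \<Longrightarrow> set xs \<subseteq> U \<Longrightarrow> \<phi> xs = 0"
    using assms unfolding locally_zero_def by auto
  then show "\<exists>U. openin (subtopology X A) U \<and> x \<in> U \<and>
      (\<forall>xs. length xs = Suc q \<and> set xs \<subseteq> U \<longrightarrow> \<phi> xs = 0)"
    using x by (intro exI[of _ "U \<inter> A"]) (auto simp: openin_subtopology)
qed

lemma coboundary_0 [simp]: "coboundary (\<lambda>xs. 0) = (\<lambda>xs. 0)"
  by (simp add: coboundary_def fun_eq_iff)

lemma coboundary_add:
  "coboundary (\<lambda>xs. \<phi> xs + \<psi> xs) = (\<lambda>xs. coboundary \<phi> xs + coboundary \<psi> xs)"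
  by (simp add: coboundary_def fun_eq_iff sum.distrib)

lemma locally_zero_coboundary:
  assumes "locally_zero q X \<phi>"
  shows "locally_zero (Suc q) X (coboundary \<phi>)"
  unfolding locally_zero_def
proof
  fix x assume "x \<in> topspace X"
  then obtain U where U:
    "openin X U" "x \<in> U" "\<And>xs. length xs = Suc q \<Longrightarrow> set xs \<subseteq> U \<Longrightarrow> \<phi> xs = 0"
    using assms unfolding locally_zero_def by auto
  have "coboundary \<phi> xs = 0" if "length xs = Suc (Suc q)" "set xs \<subseteq> U" for xs
    unfolding coboundary_def
  proof (rule sum.neutral, rule ballI, rule U(3))
    fix i assume "i \<in> {..<length xs}"
    then show "length (take i xs @ drop (Suc i) xs) = Suc q" using that by auto
    show "set (take i xs @ drop (Suc i) xs) \<subseteq> U"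
      using that(2) set_take_subset[of i xs] set_drop_subset[of "Suc i" xs] by auto
  qed
  then show "\<exists>U. openin X U \<and> x \<in> U \<and>
      (\<forall>xs. length xs = Suc (Suc q) \<and> set xs \<subseteq> U \<longrightarrow> coboundary \<phi> xs = 0)"
    using U by blast
qed

lemma coboundary_coboundary [simp]: "coboundary (coboundary \<phi>) = (\<lambda>xs. 0)"
proof
  fix xs :: "'a list"
  define n where "n = length xs"
  define d where "d = (\<lambda>i ys :: 'a list. take i ys @ drop (Suc i) ys)"
  have len: "length (d i xs) = n - 1" if "i < n" for i
    using that by (auto simp: d_def n_def)
  have nth_d: "d i ys ! m = (if m < i then ys ! m else ys ! Suc m)" "length (d i ys) = length ys - 1"
    if "i < length ys" "m < length ys - 1" for i m and ys :: "'a list"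
    using that by (auto simp: d_def nth_append min_def)
  have swap: "d j (d i xs) = d (i - 1) (d j xs)" if "j < i" "i < n" for i j
  proof (rule nth_equalityI)
    show "length (d j (d i xs)) = length (d (i - 1) (d j xs))"
      using that by (simp add: d_def n_def)
    fix m assume "m < length (d j (d i xs))"
    then have m: "m < n - 2"
      using that by (simp add: d_def n_def)
    have "length (d i xs) = n - 1" "length (d j xs) = n - 1"
      using that len by auto
    then show "d j (d i xs) ! m = d (i - 1) (d j xs) ! m"
      using that m by (auto simp: nth_d n_def)
  qed
  let ?L = "{(i, j). i < n \<and> j < i}" and ?U = "{(i, j). i < n \<and> j < n - 1 \<and> i \<le> j}"
  have fin: "finite ?L" "finite ?U"
    by (rule finite_subset[of _ "{..<n} \<times> {..<n}"]; auto)+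
  have "coboundary (coboundary \<phi>) xs = (\<Sum>i<n. \<Sum>j<n - 1. \<phi> (d j (d i xs)))"
  proof -
    have "coboundary \<theta> ys = (\<Sum>i<length ys. \<theta> (d i ys))" for \<theta> and ys :: "'a list"
      by (simp add: coboundary_def d_def)
    then show ?thesis
      by (simp add: len n_def)
  qed
  also have "\<dots> = (\<Sum>(i, j)\<in>{..<n} \<times> {..<n - 1}. \<phi> (d j (d i xs)))"
    by (simp add: sum.cartesian_product)
  also have "{..<n} \<times> {..<n - 1} = ?L \<union> ?U"
    by auto
  also have "(\<Sum>(i, j)\<in>\<dots>. \<phi> (d j (d i xs))) =
      (\<Sum>(i, j)\<in>?L. \<phi> (d j (d i xs))) + (\<Sum>(i, j)\<in>?U. \<phi> (d j (d i xs)))"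
    using fin by (intro sum.union_disjoint) auto
  also have "(\<Sum>(i, j)\<in>?L. \<phi> (d j (d i xs))) = (\<Sum>(i, j)\<in>?U. \<phi> (d j (d i xs)))"
    by (rule sum.reindex_bij_witness[of _ "\<lambda>(i, j). (Suc j, i)" "\<lambda>(i, j). (j, i - 1)"])
      (auto simp: swap)
  finally show "coboundary (coboundary \<phi>) xs = 0"
    by simp
qed

lemma coboundaries_subset_cocycles: "coboundaries q X A \<subseteq> cocycles q X A"
proof
  fix \<phi> assume \<phi>: "\<phi> \<in> coboundaries q X A"
  show "\<phi> \<in> cocycles q X A"
  proof (cases q)
    case 0
    then show ?thesis
      using \<phi> by (auto simp: coboundaries_def cocycles_def
          intro: locally_zero_subtopology locally_zero_coboundary)
  next
    case (Suc p)
    then obtain \<psi> where \<psi>: "locally_zero p (subtopology X A) \<psi>"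
      "locally_zero q X (\<lambda>xs. \<phi> xs + coboundary \<psi> xs)"
      using \<phi> by (auto simp: coboundaries_def)
    define \<theta> where "\<theta> = (\<lambda>xs. \<phi> xs + coboundary \<psi> xs)"
    have \<phi>_eq: "\<phi> = (\<lambda>xs. \<theta> xs + coboundary \<psi> xs)"
      by (auto simp: \<theta>_def fun_eq_iff add.assoc)
    have \<theta>: "locally_zero q X \<theta>"
      using \<psi>(2) by (simp add: \<theta>_def)
    have "locally_zero q (subtopology X A) \<phi>"
      unfolding \<phi>_eq using \<psi>(1) \<theta> Suc
      by (auto intro: locally_zero_add locally_zero_subtopology locally_zero_coboundary)
    moreover have "locally_zero (Suc q) X (coboundary \<phi>)"
      unfolding \<phi>_eq coboundary_add using \<theta> by (auto intro: locally_zero_coboundary)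
    ultimately show ?thesis
      by (simp add: cocycles_def)
  qed
qed

lemma subgroup_cocycles: "subgroup (cocycles q X A) cochain_group"
  by (rule subgroup.intro)
    (auto simp: cocycles_def coboundary_add intro: locally_zero_add)

lemma subgroup_coboundaries: "subgroup (coboundaries q X A) cochain_group"
proof (rule subgroup.intro)
  fix \<phi> \<psi> assume *: "\<phi> \<in> coboundaries q X A" "\<psi> \<in> coboundaries q X A"
  show "\<phi> \<otimes>\<^bsub>cochain_group\<^esub> \<psi> \<in> coboundaries q X A"
  proof (cases q)
    case 0
    then show ?thesis
      using * by (auto simp: coboundaries_def intro: locally_zero_add)
  next
    case (Suc p)
    then obtain \<alpha> \<beta> where **: "locally_zero p (subtopology X A) \<alpha>"
      "locally_zero q X (\<lambda>xs. \<phi> xs + coboundary \<alpha> xs)"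
      "locally_zero p (subtopology X A) \<beta>"
      "locally_zero q X (\<lambda>xs. \<psi> xs + coboundary \<beta> xs)"
      using * by (auto simp: coboundaries_def)
    have "locally_zero q X (\<lambda>xs. (\<phi> xs + \<psi> xs) - coboundary (\<lambda>xs. \<alpha> xs + \<beta> xs) xs)"
      using locally_zero_add[OF **(2) **(4)] by (simp add: coboundary_add ac_simps)
    then show ?thesis
      using Suc locally_zero_add[OF **(1) **(3)] by (auto simp: coboundaries_def)
  qed
next
  show "\<one>\<^bsub>cochain_group\<^esub> \<in> coboundaries q X A"
    by (cases q) (auto simp: coboundaries_def intro: exI[of _ "\<lambda>xs. 0"])
qed auto

lemma comm_group_cohomology: "comm_group (cohomology q X A)"
proof -
  interpret C: comm_group "cochain_group :: 'a cochain monoid"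
    by (rule comm_group_cochain_group)
  let ?Z = "(cochain_group :: 'a cochain monoid)\<lparr>carrier := cocycles q X A\<rparr>"
  interpret Z: comm_group ?Z
    by (rule group.group_comm_groupI[OF C.subgroup_imp_group[OF subgroup_cocycles]])
      (simp add: add.commute)
  have "subgroup (coboundaries q X A) ?Z"
    by (rule C.subgroup_incl[OF subgroup_coboundaries subgroup_cocycles coboundaries_subset_cocycles])
  then show ?thesis
    unfolding cohomology_def by (rule Z.abelian_FactGroup)
qed


section \<open>Infinite real projective space and the cohomological index\<close>

definition quotient_topology :: "'a topology \<Rightarrow> ('a \<Rightarrow> 'b) \<Rightarrow> 'b topology" where
  "quotient_topology X p =
     topology (\<lambda>V. V \<subseteq> p ` topspace X \<and> openin X {x \<in> topspace X. p x \<in> V})"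

lemma openin_quotient_topology:
  "openin (quotient_topology X p) V \<longleftrightarrow>
     V \<subseteq> p ` topspace X \<and> openin X {x \<in> topspace X. p x \<in> V}"
proof -
  have "istopology (\<lambda>V. V \<subseteq> p ` topspace X \<and> openin X {x \<in> topspace X. p x \<in> V})"
    unfolding istopology_def
  proof (intro conjI allI impI; (elim conjE)?)
    fix S T
    assume "openin X {x \<in> topspace X. p x \<in> S}" "openin X {x \<in> topspace X. p x \<in> T}"
    then have "openin X ({x \<in> topspace X. p x \<in> S} \<inter> {x \<in> topspace X. p x \<in> T})"
      by (rule openin_Int)
    also have "\<dots> = {x \<in> topspace X. p x \<in> S \<inter> T}"
      by auto
    finally show "openin X {x \<in> topspace X. p x \<in> S \<inter> T}" .
  next
    fix \<K>
    assume "\<forall>K\<in>\<K>. K \<subseteq> p ` topspace X \<and> openin X {x \<in> topspace X. p x \<in> K}"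
    then have "openin X (\<Union>K\<in>\<K>. {x \<in> topspace X. p x \<in> K})"
      by blast
    also have "(\<Union>K\<in>\<K>. {x \<in> topspace X. p x \<in> K}) = {x \<in> topspace X. p x \<in> \<Union>\<K>}"
      by auto
    finally show "openin X {x \<in> topspace X. p x \<in> \<Union>\<K>}" .
  qed auto
  then show ?thesis
    by (simp add: quotient_topology_def topology_inverse')
qed

lemma topspace_quotient_topology [simp]: "topspace (quotient_topology X p) = p ` topspace X"
proof -
  have "{x \<in> topspace X. p x \<in> p ` topspace X} = topspace X"
    by auto
  then have "openin (quotient_topology X p) (p ` topspace X)"
    by (simp add: openin_quotient_topology)
  then show ?thesis
    by (meson openin_quotient_topology openin_subset openin_topspace subset_antisym)
qed

lemma quotient_map_quotient_topology: "quotient_map X (quotient_topology X p) p"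
  by (auto simp: quotient_map_def openin_quotient_topology)

definition antipodal_quotient :: "'a::uminus topology \<Rightarrow> 'a set topology" where
  "antipodal_quotient X = quotient_topology X (\<lambda>x. {x, - x})"

text \<open>
  The infinite sphere is the union of the library's spheres \<open>nsphere n\<close>, which are nested sets of
  finitely supported sequences, with the direct limit topology.
\<close>

definition infinite_sphere :: "(nat \<Rightarrow> real) topology" where
  "infinite_sphere =
     topology (\<lambda>U. U \<subseteq> (\<Union>n. topspace (nsphere n)) \<and>
                   (\<forall>n. openin (nsphere n) (U \<inter> topspace (nsphere n))))"

lemma openin_infinite_sphere:
  "openin infinite_sphere U \<longleftrightarrow>
     U \<subseteq> (\<Union>n. topspace (nsphere n)) \<and> (\<forall>n. openin (nsphere n) (U \<inter> topspace (nsphere n)))"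
proof -
  have "istopology (\<lambda>U. U \<subseteq> (\<Union>n. topspace (nsphere n)) \<and>
                        (\<forall>n. openin (nsphere n) (U \<inter> topspace (nsphere n))))"
    unfolding istopology_def
  proof (intro conjI allI impI; (elim conjE)?)
    fix S T n
    assume "\<forall>n. openin (nsphere n) (S \<inter> topspace (nsphere n))"
      "\<forall>n. openin (nsphere n) (T \<inter> topspace (nsphere n))"
    then have "openin (nsphere n) ((S \<inter> topspace (nsphere n)) \<inter> (T \<inter> topspace (nsphere n)))"
      by - (rule openin_Int; rule spec)
    also have "\<dots> = S \<inter> T \<inter> topspace (nsphere n)"
      by blast
    finally show "openin (nsphere n) (S \<inter> T \<inter> topspace (nsphere n))" .
  next
    fix \<K> n
    assume "\<forall>K\<in>\<K>. K \<subseteq> (\<Union>n. topspace (nsphere n)) \<and>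
      (\<forall>n. openin (nsphere n) (K \<inter> topspace (nsphere n)))"
    then have "openin (nsphere n) (\<Union>K\<in>\<K>. K \<inter> topspace (nsphere n))"
      by (intro openin_Union) blast
    also have "(\<Union>K\<in>\<K>. K \<inter> topspace (nsphere n)) = \<Union>\<K> \<inter> topspace (nsphere n)"
      by blast
    finally show "openin (nsphere n) (\<Union>\<K> \<inter> topspace (nsphere n))" .
  next
    fix \<K> :: "(nat \<Rightarrow> real) set set"
    assume "\<forall>K\<in>\<K>. K \<subseteq> (\<Union>n. topspace (nsphere n)) \<and>
      (\<forall>n. openin (nsphere n) (K \<inter> topspace (nsphere n)))"
    then show "\<Union>\<K> \<subseteq> (\<Union>n. topspace (nsphere n))"
      by blast
  next
    fix S T :: "(nat \<Rightarrow> real) set"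
    assume "S \<subseteq> (\<Union>n. topspace (nsphere n))"
    then show "S \<inter> T \<subseteq> (\<Union>n. topspace (nsphere n))"
      by blast
  qed
  then show ?thesis
    by (simp add: infinite_sphere_def topology_inverse')
qed

definition RP_infinity :: "(nat \<Rightarrow> real) set topology" where
  "RP_infinity = antipodal_quotient infinite_sphere"

text \<open>
  The generator is the unique nonzero class of degree one.
\<close>

definition RP_generator :: "(nat \<Rightarrow> real) set cochain set" where
  "RP_generator =
     (THE w. w \<in> carrier (cohomology 1 RP_infinity {}) \<and> w \<noteq> \<one>\<^bsub>cohomology 1 RP_infinity {}\<^esub>)"

text \<open>
  A classifying map of the double cover \<open>A \<rightarrow> A/\<int>\<^sub>2\<close> is a continuous map that is covered by a
  continuous equivariant map \<open>F\<close> into the infinite sphere, the total space of the universal double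
  cover. It is unique up to homotopy, so its choice does not affect the index below.
\<close>

definition is_classifying_map ::
  "'a::real_normed_vector set \<Rightarrow> ('a set \<Rightarrow> (nat \<Rightarrow> real) set) \<Rightarrow> bool" where
  "is_classifying_map A f \<longleftrightarrow>
     continuous_map (antipodal_quotient (top_of_set A)) RP_infinity f \<and>
     (\<exists>F. continuous_map (top_of_set A) infinite_sphere F \<and>
          (\<forall>u\<in>A. F (- u) = - F u \<and> f {u, - u} = {F u, - F u}))"

text \<open>Meaningful for symmetric sets \<open>A\<close> not containing \<open>0\<close>.\<close>

definition cohomological_index :: "'a::real_normed_vector set \<Rightarrow> enat" where
  "cohomological_index A =
     (if A = {} then 0
      else Sup {enat m | m. m \<ge> 1 \<and>
        (\<exists>f. is_classifying_map A f \<and>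
             induced (m - 1) (antipodal_quotient (top_of_set A)) f
               (cup_power RP_infinity RP_generator (m - 1))
             \<noteq> \<one>\<^bsub>cohomology (m - 1) (antipodal_quotient (top_of_set A)) {}\<^esub>)})"


section \<open>Scalings, scaled local linking and critical groups\<close>

definition reflexive :: "'a::banach itself \<Rightarrow> bool" where
  "reflexive _ \<longleftrightarrow>
     (\<forall>\<xi> :: ('a \<Rightarrow>\<^sub>L real) \<Rightarrow>\<^sub>L real. \<exists>u :: 'a. \<forall>g :: 'a \<Rightarrow>\<^sub>L real.
        blinfun_apply \<xi> g = blinfun_apply g u)"

text \<open>\<open>sc u t\<close> is the scaled vector written \<open>u\<^sub>t\<close>; only its values for \<open>t \<ge> 0\<close> matter.\<close>

definition is_scaling :: "('a::banach \<Rightarrow> real \<Rightarrow> 'a) \<Rightarrow> real \<Rightarrow> bool" where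
  "is_scaling sc s \<longleftrightarrow>
     continuous_on (UNIV \<times> {0..}) (\<lambda>(u, t). sc u t) \<and>
     (\<forall>u. \<forall>t1\<ge>0. \<forall>t2\<ge>0. sc (sc u t1) t2 = sc u (t1 * t2)) \<and>
     (\<forall>u \<tau>. \<forall>t\<ge>0. sc (\<tau> *\<^sub>R u) t = \<tau> *\<^sub>R sc u t) \<and>
     (\<forall>u. sc u 0 = 0 \<and> sc u 1 = u) \<and>
     (\<forall>D \<subseteq> UNIV \<times> {0..}. bounded D \<longrightarrow> bounded ((\<lambda>(u, t). sc u t) ` D)) \<and>
     s > 0 \<and>
     (\<forall>B. bounded B \<longrightarrow>
        (\<exists>C T. T > 0 \<and> (\<forall>u\<in>B. \<forall>t\<ge>T. norm (sc u t) \<le> C * t powr s)))"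

definition level_one :: "('a \<Rightarrow> real) \<Rightarrow> 'a set" where
  "level_one I = {u. I u = 1}"

definition is_scaled_functional ::
  "('a::banach \<Rightarrow> real \<Rightarrow> 'a) \<Rightarrow> real \<Rightarrow> ('a \<Rightarrow> real) \<Rightarrow> bool" where
  "is_scaled_functional sc s I \<longleftrightarrow>
     continuous_on UNIV I \<and>
     (\<forall>u. I (- u) = I u) \<and>
     (\<forall>u. \<forall>t\<ge>0. I (sc u t) = t powr s * I u) \<and>
     (\<forall>u. u \<noteq> 0 \<longrightarrow> I u > 0) \<and>
     bounded (level_one I) \<and>
     (\<forall>u. u \<noteq> 0 \<longrightarrow> (\<exists>!v. v \<in> {t *\<^sub>R u | t. t \<ge> 0} \<inter> level_one I))"

definition C1_functional :: "('a::real_normed_vector \<Rightarrow> real) \<Rightarrow> bool" where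
  "C1_functional \<Phi> \<longleftrightarrow>
     (\<exists>\<Phi>' :: 'a \<Rightarrow> ('a \<Rightarrow>\<^sub>L real).
        (\<forall>u. (\<Phi> has_derivative blinfun_apply (\<Phi>' u)) (at u)) \<and> continuous_on UNIV \<Phi>')"

definition symmetric_set :: "'a::uminus set \<Rightarrow> bool" where
  "symmetric_set A \<longleftrightarrow> uminus ` A = A"

definition scaled_local_linking ::
  "('a::banach \<Rightarrow> real \<Rightarrow> 'a) \<Rightarrow> ('a \<Rightarrow> real) \<Rightarrow> ('a \<Rightarrow> real) \<Rightarrow> nat \<Rightarrow> bool" where
  "scaled_local_linking sc I \<Phi> k \<longleftrightarrow>
     k \<ge> 1 \<and>
     (\<exists>A\<^sub>0 B\<^sub>0 \<rho>.
        closedin (top_of_set (level_one I)) A\<^sub>0 \<and> closedin (top_of_set (level_one I)) B\<^sub>0 \<and>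
        symmetric_set A\<^sub>0 \<and> symmetric_set B\<^sub>0 \<and>
        A\<^sub>0 \<noteq> {} \<and> B\<^sub>0 \<noteq> {} \<and> A\<^sub>0 \<inter> B\<^sub>0 = {} \<and>
        cohomological_index A\<^sub>0 = enat k \<and>
        cohomological_index (level_one I - B\<^sub>0) = enat k \<and>
        \<rho> > 0 \<and>
        (\<forall>u\<in>A\<^sub>0. \<forall>t. 0 \<le> t \<and> t \<le> \<rho> \<longrightarrow> \<Phi> (sc u t) \<le> 0) \<and>
        (\<forall>u\<in>B\<^sub>0. \<forall>t. 0 < t \<and> t \<le> \<rho> \<longrightarrow> \<Phi> (sc u t) > 0))"

definition critical_group :: "nat \<Rightarrow> ('a::real_normed_vector \<Rightarrow> real) \<Rightarrow> 'a cochain set monoid" where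
  "critical_group l \<Phi> = cohomology l (top_of_set {u. \<Phi> u \<le> 0}) ({u. \<Phi> u \<le> 0} - {0})"

end

theory Submission
  imports Defs
begin

text \<open>
  Write \<open>M\<close> for the level set \<open>I = 1\<close>, \<open>A\<close> and \<open>B\<close> for the two linked subsets of \<open>M\<close>, and \<open>\<Phi>\<^sup>0\<close> for
  the sublevel set \<open>\<Phi> \<le> 0\<close>. Two facts carry the proof.

  The index produces a class. A double cover \<open>A \<rightarrow> A/\<plusminus>\<close> is described by a function \<open>\<sigma>\<close> with values in
  the field of two elements and \<open>\<sigma>(-u) = \<sigma>(u) + 1\<close>, as discontinuous as one likes: the coboundary of
  \<open>\<sigma>\<close> is invariant under the antipode and, as a cochain on the quotient, represents the pullback of
  the generator \<open>\<omega>\<close>. Put \<open>e\<^sub>n = (d\<sigma>)\<^sup>n\<close>. If \<open>i(M - B) = k\<close>, then \<open>e\<^sub>k = db\<close> locally for an invariant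
  cochain \<open>b\<close>, hence \<open>c = b + e\<^bsub>k-1\<^esub> \<union> \<sigma>\<close> is a cocycle on \<open>M - B\<close>, and \<open>c(x) + c(-x) = e\<^bsub>k-1\<^esub>\<close>. If \<open>c\<close> were
  the coboundary of \<open>\<beta>\<close> on \<open>A\<close>, then \<open>e\<^bsub>k-1\<^esub>\<close> would be the coboundary of the invariant cochain
  \<open>\<beta>(x) + \<beta>(-x)\<close>, contrary to \<open>i(A) = k\<close>. So \<open>c\<close> is a class of degree \<open>k - 1\<close> on \<open>M - B\<close> with a nonzero
  restriction to \<open>A\<close> (in reduced cohomology if \<open>k = 1\<close>). This is the part of the transfer sequence of
  the double cover that is needed, written out with cochains: lemmas \<open>index_class\<close>,
  \<open>cup_power_transition_independent\<close> and theorem \<open>index_separating_class\<close>.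

  The class obstructs an extension over the origin. Let \<open>r\<close> move every nonzero vector along its
  scaling curve to \<open>M\<close>. A point of \<open>\<Phi>\<^sup>0\<close> near the origin cannot project into \<open>B\<close>, so \<open>c\<close> pulls back under
  \<open>r\<close> to a punctured neighbourhood of \<open>0\<close> in \<open>\<Phi>\<^sup>0\<close>. The coboundary of any extension of this cochain
  over \<open>0\<close>, cut off away from \<open>0\<close>, is a relative cocycle of degree \<open>k\<close>. If it were a relative
  coboundary, the pullback of \<open>c\<close> would agree near \<open>0\<close>, up to a cochain that is locally zero off \<open>0\<close>,
  with a cochain whose coboundary vanishes on all tuples of a whole neighbourhood \<open>W\<close> of \<open>0\<close>. Such a
  cochain is a coboundary: insert \<open>0\<close> as the cone vertex. But \<open>W\<close> contains a scaled-down copy of \<open>A\<close> that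
  \<open>r\<close> projects identically onto \<open>A\<close>, so \<open>c\<close> would be a coboundary on \<open>A\<close>. This is theorem
  \<open>local_cohomology_nontrivial\<close>.

  Since the index is defined through \<open>\<omega>\<close> as the only nonzero class in \<open>H\<^sup>1\<close> of the infinite projective
  space, that uniqueness has to be established. It follows from \<open>H\<^sup>1(S\<^sup>\<infinity>) = 0\<close>, which is proved by summing
  a cocycle along explicit paths to a base point (lemmas \<open>primitive_along_paths\<close> and
  \<open>cocycle_infinite_sphere_exact\<close>). It also yields \<open>\<sigma>\<close>: the pullback of \<open>\<omega>\<close> to the sphere has a primitive
  \<open>g\<close> with \<open>g(-x) = g(x) + 1\<close>, and \<open>\<sigma> = g \<circ> F\<close> for an equivariant map \<open>F\<close> covering a classifying map.
\<close>

section \<open>Cochains and the Leibniz rule\<close>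

text \<open>This library rule, too, turns products of bits into case distinctions.\<close>

declare mult_bit_eq_and [simp del]

lemma add_eq_0_iff_bit: "b + c = 0 \<longleftrightarrow> b = c" for b c :: bit
  by (cases b; cases c; simp)

lemma coboundary_pullback: "coboundary (\<lambda>xs. \<phi> (map f xs)) xs = coboundary \<phi> (map f xs)"
  by (simp add: coboundary_def take_map drop_map)

text \<open>
  The identity says that inserting a fixed first vertex is a contracting homotopy.
\<close>

lemma coboundary_Cons:
  "coboundary \<phi> (x # xs) = \<phi> xs + coboundary (\<lambda>ys. \<phi> (x # ys)) xs"
  by (simp add: coboundary_def sum.lessThan_Suc_shift del: sum.lessThan_Suc)

lemma locally_zero_cong:
  assumes "locally_zero q X \<phi>"
    and "\<And>xs. length xs = Suc q \<Longrightarrow> set xs \<subseteq> topspace X \<Longrightarrow> \<phi> xs = \<psi> xs"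
  shows "locally_zero q X \<psi>"
  unfolding locally_zero_def
proof
  fix x assume "x \<in> topspace X"
  then obtain U where U: "openin X U" "x \<in> U"
    "\<And>xs. length xs = Suc q \<Longrightarrow> set xs \<subseteq> U \<Longrightarrow> \<phi> xs = 0"
    using assms(1) unfolding locally_zero_def by meson
  moreover have "\<psi> xs = 0" if "length xs = Suc q" "set xs \<subseteq> U" for xs
    using that U(3)[of xs] assms(2)[of xs] openin_subset[OF U(1)] by force
  ultimately show "\<exists>U. openin X U \<and> x \<in> U \<and> (\<forall>xs. length xs = Suc q \<and> set xs \<subseteq> U \<longrightarrow> \<psi> xs = 0)"
    by blast
qed

lemma locally_zero_exact:
  assumes "\<And>xs. length xs = Suc q \<Longrightarrow> set xs \<subseteq> topspace X \<Longrightarrow> \<phi> xs = 0"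
  shows "locally_zero q X \<phi>"
  by (rule locally_zero_cong[OF locally_zero_0]) (simp add: assms)

lemma locally_zero_pullback:
  assumes "locally_zero q Y \<phi>" "continuous_map X Y f"
  shows "locally_zero q X (\<lambda>xs. \<phi> (map f xs))"
  unfolding locally_zero_def
proof
  fix x assume x: "x \<in> topspace X"
  then have "f x \<in> topspace Y"
    using assms(2) continuous_map_image_subset_topspace by fastforce
  then obtain U where U: "openin Y U" "f x \<in> U"
    "\<And>xs. length xs = Suc q \<Longrightarrow> set xs \<subseteq> U \<Longrightarrow> \<phi> xs = 0"
    using assms(1) unfolding locally_zero_def by meson
  let ?V = "{y \<in> topspace X. f y \<in> U}"
  have "openin X ?V"
    using openin_continuous_map_preimage[OF assms(2) U(1)] .
  moreover have "\<phi> (map f xs) = 0" if "length xs = Suc q" "set xs \<subseteq> ?V" for xs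
    using that by (intro U(3)) auto
  ultimately show "\<exists>U. openin X U \<and> x \<in> U \<and>
      (\<forall>xs. length xs = Suc q \<and> set xs \<subseteq> U \<longrightarrow> \<phi> (map f xs) = 0)"
    using x U(2) by (intro exI[of _ ?V]) auto
qed

lemma locally_zero_cup_left:
  assumes "locally_zero p X \<phi>"
  shows "locally_zero (p + q) X (cup_cochain p \<phi> \<psi>)"
  unfolding locally_zero_def
proof
  fix x assume "x \<in> topspace X"
  then obtain U where U: "openin X U" "x \<in> U"
    "\<And>xs. length xs = Suc p \<Longrightarrow> set xs \<subseteq> U \<Longrightarrow> \<phi> xs = 0"
    using assms(1) unfolding locally_zero_def by meson
  have "cup_cochain p \<phi> \<psi> xs = 0" if "length xs = Suc (p + q)" "set xs \<subseteq> U" for xs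
  proof -
    have "\<phi> (take (Suc p) xs) = 0"
      using that set_take_subset[of "Suc p" xs] by (intro U(3)) auto
    then show ?thesis by (simp add: cup_cochain_def)
  qed
  then show "\<exists>U. openin X U \<and> x \<in> U \<and>
      (\<forall>xs. length xs = Suc (p + q) \<and> set xs \<subseteq> U \<longrightarrow> cup_cochain p \<phi> \<psi> xs = 0)"
    using U by blast
qed

lemma locally_zero_cup_right:
  assumes "locally_zero q X \<psi>"
  shows "locally_zero (p + q) X (cup_cochain p \<phi> \<psi>)"
  unfolding locally_zero_def
proof
  fix x assume "x \<in> topspace X"
  then obtain U where U: "openin X U" "x \<in> U"
    "\<And>xs. length xs = Suc q \<Longrightarrow> set xs \<subseteq> U \<Longrightarrow> \<psi> xs = 0"
    using assms(1) unfolding locally_zero_def by meson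
  have "cup_cochain p \<phi> \<psi> xs = 0" if "length xs = Suc (p + q)" "set xs \<subseteq> U" for xs
  proof -
    have "\<psi> (drop p xs) = 0"
      using that set_drop_subset[of p xs] by (intro U(3)) auto
    then show ?thesis by (simp add: cup_cochain_def)
  qed
  then show "\<exists>U. openin X U \<and> x \<in> U \<and>
      (\<forall>xs. length xs = Suc (p + q) \<and> set xs \<subseteq> U \<longrightarrow> cup_cochain p \<phi> \<psi> xs = 0)"
    using U by blast
qed

lemma cup_cochain_add:
  "cup_cochain p (\<lambda>xs. \<phi> xs + \<phi>' xs) \<psi> xs = cup_cochain p \<phi> \<psi> xs + cup_cochain p \<phi>' \<psi> xs"
  "cup_cochain p \<phi> (\<lambda>xs. \<psi> xs + \<psi>' xs) xs = cup_cochain p \<phi> \<psi> xs + cup_cochain p \<phi> \<psi>' xs"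
  by (simp_all add: cup_cochain_def distrib_left distrib_right)

text \<open>
  Deleting an entry up to position \<open>p\<close> affects only the front factor of a cup product, deleting a
  later one only the back factor.
\<close>

lemma take_drop_face:
  assumes "length xs = Suc (Suc (p + q))"
  shows "i \<le> p \<Longrightarrow> take (Suc p) (take i xs @ drop (Suc i) xs) =
      take i (take (Suc (Suc p)) xs) @ drop (Suc i) (take (Suc (Suc p)) xs)"
    and "i \<le> p \<Longrightarrow> drop p (take i xs @ drop (Suc i) xs) = drop (Suc p) xs"
    and "i \<le> q \<Longrightarrow> take (Suc p) (take (Suc (p + i)) xs @ drop (Suc (Suc (p + i))) xs) = take (Suc p) xs"
    and "i \<le> q \<Longrightarrow> drop p (take (Suc (p + i)) xs @ drop (Suc (Suc (p + i))) xs) =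
      take (Suc i) (drop p xs) @ drop (Suc (Suc i)) (drop p xs)"
  using assms by (auto intro!: nth_equalityI simp: nth_append min_def ac_simps split: if_splits)

text \<open>
  The faces of the tuple are distributed over the two factors. Omitting the last entry of the front
  factor and omitting the first entry of the back factor give the same product, so these two terms of
  the right-hand side cancel.
\<close>

lemma coboundary_cup:
  assumes "length xs = Suc (Suc (p + q))"
  shows "coboundary (cup_cochain p \<phi> \<psi>) xs =
    cup_cochain (Suc p) (coboundary \<phi>) \<psi> xs + cup_cochain p \<phi> (coboundary \<psi>) xs"
proof -
  define d where "d = (\<lambda>i ys :: 'a list. take i ys @ drop (Suc i) ys)"
  have cob: "coboundary \<theta> ys = (\<Sum>i<length ys. \<theta> (d i ys))" for \<theta> ys
    by (simp add: coboundary_def d_def)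
  define L where "L = (\<Sum>i<Suc p. \<phi> (d i (take (Suc (Suc p)) xs)) * \<psi> (drop (Suc p) xs))"
  define R where "R = (\<Sum>i<Suc q. \<phi> (take (Suc p) xs) * \<psi> (d (Suc i) (drop p xs)))"
  \<comment> \<open>the summand that occurs in both factors and cancels\<close>
  define M where "M = \<phi> (take (Suc p) xs) * \<psi> (drop (Suc p) xs)"
  have "coboundary (cup_cochain p \<phi> \<psi>) xs = (\<Sum>i<Suc p + Suc q. cup_cochain p \<phi> \<psi> (d i xs))"
    using assms by (simp only: cob) simp
  also have "\<dots> = (\<Sum>i<Suc p. cup_cochain p \<phi> \<psi> (d i xs)) +
      (\<Sum>i<Suc q. cup_cochain p \<phi> \<psi> (d (Suc p + i) xs))"
    using sum.nat_group sum.atLeastLessThan_concat[of 0 "Suc p" "Suc p + Suc q"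
        "\<lambda>i. cup_cochain p \<phi> \<psi> (d i xs)"]
      sum.shift_bounds_nat_ivl[of "\<lambda>i. cup_cochain p \<phi> \<psi> (d i xs)" 0 "Suc p" "Suc q"]
    by (simp only: lessThan_atLeast0 add.commute[of _ "Suc p"]) simp
  also have "(\<Sum>i<Suc p. cup_cochain p \<phi> \<psi> (d i xs)) = L"
    unfolding L_def d_def cup_cochain_def
    by (intro sum.cong refl) (simp only: lessThan_iff less_Suc_eq_le take_drop_face[OF assms] add_Suc)
  also have "(\<Sum>i<Suc q. cup_cochain p \<phi> \<psi> (d (Suc p + i) xs)) = R"
    unfolding R_def d_def cup_cochain_def
    by (intro sum.cong refl) (simp only: lessThan_iff less_Suc_eq_le take_drop_face[OF assms] add_Suc)
  also have "L + R = (L + M) + (M + R)"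
    by (simp add: add.assoc)
  also have "L + M = cup_cochain (Suc p) (coboundary \<phi>) \<psi> xs"
  proof -
    have "d (Suc p) (take (Suc (Suc p)) xs) = take (Suc p) xs"
      using assms by (simp add: d_def min_def)
    then show ?thesis using assms
      by (simp add: L_def M_def cup_cochain_def cob sum_distrib_right distrib_right)
  qed
  also have "M + R = cup_cochain p \<phi> (coboundary \<psi>) xs"
  proof -
    have "d 0 (drop p xs) = drop (Suc p) xs"
      by (simp add: d_def)
    moreover have "length (drop p xs) = Suc (Suc q)"
      using assms by simp
    ultimately show ?thesis
      unfolding R_def M_def cup_cochain_def cob
      by (simp only: sum.lessThan_Suc_shift sum_distrib_left distrib_left)
  qed
  finally show ?thesis .
qed

section \<open>Cup powers of cohomology classes\<close>

lemma mem_cohomology_class: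
  "\<psi> \<in> cohomology_class q X A \<phi> \<longleftrightarrow> (\<lambda>xs. \<phi> xs + \<psi> xs) \<in> coboundaries q X A"
proof -
  have "\<psi> = (\<lambda>xs. (\<phi> xs + \<psi> xs) + \<phi> xs)"
    by (simp add: fun_eq_iff ac_simps)
  moreover have "(\<lambda>xs. \<phi> xs + (\<theta> xs + \<phi> xs)) = \<theta>" for \<theta> :: "'a cochain"
    by (simp add: fun_eq_iff ac_simps)
  ultimately show ?thesis
    unfolding r_coset_def
    by (auto intro!: bexI[of _ "\<lambda>xs. \<phi> xs + \<psi> xs"] simp: fun_eq_iff ac_simps)
qed

lemma coboundaries_add:
  "\<phi> \<in> coboundaries q X A \<Longrightarrow> \<psi> \<in> coboundaries q X A \<Longrightarrow> (\<lambda>xs. \<phi> xs + \<psi> xs) \<in> coboundaries q X A"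
  using subgroup.m_closed[OF subgroup_coboundaries, of \<phi> q X A \<psi>] by simp

lemma coboundaries_0 [simp]: "(\<lambda>xs. 0) \<in> coboundaries q X A"
  using subgroup.one_closed[OF subgroup_coboundaries, of q X A] by simp

lemma locally_zero_coboundaries: "locally_zero q X \<phi> \<Longrightarrow> \<phi> \<in> coboundaries q X A"
  by (cases q) (auto simp: coboundaries_def intro!: exI[of _ "\<lambda>xs. 0"])

lemma cohomology_class_eq_iff:
  "cohomology_class q X A \<phi> = cohomology_class q X A \<psi> \<longleftrightarrow> (\<lambda>xs. \<phi> xs + \<psi> xs) \<in> coboundaries q X A"
proof
  assume "cohomology_class q X A \<phi> = cohomology_class q X A \<psi>"
  moreover have "\<psi> \<in> cohomology_class q X A \<psi>"
    by (simp add: mem_cohomology_class)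
  ultimately show "(\<lambda>xs. \<phi> xs + \<psi> xs) \<in> coboundaries q X A"
    by (metis mem_cohomology_class)
next
  assume *: "(\<lambda>xs. \<phi> xs + \<psi> xs) \<in> coboundaries q X A"
  show "cohomology_class q X A \<phi> = cohomology_class q X A \<psi>"
  proof (rule Set.set_eqI)
    fix \<theta>
    have "(\<lambda>xs. (\<phi> xs + \<psi> xs) + (\<phi> xs + \<theta> xs)) = (\<lambda>xs. \<psi> xs + \<theta> xs)"
      "(\<lambda>xs. (\<phi> xs + \<psi> xs) + (\<psi> xs + \<theta> xs)) = (\<lambda>xs. \<phi> xs + \<theta> xs)"
      by (simp_all add: fun_eq_iff ac_simps)
    then show "\<theta> \<in> cohomology_class q X A \<phi> \<longleftrightarrow> \<theta> \<in> cohomology_class q X A \<psi>"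
      using coboundaries_add[OF *] unfolding mem_cohomology_class by metis
  qed
qed

lemma one_cohomology: "\<one>\<^bsub>cohomology q X A\<^esub> = coboundaries q X A"
  by (simp add: cohomology_def FactGroup_def)

lemma carrier_cohomology: "carrier (cohomology q X A) = cohomology_class q X A ` cocycles q X A"
  by (auto simp: cohomology_def FactGroup_def RCOSETS_def r_coset_def)

lemma cohomology_class_trivial_iff:
  "cohomology_class q X A \<phi> = \<one>\<^bsub>cohomology q X A\<^esub> \<longleftrightarrow> \<phi> \<in> coboundaries q X A"
proof -
  have "cohomology_class q X A (\<lambda>xs. 0) = coboundaries q X A"
    by (auto simp: r_coset_def)
  then show ?thesis
    unfolding one_cohomology using cohomology_class_eq_iff[of q X A \<phi> "\<lambda>xs. 0"] by simp
qed

lemma locally_zero_trivial_topology [simp]: "locally_zero q trivial_topology \<phi>"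
  by (simp add: locally_zero_def)

lemma cocycles_absolute: "\<phi> \<in> cocycles q X {} \<longleftrightarrow> locally_zero (Suc q) X (coboundary \<phi>)"
  by (simp add: cocycles_def)

text \<open>
  In degree zero, cochains on the empty list would contribute the constants as coboundaries; the
  side condition excludes them. Dropping it turns cohomology into reduced cohomology, and this is how
  the case \<open>k = 1\<close> of the theorem is treated together with the others.
\<close>

lemma coboundaries_absolute:
  "\<phi> \<in> coboundaries q X {} \<longleftrightarrow>
    (\<exists>\<psi>. (q = 0 \<longrightarrow> \<psi> [] = 0) \<and> locally_zero q X (\<lambda>xs. \<phi> xs + coboundary \<psi> xs))"
proof (cases q)
  case 0
  have "locally_zero 0 X (\<lambda>xs. \<phi> xs + coboundary \<psi> xs) \<longleftrightarrow> locally_zero 0 X \<phi>" if "\<psi> [] = 0" for \<psi>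
  proof -
    have "coboundary \<psi> xs = 0" if "length xs = Suc 0" for xs :: "'a list"
      using that \<open>\<psi> [] = 0\<close> by (simp add: coboundary_def)
    then show ?thesis by (simp add: locally_zero_def cong: conj_cong)
  qed
  then show ?thesis using 0 by (auto simp: coboundaries_def intro: exI[of _ "\<lambda>xs. 0"])
next
  case (Suc p)
  then show ?thesis by (simp add: coboundaries_def)
qed

lemma cup_coboundary_left:
  assumes "\<phi> \<in> coboundaries p X {}" "\<psi> \<in> cocycles q X {}"
  shows "cup_cochain p \<phi> \<psi> \<in> coboundaries (p + q) X {}"
proof (cases p)
  case 0
  then have "locally_zero p X \<phi>" using assms by (simp add: coboundaries_def)
  then show ?thesis by (intro locally_zero_coboundaries locally_zero_cup_left)
next
  case (Suc r)
  then obtain \<zeta> where \<zeta>: "locally_zero p X (\<lambda>xs. \<phi> xs + coboundary \<zeta> xs)"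
    using assms unfolding coboundaries_absolute by auto
  have "locally_zero (p + q) X (\<lambda>xs. cup_cochain p (\<lambda>xs. \<phi> xs + coboundary \<zeta> xs) \<psi> xs + cup_cochain r \<zeta> (coboundary \<psi>) xs)"
    using locally_zero_cup_right[of "Suc q" X "coboundary \<psi>" r \<zeta>] assms(2) Suc
    by (intro locally_zero_add locally_zero_cup_left \<zeta>) (simp add: cocycles_absolute)
  then have "locally_zero (p + q) X (\<lambda>xs. cup_cochain p \<phi> \<psi> xs + coboundary (cup_cochain r \<zeta> \<psi>) xs)"
    by (rule locally_zero_cong) (simp add: Suc coboundary_cup[of _ r q] cup_cochain_add add.assoc)
  then show ?thesis
    unfolding coboundaries_absolute using Suc by auto
qed

lemma cup_coboundary_right:
  assumes "\<phi> \<in> cocycles p X {}" "\<psi> \<in> coboundaries q X {}"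
  shows "cup_cochain p \<phi> \<psi> \<in> coboundaries (p + q) X {}"
proof (cases q)
  case 0
  then have "locally_zero q X \<psi>" using assms by (simp add: coboundaries_def)
  then show ?thesis by (intro locally_zero_coboundaries locally_zero_cup_right)
next
  case (Suc r)
  then obtain \<zeta> where \<zeta>: "locally_zero q X (\<lambda>xs. \<psi> xs + coboundary \<zeta> xs)"
    using assms unfolding coboundaries_absolute by auto
  have "locally_zero (p + q) X (\<lambda>xs. cup_cochain p \<phi> (\<lambda>xs. \<psi> xs + coboundary \<zeta> xs) xs + cup_cochain (Suc p) (coboundary \<phi>) \<zeta> xs)"
    using locally_zero_cup_left[of "Suc p" X "coboundary \<phi>" r \<zeta>] assms(1) Suc
    by (intro locally_zero_add locally_zero_cup_right \<zeta>) (simp add: cocycles_absolute)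
  then have "locally_zero (p + q) X (\<lambda>xs. cup_cochain p \<phi> \<psi> xs + coboundary (cup_cochain p \<phi> \<zeta>) xs)"
    by (rule locally_zero_cong) (simp add: Suc coboundary_cup[of _ p r] cup_cochain_add ac_simps)
  then show ?thesis
    unfolding coboundaries_absolute using Suc by (auto intro!: exI[of _ "cup_cochain p \<phi> \<zeta>"])
qed

lemma cocycles_add:
  "\<phi> \<in> cocycles q X A \<Longrightarrow> \<psi> \<in> cocycles q X A \<Longrightarrow> (\<lambda>xs. \<phi> xs + \<psi> xs) \<in> cocycles q X A"
  using subgroup.m_closed[OF subgroup_cocycles, of \<phi> q X A \<psi>] by simp

lemma cup_cocycles:
  assumes "\<phi> \<in> cocycles p X {}" "\<psi> \<in> cocycles q X {}"
  shows "cup_cochain p \<phi> \<psi> \<in> cocycles (p + q) X {}"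
proof -
  have "locally_zero (Suc (p + q)) X (\<lambda>xs. cup_cochain (Suc p) (coboundary \<phi>) \<psi> xs + cup_cochain p \<phi> (coboundary \<psi>) xs)"
    using assms locally_zero_cup_left[of "Suc p" X "coboundary \<phi>" q \<psi>]
      locally_zero_cup_right[of "Suc q" X "coboundary \<psi>" p \<phi>]
    by (intro locally_zero_add) (auto simp: cocycles_absolute)
  then show ?thesis unfolding cocycles_absolute
    by (rule locally_zero_cong) (simp add: coboundary_cup)
qed

text \<open>
  By the Leibniz rule, the product of a coboundary and a cocycle is a coboundary, so all
  representatives give the same class.
\<close>

lemma cup_cohomology_class:
  assumes "\<phi> \<in> cocycles p X {}" "\<psi> \<in> cocycles q X {}"
  shows "cup p q X (cohomology_class p X {} \<phi>) (cohomology_class q X {} \<psi>) =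
    cohomology_class (p + q) X {} (cup_cochain p \<phi> \<psi>)"
proof -
  have "cohomology_class (p + q) X {} (cup_cochain p \<phi>' \<psi>') =
      cohomology_class (p + q) X {} (cup_cochain p \<phi> \<psi>)"
    if "\<phi>' \<in> cohomology_class p X {} \<phi>" "\<psi>' \<in> cohomology_class q X {} \<psi>" for \<phi>' \<psi>'
  proof -
    have \<alpha>: "(\<lambda>xs. \<phi> xs + \<phi>' xs) \<in> coboundaries p X {}"
      and \<beta>: "(\<lambda>xs. \<psi> xs + \<psi>' xs) \<in> coboundaries q X {}"
      using that by (simp_all add: mem_cohomology_class)
    have "\<psi>' \<in> cocycles q X {}"
      using cocycles_add[OF assms(2) subsetD[OF coboundaries_subset_cocycles \<beta>]] by simp
    have "(\<lambda>xs. cup_cochain p (\<lambda>xs. \<phi> xs + \<phi>' xs) \<psi>' xs + cup_cochain p \<phi> (\<lambda>xs. \<psi> xs + \<psi>' xs) xs)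
        \<in> coboundaries (p + q) X {}"
      by (rule coboundaries_add[OF cup_coboundary_left[OF \<alpha> \<open>\<psi>' \<in> cocycles q X {}\<close>]
            cup_coboundary_right[OF assms(1) \<beta>]])
    then show ?thesis
      unfolding cohomology_class_eq_iff by (simp add: cup_cochain_add ac_simps)
  qed
  moreover have "\<phi> \<in> cohomology_class p X {} \<phi>" "\<psi> \<in> cohomology_class q X {} \<psi>"
    by (simp_all add: mem_cohomology_class)
  ultimately show ?thesis unfolding cup_def by blast
qed

lemma coboundaries_pullback:
  assumes "\<phi> \<in> coboundaries q Y {}" "continuous_map X Y f"
  shows "(\<lambda>xs. \<phi> (map f xs)) \<in> coboundaries q X {}"
proof -
  obtain \<psi> where \<psi>: "q = 0 \<longrightarrow> \<psi> [] = 0" "locally_zero q Y (\<lambda>xs. \<phi> xs + coboundary \<psi> xs)"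
    using assms(1) unfolding coboundaries_absolute by blast
  have "locally_zero q X (\<lambda>xs. \<phi> (map f xs) + coboundary (\<lambda>ys. \<psi> (map f ys)) xs)"
    using locally_zero_pullback[OF \<psi>(2) assms(2)] by (simp add: coboundary_pullback)
  then show ?thesis unfolding coboundaries_absolute using \<psi>(1)
    by (intro exI[of _ "\<lambda>ys. \<psi> (map f ys)"]) auto
qed

lemma induced_cohomology_class:
  assumes "continuous_map X Y f"
  shows "induced q X f (cohomology_class q Y {} \<phi>) = cohomology_class q X {} (\<lambda>xs. \<phi> (map f xs))"
proof -
  have "cohomology_class q X {} (\<lambda>xs. \<phi>' (map f xs)) = cohomology_class q X {} (\<lambda>xs. \<phi> (map f xs))"
    if "\<phi>' \<in> cohomology_class q Y {} \<phi>" for \<phi>'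
    using coboundaries_pullback[OF _ assms] that
    unfolding cohomology_class_eq_iff mem_cohomology_class by (simp add: add.commute)
  moreover have "\<phi> \<in> cohomology_class q Y {} \<phi>"
    by (simp add: mem_cohomology_class)
  ultimately show ?thesis unfolding induced_def by blast
qed

primrec cup_power_cochain :: "'a cochain \<Rightarrow> nat \<Rightarrow> 'a cochain" where
  "cup_power_cochain \<theta> 0 = (\<lambda>xs. 1)"
| "cup_power_cochain \<theta> (Suc n) = cup_cochain n (cup_power_cochain \<theta> n) \<theta>"

lemma coboundary_cup_power_cochain:
  assumes "coboundary \<theta> = (\<lambda>xs. 0)" "length xs = Suc (Suc n)"
  shows "coboundary (cup_power_cochain \<theta> n) xs = 0"
  using assms(2)
proof (induction n arbitrary: xs)
  case 0
  then show ?case by (simp add: coboundary_def)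
next
  case (Suc n)
  then have "coboundary (cup_power_cochain \<theta> n) (take (Suc (Suc n)) xs) = 0"
    by (intro Suc.IH) simp
  then show ?case
    using Suc.prems coboundary_cup[of xs n 1 "cup_power_cochain \<theta> n" \<theta>]
    by (simp add: cup_cochain_def[of "Suc n"] cup_cochain_def[of _ _ "\<lambda>xs. 0"] assms(1))
qed

lemma cup_power_cochain_cocycle:
  assumes "\<theta> \<in> cocycles 1 X {}"
  shows "cup_power_cochain \<theta> n \<in> cocycles n X {}"
proof (induction n)
  case 0
  then show ?case unfolding cocycles_absolute
    by (intro locally_zero_exact) (simp add: coboundary_def)
next
  case (Suc n)
  then show ?case using cup_cocycles[OF Suc assms] by simp
qed

lemma cup_power_cohomology_class:
  assumes "\<theta> \<in> cocycles 1 X {}"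
  shows "cup_power X (cohomology_class 1 X {} \<theta>) n = cohomology_class n X {} (cup_power_cochain \<theta> n)"
proof (induction n)
  case (Suc n)
  then show ?case
    using cup_cohomology_class[OF cup_power_cochain_cocycle[OF assms] assms, of n]
    by simp
qed simp

lemma cup_power_cochain_pullback:
  "cup_power_cochain (\<lambda>xs. \<theta> (map f xs)) n xs = cup_power_cochain \<theta> n (map f xs)"
  by (induction n arbitrary: xs) (simp_all add: cup_cochain_def take_map drop_map)

lemma locally_zero_cup_power:
  assumes "locally_zero 1 X (\<lambda>xs. \<theta> xs + \<theta>' xs)"
  shows "locally_zero n X (\<lambda>xs. cup_power_cochain \<theta> n xs + cup_power_cochain \<theta>' n xs)"
proof (induction n)
  case (Suc n)
  have "locally_zero (n + 1) X (\<lambda>xs.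
      cup_cochain n (\<lambda>xs. cup_power_cochain \<theta> n xs + cup_power_cochain \<theta>' n xs) \<theta> xs +
      cup_cochain n (cup_power_cochain \<theta>' n) (\<lambda>xs. \<theta> xs + \<theta>' xs) xs)"
    by (rule locally_zero_add[OF locally_zero_cup_left[OF Suc] locally_zero_cup_right[OF assms]])
  then show ?case by (simp add: cup_cochain_add ac_simps)
qed simp

section \<open>Cohomology of the quotient by a free involution\<close>

text \<open>
  The relation \<open>close\<close> selects sheets of the double cover that identifies \<open>x\<close> with \<open>- x\<close>: points
  near each other are close, and no point is close to both points of a pair. Hence a tuple of pairs
  has at most two lifts with pairwise close entries, and these are exchanged by the involution.
\<close>

locale antipodal_space =
  fixes X :: "'a::uminus topology" and close :: "'a \<Rightarrow> 'a \<Rightarrow> bool"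
  assumes minus_minus: "x \<in> topspace X \<Longrightarrow> - (- x) = x"
    and openin_uminus: "openin X U \<Longrightarrow> openin X (uminus ` U)"
    and close_nbhd: "x \<in> topspace X \<Longrightarrow> \<exists>U. openin X U \<and> x \<in> U \<and> (\<forall>y\<in>U. \<forall>z\<in>U. close y z)"
    and not_close_uminus: "close x y \<Longrightarrow> \<not> close x (- y)"
    and close_uminus: "close x y \<Longrightarrow> close (- x) (- y)"
begin

lemma uminus_in_topspace: "x \<in> topspace X \<Longrightarrow> - x \<in> topspace X"
  using openin_subset[OF openin_uminus[OF openin_topspace]] by auto

lemma continuous_map_antipodal_quotient: "continuous_map X (antipodal_quotient X) (\<lambda>x. {x, - x})"
  unfolding antipodal_quotient_def
  by (rule quotient_imp_continuous_map[OF quotient_map_quotient_topology])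

lemma openin_antipodal_quotient_image:
  assumes "openin X U"
  shows "openin (antipodal_quotient X) ((\<lambda>x. {x, - x}) ` U)"
proof -
  have sub: "U \<subseteq> topspace X"
    using openin_subset[OF assms] .
  have "{x \<in> topspace X. {x, - x} \<in> (\<lambda>x. {x, - x}) ` U} = U \<union> uminus ` U"
  proof (intro equalityI subsetI)
    fix x assume "x \<in> {x \<in> topspace X. {x, - x} \<in> (\<lambda>x. {x, - x}) ` U}"
    then obtain u where "x \<in> topspace X" "u \<in> U" "{x, - x} = {u, - u}" by auto
    then show "x \<in> U \<union> uminus ` U" by (metis UnI1 UnI2 doubleton_eq_iff imageI)
  next
    fix x assume "x \<in> U \<union> uminus ` U"
    then show "x \<in> {x \<in> topspace X. {x, - x} \<in> (\<lambda>x. {x, - x}) ` U}"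
      using sub uminus_in_topspace minus_minus by (force simp: insert_commute)
  qed
  then show ?thesis
    using sub openin_Un[OF assms openin_uminus[OF assms]]
    unfolding antipodal_quotient_def openin_quotient_topology by auto
qed

text \<open>
  The projection is open, and a tuple of pairs close to \<open>{x, - x}\<close> lifts to a tuple of points close
  to \<open>x\<close>.
\<close>

lemma locally_zero_antipodal_quotient:
  "locally_zero q (antipodal_quotient X) \<phi> \<longleftrightarrow> locally_zero q X (\<lambda>xs. \<phi> (map (\<lambda>x. {x, - x}) xs))"
proof
  assume "locally_zero q (antipodal_quotient X) \<phi>"
  then show "locally_zero q X (\<lambda>xs. \<phi> (map (\<lambda>x. {x, - x}) xs))"
    by (rule locally_zero_pullback[OF _ continuous_map_antipodal_quotient])
next
  assume *: "locally_zero q X (\<lambda>xs. \<phi> (map (\<lambda>x. {x, - x}) xs))"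
  show "locally_zero q (antipodal_quotient X) \<phi>"
    unfolding locally_zero_def
  proof
    fix P assume "P \<in> topspace (antipodal_quotient X)"
    then obtain x where x: "x \<in> topspace X" "P = {x, - x}"
      by (auto simp: antipodal_quotient_def)
    then obtain U where U: "openin X U" "x \<in> U"
      "\<And>xs. length xs = Suc q \<Longrightarrow> set xs \<subseteq> U \<Longrightarrow> \<phi> (map (\<lambda>x. {x, - x}) xs) = 0"
      using * unfolding locally_zero_def by meson
    have "\<phi> Ps = 0" if Ps: "length Ps = Suc q" "set Ps \<subseteq> (\<lambda>x. {x, - x}) ` U" for Ps
    proof -
      have "Ps \<in> lists ((\<lambda>x. {x, - x}) ` U)"
        using Ps(2) by auto
      then obtain xs where "Ps = map (\<lambda>x. {x, - x}) xs" "set xs \<subseteq> U"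
        unfolding lists_image by auto
      then show ?thesis using U(3) Ps(1) by simp
    qed
    then show "\<exists>V. openin (antipodal_quotient X) V \<and> P \<in> V \<and>
        (\<forall>Ps. length Ps = Suc q \<and> set Ps \<subseteq> V \<longrightarrow> \<phi> Ps = 0)"
      using openin_antipodal_quotient_image[OF U(1)] U(2) x(2) by blast
  qed
qed

text \<open>
  The sign of the first entry determines the signs of all others.
\<close>

lemma lift_unique_up_to_sign:
  assumes "set xs \<subseteq> topspace X" "\<forall>y\<in>set xs. \<forall>z\<in>set xs. close y z"
    and "set ys \<subseteq> topspace X" "\<forall>y\<in>set ys. \<forall>z\<in>set ys. close y z"
    and "map (\<lambda>x. {x, - x}) xs = map (\<lambda>x. {x, - x}) ys"
  shows "ys = xs \<or> ys = map uminus xs"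
proof (cases xs)
  case Nil
  then show ?thesis using assms(5) by simp
next
  case (Cons x xs')
  have len: "length ys = length xs"
    using assms(5) map_eq_imp_length_eq by metis
  have pair: "ys ! i = xs ! i \<or> ys ! i = - (xs ! i)" if "i < length xs" for i
  proof -
    have "{xs ! i, - (xs ! i)} = {ys ! i, - (ys ! i)}"
      using that len assms(5) by (metis (no_types, lifting) nth_map)
    then show ?thesis by blast
  qed
  have len0: "0 < length xs" using Cons by simp
  have cx: "close (xs ! 0) (xs ! i)" and cy: "close (ys ! 0) (ys ! i)" if "i < length xs" for i
    using assms(2,4) that len len0 by (metis nth_mem)+
  show ?thesis
  proof (cases "ys ! 0 = xs ! 0")
    case True
    have "ys ! i = xs ! i" if "i < length xs" for i
      using pair[OF that] cx[OF that] cy[OF that] not_close_uminus True by metis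
    then show ?thesis using len by (simp add: nth_equalityI)
  next
    case False
    then have *: "ys ! 0 = - (xs ! 0)" using pair len0 by blast
    have "ys ! i = - (xs ! i)" if "i < length xs" for i
    proof (rule ccontr)
      assume "ys ! i \<noteq> - (xs ! i)"
      then have "close (- (xs ! 0)) (xs ! i)"
        using pair[OF that] cy[OF that] * by metis
      then show False
        using close_uminus[OF cx[OF that]] not_close_uminus by blast
    qed
    then show ?thesis using len by (simp add: nth_equalityI)
  qed
qed

text \<open>
  Evaluate \<open>b\<close> at any lift with pairwise close entries; the two choices give the same value.
\<close>

lemma invariant_cochain_descends:
  assumes "\<And>xs. set xs \<subseteq> topspace X \<Longrightarrow> b (map uminus xs) = b xs"
  obtains b' where "\<And>xs. set xs \<subseteq> topspace X \<Longrightarrow> \<forall>y\<in>set xs. \<forall>z\<in>set xs. close y z \<Longrightarrow>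
    b' (map (\<lambda>x. {x, - x}) xs) = b xs"
proof
  define lift where "lift = (\<lambda>xs Ps. set xs \<subseteq> topspace X \<and> (\<forall>y\<in>set xs. \<forall>z\<in>set xs. close y z) \<and>
    map (\<lambda>x. {x, - x}) xs = Ps)"
  fix xs assume "set xs \<subseteq> topspace X" "\<forall>y\<in>set xs. \<forall>z\<in>set xs. close y z"
  then have xs: "lift xs (map (\<lambda>x. {x, - x}) xs)" (is "lift xs ?Ps")
    by (simp add: lift_def)
  then have "lift (SOME ys. lift ys ?Ps) ?Ps"
    by (rule someI[of "\<lambda>ys. lift ys ?Ps"])
  then have "(SOME ys. lift ys ?Ps) = xs \<or> (SOME ys. lift ys ?Ps) = map uminus xs"
    using xs unfolding lift_def by (intro lift_unique_up_to_sign) auto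
  then show "(\<lambda>Ps. b (SOME ys. lift ys Ps)) ?Ps = b xs"
    using assms xs unfolding lift_def by auto
qed

lemma locally_zero_if_close:
  assumes "\<And>xs. length xs = Suc q \<Longrightarrow> set xs \<subseteq> topspace X \<Longrightarrow> \<forall>y\<in>set xs. \<forall>z\<in>set xs. close y z \<Longrightarrow> \<phi> xs = 0"
  shows "locally_zero q X \<phi>"
  unfolding locally_zero_def
proof
  fix x assume "x \<in> topspace X"
  then obtain U where U: "openin X U" "x \<in> U" "\<forall>y\<in>U. \<forall>z\<in>U. close y z"
    using close_nbhd by blast
  then have "\<phi> xs = 0" if "length xs = Suc q" "set xs \<subseteq> U" for xs
    using that openin_subset[OF U(1)] by (intro assms) blast+
  then show "\<exists>U. openin X U \<and> x \<in> U \<and> (\<forall>xs. length xs = Suc q \<and> set xs \<subseteq> U \<longrightarrow> \<phi> xs = 0)"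
    using U by blast
qed

end

text \<open>
  The coboundaries of invariant cochains, up to locally zero cochains. Pulled back from the quotient by
  the involution, coboundaries have invariant primitives.
\<close>

definition antipodal_coboundaries :: "nat \<Rightarrow> 'a::uminus topology \<Rightarrow> 'a cochain set" where
  "antipodal_coboundaries n X = {\<phi>. \<exists>b. (\<forall>xs. set xs \<subseteq> topspace X \<longrightarrow> b (map uminus xs) = b xs) \<and>
     (n = 0 \<longrightarrow> b [] = 0) \<and> locally_zero n X (\<lambda>xs. \<phi> xs + coboundary b xs)}"

context antipodal_space
begin

lemma coboundaries_antipodal_quotient:
  "\<phi> \<in> coboundaries n (antipodal_quotient X) {} \<longleftrightarrow>
    (\<lambda>xs. \<phi> (map (\<lambda>x. {x, - x}) xs)) \<in> antipodal_coboundaries n X"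
proof
  assume "\<phi> \<in> coboundaries n (antipodal_quotient X) {}"
  then obtain \<psi> where \<psi>: "n = 0 \<longrightarrow> \<psi> [] = 0"
    "locally_zero n (antipodal_quotient X) (\<lambda>xs. \<phi> xs + coboundary \<psi> xs)"
    unfolding coboundaries_absolute by blast
  let ?b = "\<lambda>xs. \<psi> (map (\<lambda>x. {x, - x}) xs)"
  have "?b (map uminus xs) = ?b xs" if "set xs \<subseteq> topspace X" for xs
  proof -
    have "map (\<lambda>x. {x, - x}) (map uminus xs) = map (\<lambda>x. {x, - x}) xs"
      using that minus_minus by (auto simp: insert_commute)
    then show ?thesis by (simp only:)
  qed
  moreover have "locally_zero n X (\<lambda>xs. \<phi> (map (\<lambda>x. {x, - x}) xs) + coboundary ?b xs)"
    using \<psi>(2) unfolding locally_zero_antipodal_quotient coboundary_pullback .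
  ultimately show "(\<lambda>xs. \<phi> (map (\<lambda>x. {x, - x}) xs)) \<in> antipodal_coboundaries n X"
    unfolding antipodal_coboundaries_def using \<psi>(1)
    by (intro CollectI exI[of _ ?b] conjI) auto
next
  assume "(\<lambda>xs. \<phi> (map (\<lambda>x. {x, - x}) xs)) \<in> antipodal_coboundaries n X"
  then obtain b where b: "\<And>xs. set xs \<subseteq> topspace X \<Longrightarrow> b (map uminus xs) = b xs"
    "n = 0 \<longrightarrow> b [] = 0" "locally_zero n X (\<lambda>xs. \<phi> (map (\<lambda>x. {x, - x}) xs) + coboundary b xs)"
    unfolding antipodal_coboundaries_def by blast
  obtain b' where b': "\<And>xs. set xs \<subseteq> topspace X \<Longrightarrow> \<forall>y\<in>set xs. \<forall>z\<in>set xs. close y z \<Longrightarrow>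
      b' (map (\<lambda>x. {x, - x}) xs) = b xs"
    using invariant_cochain_descends[of b] b(1) by blast
  have "locally_zero n X (\<lambda>xs. coboundary b xs + coboundary (\<lambda>ys. b' (map (\<lambda>x. {x, - x}) ys)) xs)"
  proof (rule locally_zero_if_close)
    fix xs assume xs: "set xs \<subseteq> topspace X" "\<forall>y\<in>set xs. \<forall>z\<in>set xs. close y z"
    have "b' (map (\<lambda>x. {x, - x}) (take i xs @ drop (Suc i) xs)) = b (take i xs @ drop (Suc i) xs)" for i
      using xs by (intro b') (auto dest!: in_set_takeD in_set_dropD)
    then have "coboundary (\<lambda>ys. b' (map (\<lambda>x. {x, - x}) ys)) xs = coboundary b xs"
      unfolding coboundary_def by presburger
    then show "coboundary b xs + coboundary (\<lambda>ys. b' (map (\<lambda>x. {x, - x}) ys)) xs = 0"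
      by simp
  qed
  from locally_zero_add[OF b(3) this]
  have "locally_zero n (antipodal_quotient X) (\<lambda>xs. \<phi> xs + coboundary b' xs)"
    unfolding locally_zero_antipodal_quotient by (simp add: coboundary_pullback add.assoc)
  moreover have "b' [] = b []"
    using b'[of "[]"] by simp
  ultimately show "\<phi> \<in> coboundaries n (antipodal_quotient X) {}"
    unfolding coboundaries_absolute using b(2) by auto
qed

end

section \<open>Primitives of one-cocycles along paths\<close>

lemma locally_constant_on_interval:
  fixes h :: "real \<Rightarrow> 'b"
  assumes "a \<le> b"
    and local: "\<And>x. a \<le> x \<Longrightarrow> x \<le> b \<Longrightarrow> \<exists>d>0. \<forall>s\<in>{a..b}. \<bar>s - x\<bar> < d \<longrightarrow> h s = h x"
  shows "h a = h b"
proof -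
  have "a \<le> a \<and> b \<le> b \<longrightarrow> h a = h b"
    using assms(1)
  proof (induct rule: Bolzano[where P = "\<lambda>s t. a \<le> s \<and> t \<le> b \<longrightarrow> h s = h t"])
    case (trans s t u)
    then show ?case by auto
  next
    case (local x)
    then obtain d where d: "d > 0" "\<And>s. s \<in> {a..b} \<Longrightarrow> \<bar>s - x\<bar> < d \<Longrightarrow> h s = h x"
      using assms(2) by blast
    have "h s = h t" if "s \<le> x" "x \<le> t" "t - s < d" "a \<le> s" "t \<le> b" for s t
    proof -
      have "h s = h x" "h t = h x"
        using that d(1) by (intro d(2); auto)+
      then show ?thesis by (rule trans[OF _ sym])
    qed
    then show ?case using d(1) by blast
  qed
  then show ?thesis by simp
qed

text \<open>
  Rearrangements in characteristic two, mostly of the cocycle identity \<open>p + q + r = 0\<close> on the edges of a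
  triangle.
\<close>

lemma bit_sums:
  fixes p q r p' q' u v w u' :: bit
  shows "p + q + r = 0 \<Longrightarrow> p + r = q"
    and "p + q + r = 0 \<Longrightarrow> p' + q' + r = 0 \<Longrightarrow> p + q' = p' + q"
    and "u + v = p \<Longrightarrow> w + u' = q \<Longrightarrow> p + q + r = 0 \<Longrightarrow> u + (u' + (w + v)) = r"
    and "u + v = q \<Longrightarrow> p + q + r = 0 \<Longrightarrow> u + p = v + r"
    and "u + w = v + r \<Longrightarrow> w = 0 \<Longrightarrow> u + v = r"
    and "p + q + r = 0 \<Longrightarrow> p + u = r + v \<Longrightarrow> u + v = q"
    and "p + q = r + u \<Longrightarrow> p + r = q + u"
        apply (cases p; cases q; cases r; simp)
       apply (cases p; cases q; cases r; cases p'; cases q'; simp)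
      apply (cases p; cases q; cases r; cases u; cases v; cases w; cases u'; simp)
     apply (cases p; cases q; cases r; cases u; cases v; simp)
    apply (cases r; cases u; cases v; simp)
   apply (cases p; cases q; cases r; cases u; cases v; simp)
  apply (cases p; cases q; cases r; cases u; simp)
  done

text \<open>
  \<open>f\<close> has coboundary \<open>\<psi>\<close> near the diagonal of the interval.
\<close>

definition local_primitive :: "(real \<Rightarrow> real \<Rightarrow> bit) \<Rightarrow> real \<Rightarrow> real \<Rightarrow> (real \<Rightarrow> bit) \<Rightarrow> bool" where
  "local_primitive \<psi> a b f \<longleftrightarrow> (\<forall>x\<in>{a..b}. \<exists>d>0. \<forall>s\<in>{a..b}. \<forall>t\<in>{a..b}.
     \<bar>s - x\<bar> < d \<longrightarrow> \<bar>t - x\<bar> < d \<longrightarrow> f s + f t = \<psi> s t)"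

lemma local_primitiveE:
  assumes "local_primitive \<psi> a b f" "a \<le> x" "x \<le> b"
  obtains d where "d > 0" "\<And>s t. a \<le> s \<Longrightarrow> s \<le> b \<Longrightarrow> a \<le> t \<Longrightarrow> t \<le> b \<Longrightarrow>
    \<bar>s - x\<bar> < d \<Longrightarrow> \<bar>t - x\<bar> < d \<Longrightarrow> f s + f t = \<psi> s t"
proof -
  have "x \<in> {a..b}" using assms by simp
  then obtain d where "d > 0" and d: "\<forall>s\<in>{a..b}. \<forall>t\<in>{a..b}.
      \<bar>s - x\<bar> < d \<longrightarrow> \<bar>t - x\<bar> < d \<longrightarrow> f s + f t = \<psi> s t"
    using assms(1) unfolding local_primitive_def by blast
  show ?thesis
  proof (rule that[OF \<open>d > 0\<close>])
    fix s t assume "a \<le> s" "s \<le> b" "a \<le> t" "t \<le> b" and st: "\<bar>s - x\<bar> < d" "\<bar>t - x\<bar> < d"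
    then have "s \<in> {a..b}" "t \<in> {a..b}" by simp_all
    then show "f s + f t = \<psi> s t" using d st by blast
  qed
qed

lemma bit_cocycle_sym:
  fixes \<psi> :: "'x \<Rightarrow> 'x \<Rightarrow> bit"
  assumes "\<And>r s t. r \<in> W \<Longrightarrow> s \<in> W \<Longrightarrow> t \<in> W \<Longrightarrow> \<psi> r s + \<psi> s t + \<psi> r t = 0"
    and "r \<in> W" "s \<in> W"
  shows "\<psi> r r = 0" "\<psi> r s = \<psi> s r"
proof -
  show *: "\<psi> r r = 0"
    using assms(1)[of r r r] assms(2) by simp
  show "\<psi> r s = \<psi> s r"
    using assms(1)[of r s r] assms(2,3) * by (simp add: add_eq_0_iff_bit)
qed

text \<open>
  By bisection: near \<open>x\<close> the function \<open>\<psi> x\<close> is a primitive by the cocycle identity, and primitives on two adjacent intervals are glued after adding to the second one the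
  constant that makes them agree at the common endpoint.
\<close>

lemma local_primitive_exists:
  assumes local: "\<And>x. 0 \<le> x \<Longrightarrow> x \<le> 1 \<Longrightarrow> \<exists>d>0. \<forall>r\<in>{0..1}. \<forall>s\<in>{0..1}. \<forall>t\<in>{0..1}.
     \<bar>r - x\<bar> < d \<longrightarrow> \<bar>s - x\<bar> < d \<longrightarrow> \<bar>t - x\<bar> < d \<longrightarrow> \<psi> r s + \<psi> s t + \<psi> r t = 0"
  shows "\<exists>f. local_primitive \<psi> 0 1 f"
proof -
  have "(0::real) \<le> 0 \<and> (1::real) \<le> 1 \<longrightarrow> (\<exists>f. local_primitive \<psi> 0 1 f)"
    using zero_le_one
  proof (induct rule: Bolzano[where P = "\<lambda>s t. 0 \<le> s \<and> t \<le> 1 \<longrightarrow> (\<exists>f. local_primitive \<psi> s t f)"])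
    case (trans a b c)
    show ?case
    proof
      assume ac: "0 \<le> a \<and> c \<le> 1"
      obtain f1 f2 where f1: "local_primitive \<psi> a b f1" and f2: "local_primitive \<psi> b c f2"
        using trans ac by auto
      define f where "f = (\<lambda>t. if t \<le> b then f1 t else f2 t + (f2 b + f1 b))"
      have "\<exists>d>0. \<forall>s\<in>{a..c}. \<forall>t\<in>{a..c}. \<bar>s - x\<bar> < d \<longrightarrow> \<bar>t - x\<bar> < d \<longrightarrow> f s + f t = \<psi> s t"
        if x: "x \<in> {a..c}" for x
      proof -
        consider "x < b" | "x > b" | "x = b" by linarith
        then show ?thesis
        proof cases
          case 1
          with x obtain d where d: "d > 0" "\<And>s t. a \<le> s \<Longrightarrow> s \<le> b \<Longrightarrow> a \<le> t \<Longrightarrow> t \<le> b \<Longrightarrow>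
              \<bar>s - x\<bar> < d \<Longrightarrow> \<bar>t - x\<bar> < d \<Longrightarrow> f1 s + f1 t = \<psi> s t"
            using local_primitiveE[OF f1, of x] by (metis atLeastAtMost_iff less_imp_le)
          show ?thesis
          proof (intro exI[of _ "min d (b - x)"] conjI ballI impI)
            fix s t assume "s \<in> {a..c}" "t \<in> {a..c}" "\<bar>s - x\<bar> < min d (b - x)" "\<bar>t - x\<bar> < min d (b - x)"
            then have *: "a \<le> s" "s \<le> b" "a \<le> t" "t \<le> b" "\<bar>s - x\<bar> < d" "\<bar>t - x\<bar> < d" by auto
            from d(2)[OF *] show "f s + f t = \<psi> s t"
              using *(2,4) by (simp add: f_def)
          qed (use d 1 in simp)
        next
          case 2
          with x obtain d where d: "d > 0" "\<And>s t. b \<le> s \<Longrightarrow> s \<le> c \<Longrightarrow> b \<le> t \<Longrightarrow> t \<le> c \<Longrightarrow>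
              \<bar>s - x\<bar> < d \<Longrightarrow> \<bar>t - x\<bar> < d \<Longrightarrow> f2 s + f2 t = \<psi> s t"
            using local_primitiveE[OF f2, of x] by (metis atLeastAtMost_iff less_imp_le)
          show ?thesis
          proof (intro exI[of _ "min d (x - b)"] conjI ballI impI)
            fix s t assume "s \<in> {a..c}" "t \<in> {a..c}" "\<bar>s - x\<bar> < min d (x - b)" "\<bar>t - x\<bar> < min d (x - b)"
            then have *: "b < s" "s \<le> c" "b < t" "t \<le> c" "\<bar>s - x\<bar> < d" "\<bar>t - x\<bar> < d" by auto
            from d(2)[of s t] * show "f s + f t = \<psi> s t"
              by (simp add: f_def ac_simps)
          qed (use d 2 in simp)
        next
          case 3
          obtain d1 where d1: "d1 > 0" "\<And>s t. a \<le> s \<Longrightarrow> s \<le> b \<Longrightarrow> a \<le> t \<Longrightarrow> t \<le> b \<Longrightarrow>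
              \<bar>s - b\<bar> < d1 \<Longrightarrow> \<bar>t - b\<bar> < d1 \<Longrightarrow> f1 s + f1 t = \<psi> s t"
            using local_primitiveE[OF f1 \<open>a \<le> b\<close> order_refl] by blast
          obtain d2 where d2: "d2 > 0" "\<And>s t. b \<le> s \<Longrightarrow> s \<le> c \<Longrightarrow> b \<le> t \<Longrightarrow> t \<le> c \<Longrightarrow>
              \<bar>s - b\<bar> < d2 \<Longrightarrow> \<bar>t - b\<bar> < d2 \<Longrightarrow> f2 s + f2 t = \<psi> s t"
            using local_primitiveE[OF f2 order_refl \<open>b \<le> c\<close>] by blast
          have b: "0 \<le> b" "b \<le> 1" using trans ac by auto
          define B where "B = (\<lambda>d. {r \<in> {0..1}. \<bar>r - b\<bar> < d})"
          obtain d3 where d3: "d3 > 0" "\<And>r s t. r \<in> B d3 \<Longrightarrow> s \<in> B d3 \<Longrightarrow> t \<in> B d3 \<Longrightarrow> \<psi> r s + \<psi> s t + \<psi> r t = 0"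
            using local[OF b] unfolding B_def by blast
          have B: "r \<in> B d3" if "a \<le> r" "r \<le> c" "\<bar>r - b\<bar> < d3" for r
            using that ac by (simp add: B_def)
          define d where "d = min d1 (min d2 d3)"
          have d: "d > 0" "d \<le> d1" "d \<le> d2" "d \<le> d3" using d1 d2 d3 by (auto simp: d_def)
          have "f s + f t = \<psi> s t"
            if s: "s \<in> {a..c}" "\<bar>s - x\<bar> < d" and t: "t \<in> {a..c}" "\<bar>t - x\<bar> < d" for s t
          proof -
            have mixed: "f1 s + (f2 t + (f2 b + f1 b)) = \<psi> s t"
              if "s \<in> {a..c}" "\<bar>s - b\<bar> < d" "t \<in> {a..c}" "\<bar>t - b\<bar> < d" "s \<le> b" "b \<le> t" for s t
            proof -
              have "f1 s + f1 b = \<psi> s b"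
                using that d d1(1) \<open>a \<le> b\<close> by (intro d1(2)) auto
              moreover have "f2 b + f2 t = \<psi> b t"
                using that d d2(1) \<open>b \<le> c\<close> by (intro d2(2)) auto
              moreover have "\<psi> s b + \<psi> b t + \<psi> s t = 0"
                using that d \<open>a \<le> b\<close> \<open>b \<le> c\<close> d3(1) by (intro d3(2) B) auto
              ultimately show ?thesis by (rule bit_sums(3))
            qed
            have sym: "\<psi> t s = \<psi> s t"
              by (rule bit_cocycle_sym(2)[of "B d3", OF d3(2) B B]) (use s t 3 d in auto)
            consider "s \<le> b" "t \<le> b" | "s \<le> b" "b < t" | "b < s" "t \<le> b" | "b < s" "b < t" by linarith
            then show ?thesis
            proof cases
              case 1
              then have "f1 s + f1 t = \<psi> s t" using s t \<open>x = b\<close> d by (intro d1(2)) auto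
              then show ?thesis using 1 by (simp add: f_def)
            next
              case 2
              then have "f1 s + (f2 t + (f2 b + f1 b)) = \<psi> s t" using s t \<open>x = b\<close> by (intro mixed) auto
              then show ?thesis using 2 by (simp add: f_def)
            next
              case 3
              then have "f1 t + (f2 s + (f2 b + f1 b)) = \<psi> s t" unfolding sym[symmetric] using s t \<open>x = b\<close> by (intro mixed) auto
              then show ?thesis using 3 by (simp add: f_def ac_simps)
            next
              case 4
              then have "f2 s + f2 t = \<psi> s t" using s t \<open>x = b\<close> d by (intro d2(2)) auto
              then show ?thesis using 4 by (simp add: f_def ac_simps)
            qed
          qed
          then show ?thesis using d by blast
        qed
      qed
      then have "local_primitive \<psi> a c f" unfolding local_primitive_def by blast
      then show "\<exists>f. local_primitive \<psi> a c f" by blast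
    qed
  next
    case (local x)
    then obtain d where d: "d > 0" "\<forall>r\<in>{0..1}. \<forall>s\<in>{0..1}. \<forall>t\<in>{0..1}.
        \<bar>r - x\<bar> < d \<longrightarrow> \<bar>s - x\<bar> < d \<longrightarrow> \<bar>t - x\<bar> < d \<longrightarrow> \<psi> r s + \<psi> s t + \<psi> r t = 0"
      using assms by blast
    have "local_primitive \<psi> a b (\<psi> x)" if "a \<le> x" "x \<le> b" "b - a < d" "0 \<le> a" "b \<le> 1" for a b
      unfolding local_primitive_def
    proof (intro ballI exI[of _ "1::real"] conjI impI)
      fix y s t assume "s \<in> {a..b}" "t \<in> {a..b}"
      then have "\<psi> x s + \<psi> s t + \<psi> x t = 0"
        using that by (intro d(2)[rule_format]) auto
      then show "\<psi> x s + \<psi> x t = \<psi> s t" by (rule bit_sums(1))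
    qed simp
    then show ?case using d(1) by blast
  qed
  then show ?thesis by simp
qed

text \<open>
  If the cocycle identity holds on the whole interval, then \<open>f\<close> and \<open>\<psi> a\<close> are two primitives and
  differ by a locally constant function.
\<close>

lemma local_primitive_eq:
  assumes prim: "local_primitive \<psi> 0 1 f" and ab: "0 \<le> a" "a \<le> b" "b \<le> 1"
    and coc: "\<And>r s t. r \<in> {a..b} \<Longrightarrow> s \<in> {a..b} \<Longrightarrow> t \<in> {a..b} \<Longrightarrow> \<psi> r s + \<psi> s t + \<psi> r t = 0"
  shows "f a + f b = \<psi> a b"
proof -
  have "f a + \<psi> a a = f b + \<psi> a b"
  proof (rule locally_constant_on_interval[OF ab(2)])
    fix x assume x: "a \<le> x" "x \<le> b"
    then have "0 \<le> x" "x \<le> 1" using ab by auto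
    then obtain d where d: "d > 0" "\<And>s t. 0 \<le> s \<Longrightarrow> s \<le> 1 \<Longrightarrow> 0 \<le> t \<Longrightarrow> t \<le> 1 \<Longrightarrow>
        \<bar>s - x\<bar> < d \<Longrightarrow> \<bar>t - x\<bar> < d \<Longrightarrow> f s + f t = \<psi> s t"
      using local_primitiveE[OF prim] by blast
    have "f s + \<psi> a s = f x + \<psi> a x" if "s \<in> {a..b}" "\<bar>s - x\<bar> < d" for s
    proof -
      have "f s + f x = \<psi> s x" using that x ab d by (intro d(2)) auto
      moreover have "\<psi> a s + \<psi> s x + \<psi> a x = 0"
        using that x ab by (intro coc) auto
      ultimately show ?thesis by (rule bit_sums(4))
    qed
    then show "\<exists>d>0. \<forall>s\<in>{a..b}. \<bar>s - x\<bar> < d \<longrightarrow> f s + \<psi> a s = f x + \<psi> a x"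
      using d(1) by blast
  qed
  moreover have "\<psi> a a = 0"
    using coc[of a a a] ab by simp
  ultimately show ?thesis by (rule bit_sums(5))
qed

lemma openin_interval_ball:
  assumes "openin (top_of_set {0..1::real}) J" "t0 \<in> J"
  obtains d where "d > 0" "\<And>s. 0 \<le> s \<Longrightarrow> s \<le> 1 \<Longrightarrow> \<bar>s - t0\<bar> < d \<Longrightarrow> s \<in> J"
proof -
  have "\<forall>x\<in>J. \<exists>e>0. \<forall>x'\<in>{0..1}. dist x' x < e \<longrightarrow> x' \<in> J"
    using openin_euclidean_subtopology_iff[THEN iffD1, OF assms(1)] by (rule conjunct2)
  then obtain d where d: "d > 0" "\<forall>s\<in>{0..1}. dist s t0 < d \<longrightarrow> s \<in> J"
    using assms(2) by blast
  then show ?thesis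
    by (intro that[of d]) (auto simp: dist_real_def)
qed

lemma path_continuity:
  assumes "continuous_map (top_of_set {0..1::real}) Y \<gamma>" "openin Y W" "0 \<le> t0" "t0 \<le> 1" "\<gamma> t0 \<in> W"
  obtains d where "d > 0" "\<And>s. 0 \<le> s \<Longrightarrow> s \<le> 1 \<Longrightarrow> \<bar>s - t0\<bar> < d \<Longrightarrow> \<gamma> s \<in> W"
proof -
  have "openin (top_of_set {0..1}) {t \<in> {0..1}. \<gamma> t \<in> W}"
    using openin_continuous_map_preimage[OF assms(1,2)] by simp
  moreover have "t0 \<in> {t \<in> {0..1}. \<gamma> t \<in> W}"
    using assms by simp
  ultimately obtain d where d: "d > 0" "\<And>s. 0 \<le> s \<Longrightarrow> s \<le> 1 \<Longrightarrow> \<bar>s - t0\<bar> < d \<Longrightarrow> s \<in> {t \<in> {0..1}. \<gamma> t \<in> W}"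
    using openin_interval_ball by blast
  show ?thesis
    by (rule that[OF d(1)]) (use d(2) in blast)
qed

text \<open>
  The sums of \<open>\<phi>\<close> along the paths from two neighbouring points differ by the values of \<open>\<phi>\<close> between
  their ends. Over a short piece of the parameter interval the tube of all paths starting in a
  neighbourhood of \<open>x\<close> lies in a set on which \<open>\<phi>\<close> is a cocycle; by bisection, finitely many pieces
  suffice for each \<open>x\<close>.
\<close>

lemma primitive_along_paths:
  fixes \<phi> :: "'b \<Rightarrow> 'b \<Rightarrow> bit" and \<gamma> :: "'x \<Rightarrow> real \<Rightarrow> 'b"
  assumes cocycle: "\<And>p. p \<in> topspace Y \<Longrightarrow> \<exists>W. openin Y W \<and> p \<in> W \<and>
      (\<forall>u\<in>W. \<forall>v\<in>W. \<forall>w\<in>W. \<phi> u v + \<phi> v w + \<phi> u w = 0)"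
    and cont: "continuous_map (prod_topology X (top_of_set {0..1})) Y (\<lambda>(x, t). \<gamma> x t)"
    and prim: "\<And>x. x \<in> topspace X \<Longrightarrow> local_primitive (\<lambda>s t. \<phi> (\<gamma> x s) (\<gamma> x t)) 0 1 (a x)"
    and x: "x \<in> topspace X"
  shows "\<exists>V. openin X V \<and> x \<in> V \<and> (\<forall>y\<in>V. \<forall>z\<in>V.
    a y 0 + a y 1 + (a z 0 + a z 1) = \<phi> (\<gamma> y 0) (\<gamma> z 0) + \<phi> (\<gamma> y 1) (\<gamma> z 1))"
proof -
  let ?Q = "\<lambda>s t. \<exists>V. openin X V \<and> x \<in> V \<and> (\<forall>y\<in>V. \<forall>z\<in>V.
    a y s + a y t + (a z s + a z t) = \<phi> (\<gamma> y s) (\<gamma> z s) + \<phi> (\<gamma> y t) (\<gamma> z t))"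
  have "(0::real) \<le> 0 \<and> (1::real) \<le> 1 \<longrightarrow> ?Q 0 1"
    using zero_le_one
  proof (induct rule: Bolzano[where P = "\<lambda>s t. 0 \<le> s \<and> t \<le> 1 \<longrightarrow> ?Q s t"])
    case (trans r s t)
    show ?case
    proof
      assume rt: "0 \<le> r \<and> t \<le> 1"
      then have rs: "0 \<le> r \<and> s \<le> 1" and st: "0 \<le> s \<and> t \<le> 1"
        using trans(3,4) by linarith+
      from trans(1) rs have "?Q r s" by (rule mp)
      from trans(2) st have "?Q s t" by (rule mp)
      obtain V where V: "openin X V" "x \<in> V" "\<And>y z. y \<in> V \<Longrightarrow> z \<in> V \<Longrightarrow>
          a y r + a y s + (a z r + a z s) = \<phi> (\<gamma> y r) (\<gamma> z r) + \<phi> (\<gamma> y s) (\<gamma> z s)"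
        using \<open>?Q r s\<close> by blast
      obtain V' where V': "openin X V'" "x \<in> V'" "\<And>y z. y \<in> V' \<Longrightarrow> z \<in> V' \<Longrightarrow>
          a y s + a y t + (a z s + a z t) = \<phi> (\<gamma> y s) (\<gamma> z s) + \<phi> (\<gamma> y t) (\<gamma> z t)"
        using \<open>?Q s t\<close> by blast
      have "a y r + a y t + (a z r + a z t) = \<phi> (\<gamma> y r) (\<gamma> z r) + \<phi> (\<gamma> y t) (\<gamma> z t)"
        if "y \<in> V \<inter> V'" "z \<in> V \<inter> V'" for y z
      proof -
        have "a y r + a y t + (a z r + a z t) =
            (a y r + a y s + (a z r + a z s)) + (a y s + a y t + (a z s + a z t))"
          by (simp add: ac_simps)
        also have "\<dots> = (\<phi> (\<gamma> y r) (\<gamma> z r) + \<phi> (\<gamma> y s) (\<gamma> z s)) + (\<phi> (\<gamma> y s) (\<gamma> z s) + \<phi> (\<gamma> y t) (\<gamma> z t))"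
          using V(3)[of y z] V'(3)[of y z] that by (simp only: Int_iff)
        also have "\<dots> = \<phi> (\<gamma> y r) (\<gamma> z r) + \<phi> (\<gamma> y t) (\<gamma> z t)"
          by (simp add: ac_simps)
        finally show ?thesis .
      qed
      then show "?Q r t"
        using V(1,2) V'(1,2) openin_Int by blast
    qed
  next
    case (local t0)
    have top: "\<gamma> x t0 \<in> topspace Y"
      using continuous_map_image_subset_topspace[OF cont] x local by force
    then obtain W where W: "openin Y W" "\<gamma> x t0 \<in> W"
      "\<And>u v w. u \<in> W \<Longrightarrow> v \<in> W \<Longrightarrow> w \<in> W \<Longrightarrow> \<phi> u v + \<phi> v w + \<phi> u w = 0"
      using cocycle[OF top] by blast
    have "openin (prod_topology X (top_of_set {0..1}))
        {p \<in> topspace (prod_topology X (top_of_set {0..1})). (\<lambda>(x, t). \<gamma> x t) p \<in> W}"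
      by (rule openin_continuous_map_preimage[OF cont W(1)])
    moreover have "(x, t0) \<in> {p \<in> topspace (prod_topology X (top_of_set {0..1})). (\<lambda>(x, t). \<gamma> x t) p \<in> W}"
      using x local W(2) by simp
    ultimately obtain V J where V: "openin X V" "x \<in> V" and J: "openin (top_of_set {0..1}) J" "t0 \<in> J"
      and VJ: "V \<times> J \<subseteq> {p \<in> topspace (prod_topology X (top_of_set {0..1})). (\<lambda>(x, t). \<gamma> x t) p \<in> W}"
      unfolding openin_prod_topology_alt by meson
    obtain d where d: "d > 0" "\<And>s. 0 \<le> s \<Longrightarrow> s \<le> 1 \<Longrightarrow> \<bar>s - t0\<bar> < d \<Longrightarrow> s \<in> J"
      using openin_interval_ball[OF J] by blast
    have "?Q s t" if st: "s \<le> t0" "t0 \<le> t" "t - s < d" "0 \<le> s" "t \<le> 1" for s t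
    proof -
      have inW: "\<gamma> y r \<in> W" if "y \<in> V" "s \<le> r" "r \<le> t" for y r
      proof -
        have "r \<in> J" using that st by (intro d(2)) auto
        then show ?thesis using that VJ by auto
      qed
      have path: "a y s + a y t = \<phi> (\<gamma> y s) (\<gamma> y t)" if y: "y \<in> V" for y
      proof (rule local_primitive_eq[OF prim])
        show "y \<in> topspace X" using y openin_subset[OF V(1)] by auto
        show "0 \<le> s" "s \<le> t" "t \<le> 1" using st by auto
        fix p q r assume "p \<in> {s..t}" "q \<in> {s..t}" "r \<in> {s..t}"
        then show "\<phi> (\<gamma> y p) (\<gamma> y q) + \<phi> (\<gamma> y q) (\<gamma> y r) + \<phi> (\<gamma> y p) (\<gamma> y r) = 0"
          using y by (intro W(3) inW) auto
      qed
      have "a y s + a y t + (a z s + a z t) = \<phi> (\<gamma> y s) (\<gamma> z s) + \<phi> (\<gamma> y t) (\<gamma> z t)"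
        if "y \<in> V" "z \<in> V" for y z
      proof -
        have "\<phi> (\<gamma> y s) (\<gamma> y t) + \<phi> (\<gamma> y t) (\<gamma> z t) + \<phi> (\<gamma> y s) (\<gamma> z t) = 0"
          and "\<phi> (\<gamma> y s) (\<gamma> z s) + \<phi> (\<gamma> z s) (\<gamma> z t) + \<phi> (\<gamma> y s) (\<gamma> z t) = 0"
          using that st by (intro W(3) inW; simp)+
        then show ?thesis
          unfolding path[OF that(1)] path[OF that(2)] by (rule bit_sums(2))
      qed
      then show ?thesis using V by blast
    qed
    then show ?case using d(1) by blast
  qed
  then show ?thesis by simp
qed

section \<open>The infinite sphere\<close>

lemma topspace_infinite_sphere: "topspace infinite_sphere = (\<Union>n. topspace (nsphere n))"
proof -
  have "openin infinite_sphere (\<Union>n. topspace (nsphere n))"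
    unfolding openin_infinite_sphere
  proof (intro conjI allI)
    fix n
    have "(\<Union>n. topspace (nsphere n)) \<inter> topspace (nsphere n) = topspace (nsphere n)"
      by blast
    then show "openin (nsphere n) ((\<Union>n. topspace (nsphere n)) \<inter> topspace (nsphere n))"
      by simp
  qed simp
  moreover have "topspace infinite_sphere \<subseteq> (\<Union>n. topspace (nsphere n))"
    using openin_infinite_sphere[of "topspace infinite_sphere"] by blast
  ultimately show ?thesis
    by (simp add: openin_subset subset_antisym)
qed

lemma in_nsphere_iff: "x \<in> topspace (nsphere n) \<longleftrightarrow> (\<Sum>i\<le>n. (x i)\<^sup>2) = 1 \<and> (\<forall>i>n. x i = 0)"
  by (simp add: nsphere)

lemma nsphere_mono:
  assumes "m \<le> n" "x \<in> topspace (nsphere m)"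
  shows "x \<in> topspace (nsphere n)"
proof -
  have "(\<Sum>i\<le>n. (x i)\<^sup>2) = (\<Sum>i\<le>m. (x i)\<^sup>2)"
    using assms by (intro sum.mono_neutral_right) (auto simp: in_nsphere_iff)
  then show ?thesis
    using assms by (auto simp: in_nsphere_iff)
qed

lemma continuous_map_into_nsphere:
  assumes "\<And>x. x \<in> topspace X \<Longrightarrow> f x \<in> topspace (nsphere n)"
    and "\<And>i. continuous_map X euclideanreal (\<lambda>x. f x i)"
  shows "continuous_map X (nsphere n) f"
  unfolding nsphere
  using assms by (auto simp: continuous_map_in_subtopology continuous_map_componentwise_UNIV in_nsphere_iff)

lemma continuous_map_nsphere_infinite_sphere: "continuous_map (nsphere n) infinite_sphere (\<lambda>x. x)"
  unfolding continuous_map_def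
proof (intro conjI allI impI)
  fix U assume "openin infinite_sphere U"
  then have "openin (nsphere n) (U \<inter> topspace (nsphere n))"
    by (simp add: openin_infinite_sphere)
  moreover have "U \<inter> topspace (nsphere n) = {x \<in> topspace (nsphere n). x \<in> U}"
    by blast
  ultimately show "openin (nsphere n) {x \<in> topspace (nsphere n). x \<in> U}"
    by simp
qed (auto simp: topspace_infinite_sphere)

lemma uminus_in_nsphere [simp]: "- x \<in> topspace (nsphere n) \<longleftrightarrow> x \<in> topspace (nsphere n)"
  by (simp add: in_nsphere_iff)

lemma minus_minus_seq: "- (- x) = (x :: nat \<Rightarrow> real)"
  by (simp add: fun_eq_iff)

lemma openin_infinite_sphere_uminus:
  assumes "openin infinite_sphere U"
  shows "openin infinite_sphere (uminus ` U)"
  unfolding openin_infinite_sphere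
proof (intro conjI allI)
  show "uminus ` U \<subseteq> (\<Union>n. topspace (nsphere n))"
  proof
    fix y assume "y \<in> uminus ` U"
    then obtain x where "y = - x" "x \<in> U" by blast
    then show "y \<in> (\<Union>n. topspace (nsphere n))"
      using assms unfolding openin_infinite_sphere by auto
  qed
next
  fix n
  have "continuous_map (nsphere n) (nsphere n) (\<lambda>x. - x)"
  proof (rule continuous_map_into_nsphere)
    fix i
    show "continuous_map (nsphere n) euclideanreal (\<lambda>x. (- x) i)"
      using continuous_map_nsphere_projection by simp
  qed simp
  moreover have "openin (nsphere n) (U \<inter> topspace (nsphere n))"
    using assms by (simp add: openin_infinite_sphere)
  ultimately have "openin (nsphere n) {x \<in> topspace (nsphere n). - x \<in> U \<inter> topspace (nsphere n)}"
    by (rule openin_continuous_map_preimage)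
  also have "{x \<in> topspace (nsphere n). - x \<in> U \<inter> topspace (nsphere n)} = uminus ` U \<inter> topspace (nsphere n)"
  proof (rule Set.set_eqI)
    fix x
    have "x \<in> uminus ` U \<longleftrightarrow> - x \<in> U"
      by (metis image_iff minus_minus_seq)
    then show "x \<in> {x \<in> topspace (nsphere n). - x \<in> U \<inter> topspace (nsphere n)} \<longleftrightarrow>
        x \<in> uminus ` U \<inter> topspace (nsphere n)"
      by auto
  qed
  finally show "openin (nsphere n) (uminus ` U \<inter> topspace (nsphere n))" .
qed

definition sphere_close :: "(nat \<Rightarrow> real) \<Rightarrow> (nat \<Rightarrow> real) \<Rightarrow> bool" where
  "sphere_close x y \<longleftrightarrow> (\<Sum>i\<in>{i. x i \<noteq> 0}. x i * y i) > 0"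

text \<open>
  Two unit vectors whose inner products with \<open>x\<close> exceed \<open>3/4\<close> have distance less than \<open>1/\<surd>2\<close> from
  \<open>x\<close>, hence less than \<open>\<surd>2\<close> from each other, and so their inner product is positive.
\<close>

lemma sphere_close_nbhd:
  assumes "x \<in> topspace infinite_sphere"
  shows "\<exists>U. openin infinite_sphere U \<and> x \<in> U \<and> (\<forall>y\<in>U. \<forall>z\<in>U. sphere_close y z)"
proof -
  obtain n where n: "x \<in> topspace (nsphere n)"
    using assms by (auto simp: topspace_infinite_sphere)
  let ?U = "{y \<in> topspace infinite_sphere. (\<Sum>i\<le>n. x i * y i) > 3/4}"
  have "openin infinite_sphere ?U"
    unfolding openin_infinite_sphere
  proof (intro conjI allI)
    fix m
    have "continuous_map (nsphere m) euclideanreal (\<lambda>y. \<Sum>i\<le>n. x i * y i)"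
      by (intro continuous_intros continuous_map_nsphere_projection) auto
    moreover have "openin euclideanreal {3/4<..}" by simp
    ultimately have "openin (nsphere m) {y \<in> topspace (nsphere m). (\<Sum>i\<le>n. x i * y i) \<in> {3/4<..}}"
      by (rule openin_continuous_map_preimage)
    also have "{y \<in> topspace (nsphere m). (\<Sum>i\<le>n. x i * y i) \<in> {3/4<..}} = ?U \<inter> topspace (nsphere m)"
      by (auto simp: topspace_infinite_sphere)
    finally show "openin (nsphere m) (?U \<inter> topspace (nsphere m))" .
  qed (auto simp: topspace_infinite_sphere)
  moreover have "x \<in> ?U"
    using assms n by (simp add: in_nsphere_iff power2_eq_square)
  moreover have "sphere_close y z" if "y \<in> ?U" "z \<in> ?U" for y z
  proof -
    have "y \<in> topspace infinite_sphere" "z \<in> topspace infinite_sphere"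
      using that by auto
    then obtain m m' where mm: "y \<in> topspace (nsphere m)" "z \<in> topspace (nsphere m')"
      unfolding topspace_infinite_sphere by blast
    define N where "N = max n (max m m')"
    have N: "x \<in> topspace (nsphere N)" "y \<in> topspace (nsphere N)" "z \<in> topspace (nsphere N)"
      by (rule nsphere_mono[OF _ n] nsphere_mono[OF _ mm(1)] nsphere_mono[OF _ mm(2)]; simp add: N_def)+
    have dist: "(\<Sum>i\<le>N. (u i - v i)\<^sup>2) = 2 - 2 * (\<Sum>i\<le>N. u i * v i)"
      if "u \<in> topspace (nsphere N)" "v \<in> topspace (nsphere N)" for u v :: "nat \<Rightarrow> real"
      using that by (simp add: in_nsphere_iff power2_diff sum.distrib sum_subtractf sum_distrib_left mult.assoc)
    have inner: "(\<Sum>i\<le>N. x i * u i) > 3/4" if "u \<in> ?U" for u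
    proof -
      have "(\<Sum>i\<le>N. x i * u i) = (\<Sum>i\<le>n. x i * u i)"
        using n by (intro sum.mono_neutral_right) (auto simp: in_nsphere_iff N_def)
      then show ?thesis using that by simp
    qed
    have "(\<Sum>i\<le>N. (y i - z i)\<^sup>2) \<le> (\<Sum>i\<le>N. 2 * (x i - y i)\<^sup>2 + 2 * (x i - z i)\<^sup>2)"
    proof (rule sum_mono)
      fix i
      have "0 \<le> ((x i - y i) + (x i - z i))\<^sup>2" by simp
      then show "(y i - z i)\<^sup>2 \<le> 2 * (x i - y i)\<^sup>2 + 2 * (x i - z i)\<^sup>2"
        by (simp add: power2_eq_square algebra_simps)
    qed
    also have "\<dots> = 2 * (2 - 2 * (\<Sum>i\<le>N. x i * y i)) + 2 * (2 - 2 * (\<Sum>i\<le>N. x i * z i))"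
      using dist[OF N(1,2)] dist[OF N(1,3)] by (simp add: sum.distrib flip: sum_distrib_left)
    also have "\<dots> < 2"
      using inner[OF that(1)] inner[OF that(2)] by simp
    finally have "(\<Sum>i\<le>N. y i * z i) > 0"
      using dist[OF N(2,3)] by simp
    also have "(\<Sum>i\<le>N. y i * z i) = (\<Sum>i\<in>{i. y i \<noteq> 0}. y i * z i)"
      using N(2) by (intro sum.mono_neutral_right) (auto simp: in_nsphere_iff not_le[symmetric])
    finally show ?thesis by (simp add: sphere_close_def)
  qed
  ultimately show ?thesis by blast
qed

lemma antipodal_space_infinite_sphere: "antipodal_space infinite_sphere sphere_close"
proof
  show "sphere_close x y \<Longrightarrow> \<not> sphere_close x (- y)" for x y
    by (simp add: sphere_close_def sum_negf)
  show "sphere_close x y \<Longrightarrow> sphere_close (- x) (- y)" for x y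
    by (simp add: sphere_close_def)
qed (simp_all add: minus_minus_seq openin_infinite_sphere_uminus sphere_close_nbhd)

text \<open>
  A curve from \<open>x\<close> to the first basis vector that avoids \<open>0\<close>. The detour through the shifted vector
  prevents cancellation, even if \<open>x\<close> is the opposite basis vector. One formula serves all dimensions, so
  that the paths from the points of different spheres fit together.
\<close>

definition deformed :: "(nat \<Rightarrow> real) \<Rightarrow> real \<Rightarrow> nat \<Rightarrow> real" where
  "deformed x t i = (1 - t)\<^sup>2 * x i + t * (1 - t) * (case i of 0 \<Rightarrow> 0 | Suc j \<Rightarrow> x j) + (if i = 0 then t\<^sup>2 else 0)"

text \<open>
  The radial projection of the curve to the sphere; summing over the support gives the norm of a
  finitely supported sequence independently of the dimension.
\<close>

definition sphere_path :: "(nat \<Rightarrow> real) \<Rightarrow> real \<Rightarrow> nat \<Rightarrow> real" where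
  "sphere_path x t i = deformed x t i / sqrt (\<Sum>j\<in>{j. deformed x t j \<noteq> 0}. (deformed x t j)\<^sup>2)"

lemma deformed_norm:
  assumes "x \<in> topspace (nsphere n)"
  shows "(\<Sum>j\<in>{j. deformed x t j \<noteq> 0}. (deformed x t j)\<^sup>2) = (\<Sum>j\<le>Suc n. (deformed x t j)\<^sup>2)"
    and "i > Suc n \<Longrightarrow> deformed x t i = 0"
    and "0 \<le> t \<Longrightarrow> t \<le> 1 \<Longrightarrow> (\<Sum>j\<le>Suc n. (deformed x t j)\<^sup>2) > 0"
proof -
  have x: "(\<Sum>i\<le>n. (x i)\<^sup>2) = 1" "\<And>i. i > n \<Longrightarrow> x i = 0"
    using assms by (auto simp: in_nsphere_iff)
  show vanish: "deformed x t i = 0" if "i > Suc n" for i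
    using that x(2) by (auto simp: deformed_def split: nat.split)
  show "(\<Sum>j\<in>{j. deformed x t j \<noteq> 0}. (deformed x t j)\<^sup>2) = (\<Sum>j\<le>Suc n. (deformed x t j)\<^sup>2)"
    using vanish by (intro sum.mono_neutral_left) (auto simp: not_le[symmetric])
  assume t: "0 \<le> t" "t \<le> 1"
  have "\<exists>i\<le>Suc n. deformed x t i \<noteq> 0"
  proof -
    consider "t = 0" | "t = 1" | "0 < t" "t < 1" using t by linarith
    then show ?thesis
    proof cases
      case 1
      have "\<exists>i\<le>n. x i \<noteq> 0"
      proof (rule ccontr)
        assume "\<not> ?thesis"
        then have "(\<Sum>i\<le>n. (x i)\<^sup>2) = 0" by simp
        then show False using x(1) by simp
      qed
      then obtain i where "i \<le> n" "x i \<noteq> 0" by blast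
      then show ?thesis using 1 by (intro exI[of _ i]) (auto simp: deformed_def)
    next
      case 2
      then show ?thesis by (intro exI[of _ 0]) (simp add: deformed_def)
    next
      case 3
      have fin: "finite {i. x i \<noteq> 0}"
        by (rule finite_subset[of _ "{..n}"]) (use x(2) in \<open>auto simp: not_le[symmetric]\<close>)
      have "{i. x i \<noteq> 0} \<noteq> {}"
      proof
        assume "{i. x i \<noteq> 0} = {}"
        then have "(\<Sum>i\<le>n. (x i)\<^sup>2) = 0" by simp
        then show False using x(1) by simp
      qed
      \<comment> \<open>the shift moves the last nonzero coordinate to a place where \<open>x\<close> vanishes\<close>
      define m where "m = Max {i. x i \<noteq> 0}"
      have m: "x m \<noteq> 0"
        using Max_in[OF fin \<open>_ \<noteq> {}\<close>] by (simp add: m_def)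
      have "x (Suc m) = 0"
        using Max_ge[OF fin, of "Suc m"] by (auto simp: m_def)
      moreover have "m \<le> n"
        using m x(2) not_le by blast
      ultimately show ?thesis
        using 3 m by (intro exI[of _ "Suc m"]) (simp add: deformed_def)
    qed
  qed
  then obtain i where "i \<le> Suc n" "deformed x t i \<noteq> 0" by blast
  then show "(\<Sum>j\<le>Suc n. (deformed x t j)\<^sup>2) > 0"
    by (intro sum_pos2[of _ i]) auto
qed

lemma sphere_path_0: "x \<in> topspace (nsphere n) \<Longrightarrow> sphere_path x 0 = x"
proof
  fix i assume x: "x \<in> topspace (nsphere n)"
  have eq: "deformed x 0 = x" by (auto simp: deformed_def fun_eq_iff)
  show "sphere_path x 0 i = x i"
    using deformed_norm(1)[OF x, of 0] x nsphere_mono[OF _ x, of "Suc n"]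
    unfolding sphere_path_def eq by (simp add: in_nsphere_iff)
qed

lemma sphere_path_1: "sphere_path x 1 = sphere_path y 1"
  by (simp add: sphere_path_def fun_eq_iff deformed_def)

lemma sphere_path_in_nsphere:
  assumes "x \<in> topspace (nsphere n)" "0 \<le> t" "t \<le> 1"
  shows "sphere_path x t \<in> topspace (nsphere (Suc n))"
proof -
  let ?N = "\<Sum>j\<le>Suc n. (deformed x t j)\<^sup>2"
  have eq: "sphere_path x t i = deformed x t i / sqrt ?N" for i
    by (simp only: sphere_path_def deformed_norm(1)[OF assms(1)])
  have "?N > 0" using deformed_norm(3)[OF assms] .
  then have "(\<Sum>i\<le>Suc n. (sphere_path x t i)\<^sup>2) = ?N / ?N"
    unfolding eq power_divide sum_divide_distrib by (intro sum.cong) (auto simp: real_sqrt_pow2)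
  then show ?thesis
    using \<open>?N > 0\<close> deformed_norm(2)[OF assms(1)] by (simp add: in_nsphere_iff eq)
qed

lemma continuous_map_sphere_path:
  "continuous_map (prod_topology (nsphere n) (top_of_set {0..1})) infinite_sphere (\<lambda>(x, t). sphere_path x t)"
proof -
  let ?P = "prod_topology (nsphere n) (top_of_set {0..1::real})"
  have fst_i: "continuous_map ?P euclideanreal (\<lambda>p. fst p i)" for i
    using continuous_map_compose[OF continuous_map_fst continuous_map_nsphere_projection]
    by (simp add: o_def)
  have snd: "continuous_map ?P euclideanreal snd"
    using continuous_map_snd by (rule continuous_map_into_fulltopology)
  have deformed: "continuous_map ?P euclideanreal (\<lambda>p. deformed (fst p) (snd p) i)" for i
    unfolding deformed_def
    by (cases i; simp; intro continuous_intros fst_i snd)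
  have "continuous_map ?P (nsphere (Suc n)) (\<lambda>(x, t). sphere_path x t)"
  proof (rule continuous_map_into_nsphere)
    fix p assume "p \<in> topspace ?P"
    then show "(case p of (x, t) \<Rightarrow> sphere_path x t) \<in> topspace (nsphere (Suc n))"
      by (auto intro: sphere_path_in_nsphere)
  next
    fix i
    let ?N = "\<lambda>p. \<Sum>j\<le>Suc n. (deformed (fst p) (snd p) j)\<^sup>2"
    have "continuous_map ?P euclideanreal (\<lambda>p. deformed (fst p) (snd p) i / sqrt (?N p))"
    proof (rule continuous_map_real_divide[OF deformed])
      show "continuous_map ?P euclideanreal (\<lambda>p. sqrt (?N p))"
        by (intro continuous_intros deformed) auto
      fix p assume "p \<in> topspace ?P"
      then show "sqrt (?N p) \<noteq> 0"
        using deformed_norm(3)[of "fst p" n "snd p"] by auto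
    qed
    then show "continuous_map ?P euclideanreal (\<lambda>p. (case p of (x, t) \<Rightarrow> sphere_path x t) i)"
    proof (rule continuous_map_eq)
      fix p assume "p \<in> topspace ?P"
      then show "deformed (fst p) (snd p) i / sqrt (?N p) = (case p of (x, t) \<Rightarrow> sphere_path x t) i"
        using deformed_norm(1)[of "fst p" n "snd p"] by (auto simp: sphere_path_def split: prod.split)
    qed
  qed
  from continuous_map_compose[OF this continuous_map_nsphere_infinite_sphere] show ?thesis
    by (simp add: o_def)
qed

lemma continuous_map_sphere_path_fixed:
  assumes "x \<in> topspace infinite_sphere"
  shows "continuous_map (top_of_set {0..1}) infinite_sphere (sphere_path x)"
proof -
  obtain n where n: "x \<in> topspace (nsphere n)"
    using assms by (auto simp: topspace_infinite_sphere)
  have "continuous_map (top_of_set {0..1}) (prod_topology (nsphere n) (top_of_set {0..1::real})) (\<lambda>t. (x, t))"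
    by (intro continuous_map_pairedI) (simp_all add: n)
  from continuous_map_compose[OF this continuous_map_sphere_path] show ?thesis
    by (simp add: o_def)
qed

lemma locally_constant_infinite_sphere:
  assumes "\<And>x. x \<in> topspace infinite_sphere \<Longrightarrow> \<exists>U. openin infinite_sphere U \<and> x \<in> U \<and> (\<forall>y\<in>U. h y = h x)"
    and "x \<in> topspace infinite_sphere" "y \<in> topspace infinite_sphere"
  shows "h x = h y"
proof -
  have end_eq: "h (sphere_path x 0) = h (sphere_path x 1)" if x: "x \<in> topspace infinite_sphere" for x
  proof (rule locally_constant_on_interval)
    fix t :: real assume t: "0 \<le> t" "t \<le> 1"
    note cont = continuous_map_sphere_path_fixed[OF x]
    have "sphere_path x t \<in> topspace infinite_sphere"
      using continuous_map_image_subset_topspace[OF cont] t by auto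
    then obtain U where U: "openin infinite_sphere U" "sphere_path x t \<in> U" "\<forall>y\<in>U. h y = h (sphere_path x t)"
      using assms(1) by blast
    obtain d where d: "d > 0" "\<And>s. 0 \<le> s \<Longrightarrow> s \<le> 1 \<Longrightarrow> \<bar>s - t\<bar> < d \<Longrightarrow> sphere_path x s \<in> U"
      using path_continuity[OF cont U(1) t U(2)] by blast
    have "h (sphere_path x s) = h (sphere_path x t)" if "s \<in> {0..1}" "\<bar>s - t\<bar> < d" for s
      using U(3) d(2)[of s] that by simp
    then show "\<exists>d>0. \<forall>s\<in>{0..1}. \<bar>s - t\<bar> < d \<longrightarrow> h (sphere_path x s) = h (sphere_path x t)"
      using d(1) by blast
  qed simp
  have 0: "sphere_path x 0 = x" if "x \<in> topspace infinite_sphere" for x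
    using that sphere_path_0 by (auto simp: topspace_infinite_sphere)
  have "h x = h (sphere_path x 1)"
    using end_eq[OF assms(2)] unfolding 0[OF assms(2)] .
  also have "sphere_path x 1 = sphere_path y 1"
    by (rule sphere_path_1)
  also have "h (sphere_path y 1) = h y"
    using end_eq[OF assms(3)] unfolding 0[OF assms(3)] by (rule sym)
  finally show ?thesis .
qed

section \<open>The generator in degree one of infinite projective space\<close>

lemma coboundary_small:
  "coboundary \<phi> [] = 0"
  "coboundary \<phi> [x] = \<phi> []"
  "coboundary \<phi> [x, y] = \<phi> [y] + \<phi> [x]"
  "coboundary \<phi> [x, y, z] = \<phi> [y, z] + (\<phi> [x, z] + \<phi> [x, y])"
  by (simp_all add: coboundary_def[of _ "[]"] coboundary_Cons)

lemma locally_zero_1_iff: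
  "locally_zero 1 X \<phi> \<longleftrightarrow> (\<forall>x\<in>topspace X. \<exists>U. openin X U \<and> x \<in> U \<and> (\<forall>y\<in>U. \<forall>z\<in>U. \<phi> [y, z] = 0))"
proof -
  have "(\<forall>xs. length xs = Suc 1 \<and> set xs \<subseteq> U \<longrightarrow> \<phi> xs = 0) \<longleftrightarrow> (\<forall>y\<in>U. \<forall>z\<in>U. \<phi> [y, z] = 0)" for U
    by (auto simp: length_Suc_conv)
  then show ?thesis by (simp add: locally_zero_def)
qed

lemma cocycle_1_local:
  assumes "\<phi> \<in> cocycles 1 X {}" "x \<in> topspace X"
  shows "\<exists>W. openin X W \<and> x \<in> W \<and> (\<forall>u\<in>W. \<forall>v\<in>W. \<forall>w\<in>W. \<phi> [u, v] + \<phi> [v, w] + \<phi> [u, w] = 0)"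
proof -
  have "locally_zero (Suc 1) X (coboundary \<phi>)"
    using assms(1) by (simp add: cocycles_absolute)
  then obtain W where W: "openin X W" "x \<in> W"
    "\<forall>xs. length xs = Suc (Suc 1) \<and> set xs \<subseteq> W \<longrightarrow> coboundary \<phi> xs = 0"
    using assms(2) unfolding locally_zero_def by blast
  have "\<phi> [u, v] + \<phi> [v, w] + \<phi> [u, w] = 0" if "u \<in> W" "v \<in> W" "w \<in> W" for u v w
  proof -
    have "coboundary \<phi> [u, v, w] = 0"
      using W(3)[rule_format, of "[u, v, w]"] that by simp
    then show ?thesis by (simp add: coboundary_small ac_simps)
  qed
  then show ?thesis using W by blast
qed

text \<open>
  The primitive \<open>g\<close> sums the cocycle along the path from a point to the base point. On every
  finite-dimensional sphere it is a local primitive by the lemma \<open>primitive_along_paths\<close>. A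
  neighbourhood in the direct limit topology is then obtained from one on which the cocycle identity
  holds, by restricting to those points at which \<open>g\<close> has the value prescribed by \<open>x\<close>; this condition is
  locally constant on every finite-dimensional sphere.
\<close>

lemma cocycle_infinite_sphere_exact:
  assumes \<phi>: "\<phi> \<in> cocycles 1 infinite_sphere {}"
  obtains g where "locally_zero 1 infinite_sphere (\<lambda>xs. \<phi> xs + coboundary (\<lambda>ys. g (hd ys)) xs)"
proof -
  define \<psi> where "\<psi> = (\<lambda>u v. \<phi> [u, v])"
  have coc: "\<exists>W. openin infinite_sphere W \<and> x \<in> W \<and> (\<forall>u\<in>W. \<forall>v\<in>W. \<forall>w\<in>W. \<psi> u v + \<psi> v w + \<psi> u w = 0)"
    if "x \<in> topspace infinite_sphere" for x
    using cocycle_1_local[OF \<phi> that] by (simp only: \<psi>_def)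
  have "\<exists>f. local_primitive (\<lambda>s t. \<psi> (sphere_path x s) (sphere_path x t)) 0 1 f"
    if x: "x \<in> topspace infinite_sphere" for x
  proof (rule local_primitive_exists)
    fix t0 :: real assume t0: "0 \<le> t0" "t0 \<le> 1"
    note cont = continuous_map_sphere_path_fixed[OF x]
    have top: "sphere_path x t0 \<in> topspace infinite_sphere"
      using continuous_map_image_subset_topspace[OF cont] t0 by auto
    then obtain W where W: "openin infinite_sphere W" "sphere_path x t0 \<in> W"
      "\<forall>u\<in>W. \<forall>v\<in>W. \<forall>w\<in>W. \<psi> u v + \<psi> v w + \<psi> u w = 0"
      using coc[OF top] by blast
    obtain d where d: "d > 0" "\<And>s. 0 \<le> s \<Longrightarrow> s \<le> 1 \<Longrightarrow> \<bar>s - t0\<bar> < d \<Longrightarrow> sphere_path x s \<in> W"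
      using path_continuity[OF cont W(1) t0 W(2)] by blast
    show "\<exists>d>0. \<forall>r\<in>{0..1}. \<forall>s\<in>{0..1}. \<forall>t\<in>{0..1}. \<bar>r - t0\<bar> < d \<longrightarrow> \<bar>s - t0\<bar> < d \<longrightarrow> \<bar>t - t0\<bar> < d \<longrightarrow>
        \<psi> (sphere_path x r) (sphere_path x s) + \<psi> (sphere_path x s) (sphere_path x t) +
        \<psi> (sphere_path x r) (sphere_path x t) = 0"
    proof (intro exI[of _ d] conjI ballI impI d(1))
      fix r s t assume "r \<in> {0..1}" "s \<in> {0..1}" "t \<in> {0..1}" "\<bar>r - t0\<bar> < d" "\<bar>s - t0\<bar> < d" "\<bar>t - t0\<bar> < d"
      then have "sphere_path x r \<in> W" "sphere_path x s \<in> W" "sphere_path x t \<in> W"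
        by (intro d(2); simp)+
      then show "\<psi> (sphere_path x r) (sphere_path x s) + \<psi> (sphere_path x s) (sphere_path x t) +
        \<psi> (sphere_path x r) (sphere_path x t) = 0"
        using W(3) by blast
    qed
  qed
  then obtain a where a: "\<And>x. x \<in> topspace infinite_sphere \<Longrightarrow>
      local_primitive (\<lambda>s t. \<psi> (sphere_path x s) (sphere_path x t)) 0 1 (a x)"
    by metis
  define g where "g = (\<lambda>x. a x 0 + a x 1)"
  have sub: "topspace (nsphere n) \<subseteq> topspace infinite_sphere" for n
    by (auto simp: topspace_infinite_sphere)
  have finite_dim: "\<exists>V. openin (nsphere n) V \<and> x \<in> V \<and> (\<forall>y\<in>V. \<forall>z\<in>V. g y + g z = \<psi> y z)"
    if x: "x \<in> topspace (nsphere n)" for n x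
  proof -
    have "\<exists>V. openin (nsphere n) V \<and> x \<in> V \<and> (\<forall>y\<in>V. \<forall>z\<in>V.
        a y 0 + a y 1 + (a z 0 + a z 1) =
        \<psi> (sphere_path y 0) (sphere_path z 0) + \<psi> (sphere_path y 1) (sphere_path z 1))"
      by (rule primitive_along_paths[where X = "nsphere n" and Y = infinite_sphere and a = a and \<phi> = \<psi>
            and \<gamma> = sphere_path, OF coc continuous_map_sphere_path a[OF subsetD[OF sub]] x])
    then obtain V where V: "openin (nsphere n) V" "x \<in> V" "\<And>y z. y \<in> V \<Longrightarrow> z \<in> V \<Longrightarrow>
        g y + g z = \<psi> (sphere_path y 0) (sphere_path z 0) + \<psi> (sphere_path y 1) (sphere_path z 1)"
      unfolding g_def by blast
    have "g y + g z = \<psi> y z" if "y \<in> V" "z \<in> V" for y z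
    proof -
      have yz: "y \<in> topspace (nsphere n)" "z \<in> topspace (nsphere n)"
        using that openin_subset[OF V(1)] by auto
      define e where "e = sphere_path y 1"
      have e: "sphere_path y 1 = e" "sphere_path z 1 = e"
        by (simp_all add: e_def sphere_path_1[of z y])
      have "e \<in> topspace infinite_sphere"
        using sphere_path_in_nsphere[OF yz(1), of 1] sub unfolding e_def by auto
      then obtain W where "e \<in> W" "\<forall>u\<in>W. \<forall>v\<in>W. \<forall>w\<in>W. \<psi> u v + \<psi> v w + \<psi> u w = 0"
        using coc[of e] by blast
      then have "\<psi> e e = 0"
        using bit_cocycle_sym(1)[of W \<psi> e e] by simp
      moreover have "g y + g z = \<psi> (sphere_path y 0) (sphere_path z 0) + \<psi> (sphere_path y 1) (sphere_path z 1)"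
        using V(3) that .
      ultimately show ?thesis
        unfolding e sphere_path_0[OF yz(1)] sphere_path_0[OF yz(2)] by simp
    qed
    then show ?thesis using V by blast
  qed
  have "\<exists>U. openin infinite_sphere U \<and> x \<in> U \<and> (\<forall>y\<in>U. \<forall>z\<in>U. g y + g z = \<psi> y z)"
    if x: "x \<in> topspace infinite_sphere" for x
  proof -
    obtain W where W: "openin infinite_sphere W" "x \<in> W"
      "\<And>u v w. u \<in> W \<Longrightarrow> v \<in> W \<Longrightarrow> w \<in> W \<Longrightarrow> \<psi> u v + \<psi> v w + \<psi> u w = 0"
      using coc[OF x] by blast
    let ?U = "{y \<in> W. \<psi> x y + g y = g x}"
    have "openin infinite_sphere ?U"
      unfolding openin_infinite_sphere
    proof (intro conjI allI)
      show "?U \<subseteq> (\<Union>n. topspace (nsphere n))"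
        using openin_subset[OF W(1)] unfolding topspace_infinite_sphere by blast
      fix n
      show "openin (nsphere n) (?U \<inter> topspace (nsphere n))"
        unfolding openin_subopen[of _ "?U \<inter> topspace (nsphere n)"]
      proof
        fix y assume y: "y \<in> ?U \<inter> topspace (nsphere n)"
        obtain V where V: "openin (nsphere n) V" "y \<in> V" "\<And>u v. u \<in> V \<Longrightarrow> v \<in> V \<Longrightarrow> g u + g v = \<psi> u v"
          using finite_dim[OF IntD2[OF y]] by blast
        have "z \<in> ?U" if "z \<in> V \<inter> W" for z
        proof -
          have "\<psi> x y + \<psi> y z + \<psi> x z = 0"
            using W y that by (intro W(3)) auto
          moreover have "g y + g z = \<psi> y z"
            using V that by auto
          ultimately have "g y + \<psi> x y = g z + \<psi> x z"
            by (intro bit_sums(4)[of "g y"])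
          then show ?thesis using y that by (simp add: add.commute)
        qed
        moreover have "openin (nsphere n) (V \<inter> (W \<inter> topspace (nsphere n)))"
          using W(1)[unfolded openin_infinite_sphere, THEN conjunct2, THEN spec, of n]
          by (rule openin_Int[OF V(1)])
        ultimately show "\<exists>T. openin (nsphere n) T \<and> y \<in> T \<and> T \<subseteq> ?U \<inter> topspace (nsphere n)"
          using y V(2) by (intro exI[of _ "V \<inter> (W \<inter> topspace (nsphere n))"]) auto
      qed
    qed
    moreover have "x \<in> ?U"
      using W(2) bit_cocycle_sym(1)[of W \<psi> x x] W(3) by simp
    moreover have "g y + g z = \<psi> y z" if "y \<in> ?U" "z \<in> ?U" for y z
    proof -
      have "\<psi> x y + \<psi> y z + \<psi> x z = 0"
        using W that by (intro W(3)) auto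
      moreover have "\<psi> x y + g y = \<psi> x z + g z"
        using that by simp
      ultimately show ?thesis by (rule bit_sums(6))
    qed
    ultimately show ?thesis by blast
  qed
  then have "locally_zero 1 infinite_sphere (\<lambda>xs. \<phi> xs + coboundary (\<lambda>ys. g (hd ys)) xs)"
    unfolding locally_zero_1_iff by (simp add: coboundary_small \<psi>_def add_eq_0_iff_bit add.commute)
  then show ?thesis using that by blast
qed

lemma cocycles_pullback:
  assumes "\<phi> \<in> cocycles q Y {}" "continuous_map X Y f"
  shows "(\<lambda>xs. \<phi> (map f xs)) \<in> cocycles q X {}"
  unfolding cocycles_absolute
  by (rule locally_zero_cong[OF locally_zero_pullback[OF assms[unfolded cocycles_absolute]]])
    (simp add: coboundary_pullback)

interpretation sphere: antipodal_space infinite_sphere sphere_close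
  rewrites "antipodal_quotient infinite_sphere \<equiv> RP_infinity"
  using antipodal_space_infinite_sphere by (simp_all add: RP_infinity_def)

text \<open>
  Since the pullback of \<open>\<theta>\<close> is invariant, \<open>g(x) + g(-x)\<close> is locally constant, hence constant on the
  connected space \<open>S\<^sup>\<infinity>\<close>.
\<close>

lemma RP_infinity_primitive:
  assumes \<theta>: "\<theta> \<in> cocycles 1 RP_infinity {}"
  obtains g \<epsilon> where
    "locally_zero 1 infinite_sphere (\<lambda>xs. \<theta> (map (\<lambda>x. {x, - x}) xs) + coboundary (\<lambda>ys. g (hd ys)) xs)"
    "\<And>x. x \<in> topspace infinite_sphere \<Longrightarrow> g (- x) = g x + \<epsilon>"
proof -
  let ?\<theta> = "\<lambda>xs. \<theta> (map (\<lambda>x. {x, - x}) xs)"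
  have "?\<theta> \<in> cocycles 1 infinite_sphere {}"
    by (rule cocycles_pullback[OF \<theta> sphere.continuous_map_antipodal_quotient])
  then obtain g where g: "locally_zero 1 infinite_sphere (\<lambda>xs. ?\<theta> xs + coboundary (\<lambda>ys. g (hd ys)) xs)"
    using cocycle_infinite_sphere_exact by blast
  have locally_const: "\<exists>U. openin infinite_sphere U \<and> x \<in> U \<and> (\<forall>y\<in>U. h y + h (- y) = h x + h (- x))"
    if h: "locally_zero 1 infinite_sphere (\<lambda>xs. \<eta> (map (\<lambda>x. {x, - x}) xs) + coboundary (\<lambda>ys. h (hd ys)) xs)"
      and x: "x \<in> topspace infinite_sphere" for x h \<eta>
  proof -
    have near: "\<exists>U. openin infinite_sphere U \<and> x \<in> U \<and>
        (\<forall>y\<in>U. \<forall>z\<in>U. \<eta> [{y, - y}, {z, - z}] = h z + h y)" if "x \<in> topspace infinite_sphere" for x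
      using h[unfolded locally_zero_1_iff, THEN bspec, OF that]
      by (simp only: coboundary_small list.map list.sel add_eq_0_iff_bit)
    obtain U where U: "openin infinite_sphere U" "x \<in> U"
      "\<And>y z. y \<in> U \<Longrightarrow> z \<in> U \<Longrightarrow> \<eta> [{y, - y}, {z, - z}] = h z + h y"
      using near[OF x] by blast
    obtain U' where U': "openin infinite_sphere U'" "- x \<in> U'"
      "\<And>y z. y \<in> U' \<Longrightarrow> z \<in> U' \<Longrightarrow> \<eta> [{y, - y}, {z, - z}] = h z + h y"
      using near[OF sphere.uminus_in_topspace[OF x]] by blast
    let ?V = "U \<inter> uminus ` U'"
    have mem: "- y \<in> U'" if "y \<in> ?V" for y
      using that minus_minus_seq by auto
    have xV: "x \<in> ?V"
      using U(2) U'(2) by (metis IntI imageI minus_minus_seq)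
    have "h y + h (- y) = h x + h (- x)" if y: "y \<in> ?V" for y
    proof -
      have "h y + h x = \<eta> [{x, - x}, {y, - y}]"
        using U(3)[OF U(2) IntD1[OF y]] by simp
      also have "\<dots> = \<eta> [{- x, - (- x)}, {- y, - (- y)}]"
        by (simp only: minus_minus_seq insert_commute)
      also have "\<dots> = h (- y) + h (- x)"
        using U'(3)[OF U'(2) mem[OF y]] .
      finally show ?thesis by (rule bit_sums(7))
    qed
    moreover have "openin infinite_sphere ?V"
      using U(1) U'(1) by (intro openin_Int openin_infinite_sphere_uminus)
    ultimately show ?thesis using xV by blast
  qed
  obtain e where e: "e \<in> topspace infinite_sphere"
    using in_topspace_nsphere by (auto simp: topspace_infinite_sphere)
  define \<epsilon> where "\<epsilon> = g e + g (- e)"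
  have \<epsilon>: "g (- x) = g x + \<epsilon>" if "x \<in> topspace infinite_sphere" for x
  proof -
    have "g x + g (- x) = \<epsilon>"
      unfolding \<epsilon>_def by (rule locally_constant_infinite_sphere[OF locally_const[OF g] that e])
    then show ?thesis by (metis bit_add_self(2))
  qed
  show ?thesis by (rule that[of g \<epsilon>, OF g \<epsilon>])
qed

text \<open>
  The primitive \<open>g\<close> descends to the projective space precisely if it is even.
\<close>

lemma RP_infinity_exact_iff:
  assumes g: "locally_zero 1 infinite_sphere (\<lambda>xs. \<theta> (map (\<lambda>x. {x, - x}) xs) + coboundary (\<lambda>ys. g (hd ys)) xs)"
    and \<epsilon>: "\<And>x. x \<in> topspace infinite_sphere \<Longrightarrow> g (- x) = g x + \<epsilon>"
  shows "\<epsilon> = 0 \<longleftrightarrow> \<theta> \<in> coboundaries 1 RP_infinity {}"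
proof -
  let ?\<theta> = "\<lambda>xs. \<theta> (map (\<lambda>x. {x, - x}) xs)"
  obtain e where e: "e \<in> topspace infinite_sphere"
    using in_topspace_nsphere by (auto simp: topspace_infinite_sphere)
  show "\<epsilon> = 0 \<longleftrightarrow> \<theta> \<in> coboundaries 1 RP_infinity {}"
  proof
    assume "\<epsilon> = 0"
    have "g (hd (map uminus xs)) = g (hd xs)" if "set xs \<subseteq> topspace infinite_sphere" for xs
      using that \<epsilon> \<open>\<epsilon> = 0\<close> by (cases xs) auto
    then have "(\<lambda>xs. ?\<theta> xs) \<in> antipodal_coboundaries 1 infinite_sphere"
      unfolding antipodal_coboundaries_def using g
      by (intro CollectI exI[of _ "\<lambda>ys. g (hd ys)"] conjI allI impI) auto
    then show "\<theta> \<in> coboundaries 1 RP_infinity {}"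
      by (simp add: sphere.coboundaries_antipodal_quotient)
  next
    assume "\<theta> \<in> coboundaries 1 RP_infinity {}"
    then obtain b where b: "\<And>xs. set xs \<subseteq> topspace infinite_sphere \<Longrightarrow> b (map uminus xs) = b xs"
      "locally_zero 1 infinite_sphere (\<lambda>xs. ?\<theta> xs + coboundary b xs)"
      unfolding sphere.coboundaries_antipodal_quotient antipodal_coboundaries_def by blast
    define h where "h = (\<lambda>x. g x + b [x])"
    have "locally_zero 1 infinite_sphere (\<lambda>xs. coboundary (\<lambda>ys. h (hd ys)) xs)"
      by (rule locally_zero_cong[OF locally_zero_add[OF g b(2)]])
        (auto simp: length_Suc_conv coboundary_small h_def ac_simps)
    note const = this
    have "\<exists>U. openin infinite_sphere U \<and> x \<in> U \<and> (\<forall>y\<in>U. h y = h x)" if x: "x \<in> topspace infinite_sphere" for x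
      using const[unfolded locally_zero_1_iff, THEN bspec, OF x]
      by (simp only: coboundary_small list.map list.sel add_eq_0_iff_bit) blast
    then have "h e = h (- e)"
      using e sphere.uminus_in_topspace[OF e] by (rule locally_constant_infinite_sphere)
    moreover have "b [- e] = b [e]"
      using b(1)[of "[e]"] e by simp
    ultimately have "g e = g (- e)"
      by (simp add: h_def)
    then show "\<epsilon> = 0"
      using \<epsilon>[OF e] by simp
  qed
qed

text \<open>
  The sign of the first nonzero coordinate is an odd function, and on pairs of points its
  coboundary is even and therefore descends.
\<close>

lemma RP_infinity_nontrivial_cocycle:
  obtains \<theta> g where "\<theta> \<in> cocycles 1 RP_infinity {}"
    "locally_zero 1 infinite_sphere (\<lambda>xs. \<theta> (map (\<lambda>x. {x, - x}) xs) + coboundary (\<lambda>ys. g (hd ys)) xs)"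
    "\<And>x. x \<in> topspace infinite_sphere \<Longrightarrow> g (- x) = g x + 1"
proof -
  define g :: "(nat \<Rightarrow> real) \<Rightarrow> bit" where "g = (\<lambda>x. if x (LEAST i. x i \<noteq> 0) > 0 then 1 else 0)"
  have g: "g (- x) = g x + 1" if x: "x \<in> topspace infinite_sphere" for x
  proof -
    obtain n where "x \<in> topspace (nsphere n)"
      using x unfolding topspace_infinite_sphere by blast
    then have "(\<Sum>i\<le>n. (x i)\<^sup>2) \<noteq> 0"
      by (simp add: in_nsphere_iff)
    then obtain i where "x i \<noteq> 0"
      by (metis (no_types, lifting) sum.neutral zero_eq_power2)
    then have "x (LEAST i. x i \<noteq> 0) \<noteq> 0"
      by (rule LeastI)
    then show ?thesis by (auto simp: g_def)
  qed
  \<comment> \<open>only pairs matter; at triples the coboundary of \<open>g \<circ> hd\<close> is not even\<close>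
  define b :: "(nat \<Rightarrow> real) cochain" where "b = (\<lambda>xs. if length xs = 2 then g (xs ! 0) + g (xs ! 1) else 0)"
  have "b (map uminus xs) = b xs" if xs: "set xs \<subseteq> topspace infinite_sphere" for xs
  proof (cases "length xs = 2")
    case True
    then have "xs ! 0 \<in> topspace infinite_sphere" "xs ! 1 \<in> topspace infinite_sphere"
      using xs by (auto simp: subset_iff)
    then show ?thesis using True by (simp add: b_def g ac_simps)
  qed (simp add: b_def)
  then obtain \<theta> where \<theta>: "\<And>xs. set xs \<subseteq> topspace infinite_sphere \<Longrightarrow>
      \<forall>y\<in>set xs. \<forall>z\<in>set xs. sphere_close y z \<Longrightarrow> \<theta> (map (\<lambda>x. {x, - x}) xs) = b xs"
    using sphere.invariant_cochain_descends[of b] by blast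
  let ?\<theta> = "\<lambda>xs. \<theta> (map (\<lambda>x. {x, - x}) xs)"
  have prim: "locally_zero 1 infinite_sphere (\<lambda>xs. ?\<theta> xs + coboundary (\<lambda>ys. g (hd ys)) xs)"
  proof (rule sphere.locally_zero_if_close)
    fix xs assume "length xs = Suc 1" and xs: "set xs \<subseteq> topspace infinite_sphere"
      "\<forall>y\<in>set xs. \<forall>z\<in>set xs. sphere_close y z"
    then obtain x y where "xs = [x, y]"
      by (auto simp: length_Suc_conv)
    then show "?\<theta> xs + coboundary (\<lambda>ys. g (hd ys)) xs = 0"
      unfolding \<theta>[OF xs] by (simp add: b_def coboundary_small add_eq_0_iff_bit add.commute)
  qed
  have "locally_zero (Suc 1) infinite_sphere (coboundary ?\<theta>)"
    by (rule locally_zero_cong[OF locally_zero_coboundary[OF prim]]) (simp add: coboundary_add)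
  then have "\<theta> \<in> cocycles 1 RP_infinity {}"
    unfolding cocycles_absolute sphere.locally_zero_antipodal_quotient
    by (rule locally_zero_cong) (simp add: coboundary_pullback)
  then show ?thesis using that prim g by blast
qed

text \<open>
  Two cocycles with odd primitives have a sum with an even primitive, which is a coboundary. So there
  is exactly one nonzero class, and the definite description of the generator denotes it.
\<close>

lemma RP_generator_representative:
  obtains \<theta> g where "\<theta> \<in> cocycles 1 RP_infinity {}" "RP_generator = cohomology_class 1 RP_infinity {} \<theta>"
    "locally_zero 1 infinite_sphere (\<lambda>xs. \<theta> (map (\<lambda>x. {x, - x}) xs) + coboundary (\<lambda>ys. g (hd ys)) xs)"
    "\<And>x. x \<in> topspace infinite_sphere \<Longrightarrow> g (- x) = g x + 1"
proof -
  obtain \<theta> g where \<theta>: "\<theta> \<in> cocycles 1 RP_infinity {}"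
    and g: "locally_zero 1 infinite_sphere (\<lambda>xs. \<theta> (map (\<lambda>x. {x, - x}) xs) + coboundary (\<lambda>ys. g (hd ys)) xs)"
      "\<And>x. x \<in> topspace infinite_sphere \<Longrightarrow> g (- x) = g x + 1"
    using RP_infinity_nontrivial_cocycle by blast
  have "RP_generator = cohomology_class 1 RP_infinity {} \<theta>"
    unfolding RP_generator_def
  proof (rule the_equality, intro conjI)
    show "cohomology_class 1 RP_infinity {} \<theta> \<in> carrier (cohomology 1 RP_infinity {})"
      using \<theta> by (auto simp: carrier_cohomology)
    show "cohomology_class 1 RP_infinity {} \<theta> \<noteq> \<one>\<^bsub>cohomology 1 RP_infinity {}\<^esub>"
      unfolding cohomology_class_trivial_iff using RP_infinity_exact_iff[where g = g and \<epsilon> = 1, OF g] by simp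
    fix w assume "w \<in> carrier (cohomology 1 RP_infinity {}) \<and> w \<noteq> \<one>\<^bsub>cohomology 1 RP_infinity {}\<^esub>"
    then obtain \<eta> where \<eta>: "\<eta> \<in> cocycles 1 RP_infinity {}" "w = cohomology_class 1 RP_infinity {} \<eta>"
      and "w \<noteq> \<one>\<^bsub>cohomology 1 RP_infinity {}\<^esub>"
      unfolding carrier_cohomology by blast
    then have nontriv: "\<eta> \<notin> coboundaries 1 RP_infinity {}"
      by (metis cohomology_class_trivial_iff)
    obtain h \<epsilon> where h: "locally_zero 1 infinite_sphere (\<lambda>xs. \<eta> (map (\<lambda>x. {x, - x}) xs) + coboundary (\<lambda>ys. h (hd ys)) xs)"
      "\<And>x. x \<in> topspace infinite_sphere \<Longrightarrow> h (- x) = h x + \<epsilon>"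
      using RP_infinity_primitive[OF \<eta>(1)] by blast
    have "\<epsilon> = 1"
      using RP_infinity_exact_iff[where g = h and \<epsilon> = \<epsilon>, OF h] nontriv by simp
    have "(\<lambda>xs. \<eta> xs + \<theta> xs) \<in> coboundaries 1 RP_infinity {}"
    proof (rule RP_infinity_exact_iff[where g = "\<lambda>x. h x + g x" and \<epsilon> = 0, THEN iffD1, OF _ _ refl])
      show "locally_zero 1 infinite_sphere (\<lambda>xs. (\<eta> (map (\<lambda>x. {x, - x}) xs) + \<theta> (map (\<lambda>x. {x, - x}) xs)) +
          coboundary (\<lambda>ys. h (hd ys) + g (hd ys)) xs)"
        by (rule locally_zero_cong[OF locally_zero_add[OF h(1) g(1)]]) (simp add: coboundary_add ac_simps)
      show "h (- x) + g (- x) = h x + g x + 0" if "x \<in> topspace infinite_sphere" for x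
        using h(2)[OF that] g(2)[OF that] \<open>\<epsilon> = 1\<close> by (simp add: ac_simps)
    qed
    then show "w = cohomology_class 1 RP_infinity {} \<theta>"
      unfolding \<eta>(2) cohomology_class_eq_iff .
  qed
  then show ?thesis using that \<theta> g by blast
qed

section \<open>Transfer for antipodal double covers\<close>

text \<open>
  Here \<open>y\<close> is close to \<open>x\<close> if it is nearer to \<open>x\<close> than \<open>- y\<close> is.
\<close>

lemma antipodal_space_normed:
  fixes A :: "'a::real_normed_vector set"
  assumes "symmetric_set A" "0 \<notin> A"
  shows "antipodal_space (top_of_set A) (\<lambda>x y. norm (x - y) < norm (x + y))"
proof
  fix U assume "openin (top_of_set A) U"
  then obtain T where T: "open T" "U = A \<inter> T"
    by (auto simp: openin_open)
  have "uminus ` U = uminus ` A \<inter> uminus ` T"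
    unfolding T(2) by (intro image_Int) simp
  then have "uminus ` U = A \<inter> uminus ` T"
    using assms(1) by (simp add: symmetric_set_def)
  then show "openin (top_of_set A) (uminus ` U)"
    using open_negations[OF T(1)] by (auto simp: openin_open)
next
  fix x assume "x \<in> topspace (top_of_set A)"
  then have x: "x \<in> A" "x \<noteq> 0" using assms(2) by auto
  have "norm (y - z) < norm (y + z)" if "dist x y < norm x / 2" "dist x z < norm x / 2" for y z
  proof -
    have "norm (y - z) \<le> dist x y + dist x z"
      using dist_triangle3[of y z x] by (simp add: dist_norm)
    moreover have "norm (2 *\<^sub>R x) \<le> norm (y + z) + (norm (x - y) + norm (x - z))"
      using norm_triangle_ineq[of "y + z" "(x - y) + (x - z)"] norm_triangle_ineq[of "x - y" "x - z"]
      by (simp add: scaleR_2 algebra_simps)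
    ultimately show ?thesis
      using that by (simp add: dist_norm)
  qed
  then show "\<exists>U. openin (top_of_set A) U \<and> x \<in> U \<and> (\<forall>y\<in>U. \<forall>z\<in>U. norm (y - z) < norm (y + z))"
    using x by (intro exI[of _ "A \<inter> ball x (norm x / 2)"]) auto
next
  fix x y :: 'a assume "norm (x - y) < norm (x + y)"
  moreover have "norm (- x - - y) = norm (x - y)" "norm (- x + - y) = norm (x + y)"
    using norm_minus_cancel[of "x - y"] norm_minus_cancel[of "x + y"] by (simp_all add: algebra_simps)
  ultimately show "norm (- x - - y) < norm (- x + - y)"
    by simp
qed auto

text \<open>
  Only the values of \<open>b\<close> at lists of length \<open>n\<close> enter its coboundary in degree \<open>n\<close>, so the others may
  be replaced by zero.
\<close>

lemma antipodal_coboundariesI: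
  assumes inv: "\<And>xs. length xs = n \<Longrightarrow> set xs \<subseteq> topspace X \<Longrightarrow> b (map uminus xs) = b xs"
    and "n = 0 \<Longrightarrow> b [] = 0" and zero: "locally_zero n X (\<lambda>xs. \<phi> xs + coboundary b xs)"
  shows "\<phi> \<in> antipodal_coboundaries n X"
proof -
  let ?b = "\<lambda>xs. if length xs = n then b xs else 0"
  have "coboundary ?b xs = coboundary b xs" if "length xs = Suc n" for xs
    unfolding coboundary_def using that by (intro sum.cong refl) (auto simp: min_def)
  then have "locally_zero n X (\<lambda>xs. \<phi> xs + coboundary ?b xs)"
    by (intro locally_zero_cong[OF zero]) simp
  moreover have "?b (map uminus xs) = ?b xs" if "set xs \<subseteq> topspace X" for xs
    using inv[of xs] that by simp
  ultimately show ?thesis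
    unfolding antipodal_coboundaries_def using assms(2) by (intro CollectI exI[of _ ?b]) auto
qed

lemma antipodal_coboundaries_cong:
  assumes "\<phi> \<in> antipodal_coboundaries n X" "locally_zero n X (\<lambda>xs. \<phi> xs + \<psi> xs)"
  shows "\<psi> \<in> antipodal_coboundaries n X"
proof -
  obtain b where b: "\<forall>xs. set xs \<subseteq> topspace X \<longrightarrow> b (map uminus xs) = b xs" "n = 0 \<longrightarrow> b [] = 0"
    "locally_zero n X (\<lambda>xs. \<phi> xs + coboundary b xs)"
    using assms(1) unfolding antipodal_coboundaries_def by blast
  have "locally_zero n X (\<lambda>xs. \<psi> xs + coboundary b xs)"
    by (rule locally_zero_cong[OF locally_zero_add[OF assms(2) b(3)]]) (simp add: ac_simps)
  then show ?thesis
    unfolding antipodal_coboundaries_def using b(1,2) by blast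
qed

text \<open>
  The transition cochain of a double cover whose sheets are labelled by \<open>\<sigma>\<close>: at a pair of points it
  tells whether the labels differ. For odd \<open>\<sigma>\<close> it is locally the pullback of a cocycle of the quotient that
  represents the first Stiefel--Whitney class of the cover.
\<close>

definition transition :: "('a \<Rightarrow> bit) \<Rightarrow> 'a cochain" where
  "transition \<sigma> = coboundary (\<lambda>xs. \<sigma> (hd xs))"

lemma coboundary_transition [simp]: "coboundary (transition \<sigma>) = (\<lambda>xs. 0)"
  by (simp add: transition_def)

lemma transition_add: "transition (\<lambda>x. \<sigma> x + \<tau> x) xs = transition \<sigma> xs + transition \<tau> xs"
  by (simp add: transition_def coboundary_add)

locale odd_function =
  fixes X :: "'a::uminus topology" and \<sigma> :: "'a \<Rightarrow> bit"
  assumes odd: "x \<in> topspace X \<Longrightarrow> \<sigma> (- x) = \<sigma> x + 1"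
begin

lemma transition_invariant:
  assumes "length xs = 2" "set xs \<subseteq> topspace X"
  shows "transition \<sigma> (map uminus xs) = transition \<sigma> xs"
proof -
  obtain x y where "xs = [x, y]"
    using assms(1) by (auto simp: length_Suc_conv numeral_2_eq_2)
  then show ?thesis
    using assms(2) by (simp add: transition_def coboundary_small odd ac_simps)
qed

lemma cup_power_transition_invariant:
  assumes "length xs = Suc n" "set xs \<subseteq> topspace X"
  shows "cup_power_cochain (transition \<sigma>) n (map uminus xs) = cup_power_cochain (transition \<sigma>) n xs"
  using assms
proof (induction n arbitrary: xs)
  case (Suc n)
  have "set (take (Suc n) xs) \<subseteq> topspace X" "set (drop n xs) \<subseteq> topspace X"
    using Suc.prems(2) set_take_subset set_drop_subset by fast+
  then show ?case
    using Suc.IH[of "take (Suc n) xs"] transition_invariant[of "drop n xs"] Suc.prems(1)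
    by (simp add: cup_cochain_def take_map drop_map)
qed simp

lemma coboundary_cup_power_transition:
  assumes "length xs = Suc (Suc n)"
  shows "coboundary (cup_cochain n (cup_power_cochain (transition \<sigma>) n) (\<lambda>ys. \<tau> (hd ys))) xs =
    cup_cochain n (cup_power_cochain (transition \<sigma>) n) (transition \<tau>) xs"
proof -
  have "coboundary (cup_power_cochain (transition \<sigma>) n) (take (Suc (Suc n)) xs) = 0"
    using assms by (intro coboundary_cup_power_cochain) simp_all
  then show ?thesis
    using coboundary_cup[of xs n 0] assms by (simp add: cup_cochain_def[of "Suc n"] transition_def)
qed

text \<open>
  This is exactness of the transfer sequence: a class whose product with the class of the cover
  vanishes is a transfer. The term added to \<open>b\<close> has the coboundary \<open>e\<^bsub>n+1\<^esub> = e\<^sub>n \<union> d\<sigma>\<close>, and since \<open>\<sigma>\<close>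
  changes by one under the involution, it contributes \<open>e\<^sub>n\<close> to the transfer \<open>c(x) + c(-x)\<close>, while \<open>b\<close>
  contributes nothing.
\<close>

lemma index_class:
  assumes "cup_power_cochain (transition \<sigma>) (Suc n) \<in> antipodal_coboundaries (Suc n) X"
  obtains c where "locally_zero (Suc n) X (coboundary c)"
    "\<And>xs. length xs = Suc n \<Longrightarrow> set xs \<subseteq> topspace X \<Longrightarrow>
      c xs + c (map uminus xs) = cup_power_cochain (transition \<sigma>) n xs"
proof -
  let ?e = "cup_power_cochain (transition \<sigma>)"
  obtain b where b: "\<And>xs. set xs \<subseteq> topspace X \<Longrightarrow> b (map uminus xs) = b xs"
    "locally_zero (Suc n) X (\<lambda>xs. ?e (Suc n) xs + coboundary b xs)"
    using assms unfolding antipodal_coboundaries_def by blast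
  define c where "c = (\<lambda>xs. b xs + cup_cochain n (?e n) (\<lambda>ys. \<sigma> (hd ys)) xs)"
  have "locally_zero (Suc n) X (coboundary c)"
    by (rule locally_zero_cong[OF b(2)])
      (simp add: c_def coboundary_add coboundary_cup_power_transition add.commute)
  moreover have "c xs + c (map uminus xs) = ?e n xs" if xs: "length xs = Suc n" "set xs \<subseteq> topspace X" for xs
  proof -
    have "drop n xs = [xs ! n]"
      using xs(1) by (simp add: Cons_nth_drop_Suc[symmetric])
    moreover have "xs ! n \<in> topspace X"
      using xs by (auto simp: subset_iff)
    ultimately show ?thesis
      using xs by (simp add: c_def cup_cochain_def b(1) drop_map cup_power_transition_invariant odd
          distrib_left ac_simps)
  qed
  ultimately show ?thesis using that by blast
qed

end

text \<open>
  Two labellings differ by an invariant function \<open>\<eta>\<close>, so their transition cochains differ by the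
  coboundary of an invariant cochain. The Leibniz rule propagates this to all powers. The lemma is used
  to compare a classifying map of a set with the restriction of a classifying map of a larger set.
\<close>

lemma cup_power_transition_independent:
  assumes "odd_function X \<sigma>" "odd_function X \<tau>"
    and "cup_power_cochain (transition \<sigma>) n \<in> antipodal_coboundaries n X"
  shows "cup_power_cochain (transition \<tau>) n \<in> antipodal_coboundaries n X"
proof -
  interpret \<sigma>: odd_function X \<sigma> by fact
  interpret \<tau>: odd_function X \<tau> by fact
  define \<eta> where "\<eta> = (\<lambda>x. \<sigma> x + \<tau> x)"
  have \<eta>: "\<eta> (- x) = \<eta> x" if "x \<in> topspace X" for x
    using that by (simp add: \<eta>_def \<sigma>.odd \<tau>.odd ac_simps)
  have \<tau>_eq: "transition \<tau> xs = transition \<sigma> xs + transition \<eta> xs" for xs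
    by (simp add: \<eta>_def transition_add)
  have "\<exists>\<zeta>. (\<forall>xs. length xs = n \<longrightarrow> set xs \<subseteq> topspace X \<longrightarrow> \<zeta> (map uminus xs) = \<zeta> xs) \<and>
      (n = 0 \<longrightarrow> \<zeta> [] = 0) \<and> (\<forall>xs. length xs = Suc n \<longrightarrow>
      cup_power_cochain (transition \<tau>) n xs = cup_power_cochain (transition \<sigma>) n xs + coboundary \<zeta> xs)"
  proof (induction n)
    case 0
    show ?case by (intro exI[of _ "\<lambda>xs. 0"]) simp
  next
    case (Suc n)
    then obtain \<zeta> where \<zeta>: "\<And>xs. length xs = n \<Longrightarrow> set xs \<subseteq> topspace X \<Longrightarrow> \<zeta> (map uminus xs) = \<zeta> xs"
      "n = 0 \<Longrightarrow> \<zeta> [] = 0" "\<And>xs. length xs = Suc n \<Longrightarrow>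
      cup_power_cochain (transition \<tau>) n xs = cup_power_cochain (transition \<sigma>) n xs + coboundary \<zeta> xs"
      by blast
    \<comment> \<open>for \<open>n = 0\<close> the cochain \<open>\<zeta>\<close> has degree \<open>-1\<close> and contributes nothing\<close>
    define \<xi> where "\<xi> = (if n = 0 then (\<lambda>xs. 0) else cup_cochain (n - 1) \<zeta> (transition \<sigma>))"
    define \<kappa> where "\<kappa> = cup_cochain n (cup_power_cochain (transition \<tau>) n) (\<lambda>ys. \<eta> (hd ys))"
    have \<xi>: "coboundary \<xi> xs = cup_cochain n (coboundary \<zeta>) (transition \<sigma>) xs" if xs: "length xs = Suc (Suc n)" for xs
    proof (cases n)
      case 0
      then obtain x y where "xs = [x, y]"
        using xs by (auto simp: length_Suc_conv)
      then show ?thesis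
        using 0 \<zeta>(2) by (simp add: \<xi>_def cup_cochain_def coboundary_small)
    next
      case (Suc m)
      then show ?thesis
        using coboundary_cup[of xs m 1 \<zeta> "transition \<sigma>"] xs
        by (simp add: \<xi>_def cup_cochain_def[of m _ "\<lambda>xs. 0"])
    qed
    have "cup_power_cochain (transition \<tau>) (Suc n) xs =
        cup_power_cochain (transition \<sigma>) (Suc n) xs + coboundary (\<lambda>ys. \<xi> ys + \<kappa> ys) xs"
      if xs: "length xs = Suc (Suc n)" for xs
    proof -
      have "coboundary \<kappa> xs = cup_cochain n (cup_power_cochain (transition \<tau>) n) (transition \<eta>) xs"
        unfolding \<kappa>_def by (rule \<tau>.coboundary_cup_power_transition[OF xs])
      moreover have "length (take (Suc n) xs) = Suc n" using xs by simp
      ultimately show ?thesis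
        unfolding coboundary_add \<xi>[OF xs] using \<zeta>(3)[of "take (Suc n) xs"]
        by (simp add: cup_cochain_def \<tau>_eq distrib_left distrib_right ac_simps)
    qed
    moreover have "\<xi> (map uminus xs) + \<kappa> (map uminus xs) = \<xi> xs + \<kappa> xs"
      if xs: "length xs = Suc n" "set xs \<subseteq> topspace X" for xs
    proof -
      have "drop n xs = [xs ! n]"
        using xs(1) by (simp add: Cons_nth_drop_Suc[symmetric])
      moreover have "xs ! n \<in> topspace X"
        using xs by (auto simp: subset_iff)
      ultimately have "\<kappa> (map uminus xs) = \<kappa> xs"
        using xs by (simp add: \<kappa>_def cup_cochain_def drop_map \<tau>.cup_power_transition_invariant \<eta>)
      moreover have "\<xi> (map uminus xs) = \<xi> xs"
      proof (cases n)
        case (Suc m)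
        have "set (take n xs) \<subseteq> topspace X" "set (drop m xs) \<subseteq> topspace X"
          using xs(2) set_take_subset set_drop_subset by fast+
        then show ?thesis
          using \<zeta>(1)[of "take n xs"] \<sigma>.transition_invariant[of "drop m xs"] xs(1) Suc
          by (simp add: \<xi>_def cup_cochain_def take_map drop_map)
      qed (simp add: \<xi>_def)
      ultimately show ?thesis by simp
    qed
    ultimately show ?case by (intro exI[of _ "\<lambda>xs. \<xi> xs + \<kappa> xs"]) auto
  qed
  then obtain \<zeta> where \<zeta>: "\<And>xs. length xs = n \<Longrightarrow> set xs \<subseteq> topspace X \<Longrightarrow> \<zeta> (map uminus xs) = \<zeta> xs"
      "n = 0 \<Longrightarrow> \<zeta> [] = 0" "\<And>xs. length xs = Suc n \<Longrightarrow>
      cup_power_cochain (transition \<tau>) n xs = cup_power_cochain (transition \<sigma>) n xs + coboundary \<zeta> xs"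
    by blast
  obtain b where b: "\<And>xs. set xs \<subseteq> topspace X \<Longrightarrow> b (map uminus xs) = b xs" "n = 0 \<longrightarrow> b [] = 0"
    "locally_zero n X (\<lambda>xs. cup_power_cochain (transition \<sigma>) n xs + coboundary b xs)"
    using assms(3) unfolding antipodal_coboundaries_def by blast
  show ?thesis
  proof (rule antipodal_coboundariesI)
    show "\<zeta> (map uminus xs) + b (map uminus xs) = \<zeta> xs + b xs" if "length xs = n" "set xs \<subseteq> topspace X" for xs
      using \<zeta>(1) b(1) that by simp
    show "\<zeta> [] + b [] = 0" if "n = 0" using that \<zeta>(2) b(2) by simp
    show "locally_zero n X (\<lambda>xs. cup_power_cochain (transition \<tau>) n xs + coboundary (\<lambda>xs. \<zeta> xs + b xs) xs)"
      by (rule locally_zero_cong[OF b(3)]) (simp add: \<zeta>(3) coboundary_add ac_simps)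
  qed
qed

section \<open>A class separating sets of equal index\<close>

text \<open>
  Pulled back along the equivariant map \<open>F\<close>, the primitive \<open>g\<close> labels the sheets over \<open>A\<close>, and its
  transition cochain is locally the pullback of the generator.
\<close>

lemma induced_generator_power_trivial_iff:
  fixes A :: "'a::real_normed_vector set"
  assumes \<theta>: "\<theta> \<in> cocycles 1 RP_infinity {}" "RP_generator = cohomology_class 1 RP_infinity {} \<theta>"
    and g: "locally_zero 1 infinite_sphere (\<lambda>xs. \<theta> (map (\<lambda>x. {x, - x}) xs) + coboundary (\<lambda>ys. g (hd ys)) xs)"
    and A: "symmetric_set A" "0 \<notin> A"
    and f: "continuous_map (antipodal_quotient (top_of_set A)) RP_infinity f"
    and F: "continuous_map (top_of_set A) infinite_sphere F" "\<And>u. u \<in> A \<Longrightarrow> f {u, - u} = {F u, - F u}"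
  shows "induced n (antipodal_quotient (top_of_set A)) f (cup_power RP_infinity RP_generator n) =
      \<one>\<^bsub>cohomology n (antipodal_quotient (top_of_set A)) {}\<^esub> \<longleftrightarrow>
    cup_power_cochain (transition (\<lambda>u. g (F u))) n \<in> antipodal_coboundaries n (top_of_set A)"
proof -
  interpret A: antipodal_space "top_of_set A" "\<lambda>x y. norm (x - y) < norm (x + y)"
    by (rule antipodal_space_normed[OF A])
  let ?p = "map (\<lambda>x. {x, - x})"
  let ?\<eta> = "\<lambda>xs. \<theta> (?p (map F xs))"
  have "locally_zero 1 (top_of_set A) (\<lambda>xs. ?\<eta> xs + transition (\<lambda>u. g (F u)) xs)"
  proof (rule locally_zero_cong[OF locally_zero_pullback[OF g F(1)]])
    fix xs :: "'a list" assume "length xs = Suc 1"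
    then obtain x y where "xs = [x, y]"
      by (auto simp: length_Suc_conv)
    then show "?\<eta> xs + coboundary (\<lambda>ys. g (hd ys)) (map F xs) = ?\<eta> xs + transition (\<lambda>u. g (F u)) xs"
      by (simp add: transition_def coboundary_small)
  qed
  then have "locally_zero n (top_of_set A) (\<lambda>xs. cup_power_cochain ?\<eta> n xs +
      cup_power_cochain (transition (\<lambda>u. g (F u))) n xs)"
    by (rule locally_zero_cup_power)
  then have close: "locally_zero n (top_of_set A) (\<lambda>xs. cup_power_cochain \<theta> n (map f (?p xs)) +
      cup_power_cochain (transition (\<lambda>u. g (F u))) n xs)"
  proof (rule locally_zero_cong)
    fix xs :: "'a list" assume "set xs \<subseteq> topspace (top_of_set A)"
    then have "map f (?p xs) = ?p (map F xs)"
      using F(2) by auto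
    moreover have "cup_power_cochain ?\<eta> n xs = cup_power_cochain \<theta> n (?p (map F xs))"
      using cup_power_cochain_pullback[of \<theta> "\<lambda>u. {F u, - F u}" n xs] by (simp add: o_def)
    ultimately show "cup_power_cochain ?\<eta> n xs + cup_power_cochain (transition (\<lambda>u. g (F u))) n xs =
        cup_power_cochain \<theta> n (map f (?p xs)) + cup_power_cochain (transition (\<lambda>u. g (F u))) n xs"
      by (simp only:)
  qed
  have "induced n (antipodal_quotient (top_of_set A)) f (cup_power RP_infinity RP_generator n) =
      cohomology_class n (antipodal_quotient (top_of_set A)) {} (\<lambda>xs. cup_power_cochain \<theta> n (map f xs))"
    unfolding \<theta>(2) cup_power_cohomology_class[OF \<theta>(1)] by (rule induced_cohomology_class[OF f])
  then have "?thesis \<longleftrightarrow> ((\<lambda>xs. cup_power_cochain \<theta> n (map f (?p xs))) \<in> antipodal_coboundaries n (top_of_set A) \<longleftrightarrow>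
      cup_power_cochain (transition (\<lambda>u. g (F u))) n \<in> antipodal_coboundaries n (top_of_set A))"
    by (simp only: cohomology_class_trivial_iff A.coboundaries_antipodal_quotient)
  moreover have "locally_zero n (top_of_set A) (\<lambda>xs. cup_power_cochain (transition (\<lambda>u. g (F u))) n xs +
      cup_power_cochain \<theta> n (map f (?p xs)))"
    using close by (simp only: add.commute)
  ultimately show ?thesis
    using close by (blast intro: antipodal_coboundaries_cong)
qed

text \<open>
  A positive finite supremum of extended natural numbers is a maximum.
\<close>

lemma cohomological_index_attained:
  assumes "cohomological_index A = enat k" "A \<noteq> {}" "k \<ge> 1"
  defines "triv \<equiv> \<lambda>n f. induced n (antipodal_quotient (top_of_set A)) f (cup_power RP_infinity RP_generator n) =
      \<one>\<^bsub>cohomology n (antipodal_quotient (top_of_set A)) {}\<^esub>"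
  shows "\<exists>f. is_classifying_map A f \<and> \<not> triv (k - 1) f"
    and "is_classifying_map A f \<Longrightarrow> triv k f"
proof -
  define S where "S = {enat m | m. m \<ge> 1 \<and> (\<exists>f. is_classifying_map A f \<and> \<not> triv (m - 1) f)}"
  have Sup: "Sup S = enat k"
    using assms(1,2) unfolding cohomological_index_def S_def triv_def by simp
  then have "S \<noteq> {}" "finite S"
    using assms(3) by (auto simp: Sup_enat_def zero_enat_def split: if_splits)
  then have "enat k \<in> S"
    using Sup Max_in[of S] by (simp add: Sup_enat_def)
  then show "\<exists>f. is_classifying_map A f \<and> \<not> triv (k - 1) f"
    unfolding S_def by auto
  assume f: "is_classifying_map A f"
  show "triv k f"
  proof (rule ccontr)
    assume "\<not> triv k f"
    then have "enat (Suc k) \<in> S"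
      using f unfolding S_def by auto
    then have "enat (Suc k) \<le> enat k"
      using Sup_upper[of "enat (Suc k)" S] Sup by simp
    then show False by simp
  qed
qed

text \<open>
  The class \<open>c\<close> has transfer \<open>e\<^sub>n\<close>, which is not the coboundary of an invariant cochain on \<open>A\<close>. For
  \<open>n = 0\<close> the arbitrary value \<open>\<beta> []\<close> makes the conclusion say that \<open>c\<close> is not constant on \<open>A\<close>.
\<close>

theorem index_separating_class:
  fixes A B :: "'a::real_normed_vector set"
  assumes "A \<subseteq> B" "A \<noteq> {}" "symmetric_set A" "symmetric_set B" "0 \<notin> B"
    and "cohomological_index A = enat (Suc n)" "cohomological_index B = enat (Suc n)"
  obtains c where "locally_zero (Suc n) (top_of_set B) (coboundary c)"
    "\<And>\<beta>. \<not> locally_zero n (top_of_set A) (\<lambda>xs. c xs + coboundary \<beta> xs)"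
proof -
  obtain \<theta> g where \<theta>: "\<theta> \<in> cocycles 1 RP_infinity {}" "RP_generator = cohomology_class 1 RP_infinity {} \<theta>"
    and g: "locally_zero 1 infinite_sphere (\<lambda>xs. \<theta> (map (\<lambda>x. {x, - x}) xs) + coboundary (\<lambda>ys. g (hd ys)) xs)"
      "\<And>x. x \<in> topspace infinite_sphere \<Longrightarrow> g (- x) = g x + 1"
    using RP_generator_representative by blast
  have B: "B \<noteq> {}" "0 \<notin> A" using assms by auto
  have odd: "odd_function (top_of_set C) (\<lambda>u. g (F u))"
    if "continuous_map (top_of_set C) infinite_sphere F" "\<forall>u\<in>C. F (- u) = - F u" for C :: "'a set" and F
  proof
    fix u assume u: "u \<in> topspace (top_of_set C)"
    then have "F u \<in> topspace infinite_sphere"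
      using continuous_map_image_subset_topspace[OF that(1)] by auto
    then show "g (F (- u)) = g (F u) + 1"
      using that(2) u g(2) by simp
  qed
  obtain f where f: "is_classifying_map A f" "induced n (antipodal_quotient (top_of_set A)) f
      (cup_power RP_infinity RP_generator n) \<noteq> \<one>\<^bsub>cohomology n (antipodal_quotient (top_of_set A)) {}\<^esub>"
    using cohomological_index_attained(1)[OF assms(6,2)] by auto
  obtain f' where f': "is_classifying_map B f'"
    using cohomological_index_attained(1)[OF assms(7) B(1)] by auto
  have f'_triv: "induced (Suc n) (antipodal_quotient (top_of_set B)) f'
      (cup_power RP_infinity RP_generator (Suc n)) = \<one>\<^bsub>cohomology (Suc n) (antipodal_quotient (top_of_set B)) {}\<^esub>"
    using cohomological_index_attained(2)[OF assms(7) B(1) _ f'] by simp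
  obtain F where F: "continuous_map (top_of_set A) infinite_sphere F" "\<forall>u\<in>A. F (- u) = - F u"
      "\<And>u. u \<in> A \<Longrightarrow> f {u, - u} = {F u, - F u}"
    and fc: "continuous_map (antipodal_quotient (top_of_set A)) RP_infinity f"
    using f(1) unfolding is_classifying_map_def by blast
  obtain F' where F': "continuous_map (top_of_set B) infinite_sphere F'" "\<forall>u\<in>B. F' (- u) = - F' u"
      "\<And>u. u \<in> B \<Longrightarrow> f' {u, - u} = {F' u, - F' u}"
    and f'c: "continuous_map (antipodal_quotient (top_of_set B)) RP_infinity f'"
    using f' unfolding is_classifying_map_def by blast
  have nontriv: "cup_power_cochain (transition (\<lambda>u. g (F u))) n \<notin> antipodal_coboundaries n (top_of_set A)"
    using f(2) induced_generator_power_trivial_iff[OF \<theta> g(1) assms(3) B(2) fc F(1,3)] by simp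
  have triv: "cup_power_cochain (transition (\<lambda>u. g (F' u))) (Suc n) \<in> antipodal_coboundaries (Suc n) (top_of_set B)"
    using f'_triv induced_generator_power_trivial_iff[OF \<theta> g(1) assms(4,5) f'c F'(1,3), of "Suc n"]
    by (simp only:)
  have F'_A: "continuous_map (top_of_set A) infinite_sphere F'"
    using F'(1) assms(1) continuous_map_from_subtopology_mono by blast
  have odd_A: "odd_function (top_of_set A) (\<lambda>u. g (F u))" "odd_function (top_of_set A) (\<lambda>u. g (F' u))"
    using F F' assms(1) by (auto intro!: odd F'_A)
  interpret B: odd_function "top_of_set B" "\<lambda>u. g (F' u)"
    by (rule odd[OF F'(1,2)])
  obtain c where c: "locally_zero (Suc n) (top_of_set B) (coboundary c)"
    "\<And>xs. length xs = Suc n \<Longrightarrow> set xs \<subseteq> topspace (top_of_set B) \<Longrightarrow>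
      c xs + c (map uminus xs) = cup_power_cochain (transition (\<lambda>u. g (F' u))) n xs"
    using B.index_class[OF triv] by blast
  have "\<not> locally_zero n (top_of_set A) (\<lambda>xs. c xs + coboundary \<beta> xs)" for \<beta>
  proof
    assume \<beta>: "locally_zero n (top_of_set A) (\<lambda>xs. c xs + coboundary \<beta> xs)"
    have "continuous_map (top_of_set A) (top_of_set A) uminus"
      using assms(3) continuous_on_minus[OF continuous_on_id, of A] by (auto simp: symmetric_set_def)
    note \<beta>' = locally_zero_pullback[OF \<beta> this]
    have "cup_power_cochain (transition (\<lambda>u. g (F' u))) n \<in> antipodal_coboundaries n (top_of_set A)"
    proof (rule antipodal_coboundariesI)
      show "\<beta> (map uminus xs) + \<beta> (map uminus (map uminus xs)) = \<beta> xs + \<beta> (map uminus xs)" for xs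
        by (simp add: o_def add.commute)
      show "\<beta> [] + \<beta> (map uminus []) = 0" by simp
      show "locally_zero n (top_of_set A) (\<lambda>xs. cup_power_cochain (transition (\<lambda>u. g (F' u))) n xs +
          coboundary (\<lambda>xs. \<beta> xs + \<beta> (map uminus xs)) xs)"
      proof (rule locally_zero_cong[OF locally_zero_add[OF \<beta> \<beta>']])
        fix xs :: "'a list" assume xs: "length xs = Suc n" "set xs \<subseteq> topspace (top_of_set A)"
        have "set xs \<subseteq> topspace (top_of_set B)" using xs(2) assms(1) by auto
        from c(2)[OF xs(1) this]
        show "c xs + coboundary \<beta> xs + (c (map uminus xs) + coboundary \<beta> (map uminus xs)) =
          cup_power_cochain (transition (\<lambda>u. g (F' u))) n xs + coboundary (\<lambda>xs. \<beta> xs + \<beta> (map uminus xs)) xs"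
          by (simp add: coboundary_add coboundary_pullback ac_simps flip: c(2))
      qed
    qed
    then show False
      using cup_power_transition_independent[OF odd_A(2,1)] nontriv by blast
  qed
  then show ?thesis using that c(1) by blast
qed

section \<open>Cohomology of a pair punctured at a point\<close>

lemma coboundary_cong:
  assumes "\<And>ys. set ys \<subseteq> set xs \<Longrightarrow> \<phi> ys = \<psi> ys"
  shows "coboundary \<phi> xs = coboundary \<psi> xs"
  unfolding coboundary_def
proof (intro sum.cong refl assms)
  fix i show "set (take i xs @ drop (Suc i) xs) \<subseteq> set xs"
    using set_take_subset[of i xs] set_drop_subset[of "Suc i" xs] by auto
qed

text \<open>
  A class \<open>c\<close> on \<open>Y\<close> is pulled back to a punctured neighbourhood of \<open>x\<^sub>0\<close>, and its image under the
  connecting homomorphism of the pair is shown to be nonzero. If it were zero, the pullback would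
  become exact on a punctured neighbourhood of \<open>x\<^sub>0\<close>, and restricting it to the image of \<open>j\<close> would make
  \<open>c\<close> exact on \<open>Z\<close>.
\<close>

theorem local_cohomology_nontrivial:
  fixes X :: "'a topology" and Y Z :: "'b topology"
  assumes x0: "x0 \<in> topspace X" "closedin X {x0}"
    and UVN: "openin X U" "closedin X V" "V \<subseteq> U" "openin X N" "x0 \<in> N" "N \<subseteq> V"
    and r: "continuous_map (subtopology X (U - {x0})) Y r"
    and c: "locally_zero (Suc n) Y (coboundary c)"
    and nontriv: "\<And>\<beta>. \<not> locally_zero n Z (\<lambda>xs. c xs + coboundary \<beta> xs)"
    and sections: "\<And>W. openin X W \<Longrightarrow> x0 \<in> W \<Longrightarrow>
      \<exists>j. continuous_map Z (subtopology X (W - {x0})) j \<and> (\<forall>z\<in>topspace Z. r (j z) = z)"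
  shows "\<not> trivial_group (cohomology (Suc n) X (topspace X - {x0}))"
proof -
  define c' where "c' = (\<lambda>xs. c (map r xs))"
  \<comment> \<open>the cutoff by \<open>V\<close> makes the cochain locally zero off \<open>U\<close>; near \<open>x\<^sub>0\<close>, on \<open>N\<close>, it changes nothing\<close>
  define \<phi> where "\<phi> = (\<lambda>xs. if set xs \<subseteq> V then coboundary c' xs else 0)"
  let ?X' = "topspace X - {x0}"
  have openX': "openin X ?X'"
    using x0(2) by (simp add: closedin_def)
  have away: "locally_zero (Suc n) (subtopology X ?X') \<phi>"
    unfolding locally_zero_def
  proof
    fix x assume "x \<in> topspace (subtopology X ?X')"
    then have x: "x \<in> topspace X" "x \<noteq> x0" by auto
    show "\<exists>P. openin (subtopology X ?X') P \<and> x \<in> P \<and>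
        (\<forall>xs. length xs = Suc (Suc n) \<and> set xs \<subseteq> P \<longrightarrow> \<phi> xs = 0)"
    proof (cases "x \<in> U")
      case True
      have openU: "openin X (U - {x0})"
        using UVN(1) x0(2) by (rule openin_diff)
      have "locally_zero (Suc n) (subtopology X (U - {x0})) (\<lambda>xs. coboundary c (map r xs))"
        by (rule locally_zero_pullback[OF c r])
      moreover have "x \<in> topspace (subtopology X (U - {x0}))"
        using True x by simp
      ultimately obtain P where P: "openin (subtopology X (U - {x0})) P" "x \<in> P"
        "\<forall>xs. length xs = Suc (Suc n) \<and> set xs \<subseteq> P \<longrightarrow> coboundary c (map r xs) = 0"
        unfolding locally_zero_def by blast
      have "openin X P" "P \<subseteq> ?X'"
        using P(1) openU openin_subset[OF UVN(1)] by (auto simp: openin_open_subtopology)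
      then have "openin (subtopology X ?X') P"
        using openX' by (simp add: openin_open_subtopology)
      moreover have "\<phi> xs = 0" if "length xs = Suc (Suc n)" "set xs \<subseteq> P" for xs
        using P(3) that by (simp add: \<phi>_def c'_def coboundary_pullback)
      ultimately show ?thesis using P(2) by blast
    next
      case False
      have "openin (subtopology X ?X') (?X' - V)"
        using openX' UVN(2) by (auto simp: openin_open_subtopology intro: openin_diff)
      moreover have "x \<in> ?X' - V"
        using False x UVN(3) by auto
      moreover have "\<phi> xs = 0" if "length xs = Suc (Suc n)" "set xs \<subseteq> ?X' - V" for xs
      proof -
        have "xs \<noteq> []" using that(1) by auto
        then have "hd xs \<in> set xs" by simp
        moreover from this have "hd xs \<notin> V"
          using that(2) by blast
        ultimately have "\<not> set xs \<subseteq> V" by blast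
        then show ?thesis by (simp add: \<phi>_def)
      qed
      ultimately show ?thesis by blast
    qed
  qed
  have "locally_zero (Suc (Suc n)) X (coboundary \<phi>)"
    unfolding locally_zero_def
  proof
    fix x assume x: "x \<in> topspace X"
    show "\<exists>P. openin X P \<and> x \<in> P \<and> (\<forall>xs. length xs = Suc (Suc (Suc n)) \<and> set xs \<subseteq> P \<longrightarrow> coboundary \<phi> xs = 0)"
    proof (cases "x = x0")
      case True
      have "coboundary \<phi> xs = 0" if "set xs \<subseteq> N" for xs
      proof -
        have "coboundary \<phi> xs = coboundary (coboundary c') xs"
          using that UVN(6) by (intro coboundary_cong) (auto simp: \<phi>_def)
        then show ?thesis by simp
      qed
      then show ?thesis using UVN(4,5) True by blast
    next
      case False
      then have "x \<in> topspace (subtopology X ?X')" using x by simp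
      then obtain P where "openin (subtopology X ?X') P" "x \<in> P"
        "\<forall>xs. length xs = Suc (Suc (Suc n)) \<and> set xs \<subseteq> P \<longrightarrow> coboundary \<phi> xs = 0"
        using locally_zero_coboundary[OF away] unfolding locally_zero_def by blast
      then show ?thesis
        using openX' by (auto simp: openin_open_subtopology)
    qed
  qed
  with away have cocycle: "\<phi> \<in> cocycles (Suc n) X ?X'"
    by (simp add: cocycles_def)
  have "\<phi> \<notin> coboundaries (Suc n) X ?X'"
  proof
    assume "\<phi> \<in> coboundaries (Suc n) X ?X'"
    then obtain \<psi> where \<psi>: "locally_zero n (subtopology X ?X') \<psi>"
      "locally_zero (Suc n) X (\<lambda>xs. \<phi> xs + coboundary \<psi> xs)"
      by (auto simp: coboundaries_def)
    obtain M where M: "openin X M" "x0 \<in> M"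
      "\<forall>xs. length xs = Suc (Suc n) \<and> set xs \<subseteq> M \<longrightarrow> \<phi> xs + coboundary \<psi> xs = 0"
      using \<psi>(2) x0(1) unfolding locally_zero_def by blast
    define \<gamma> where "\<gamma> = (\<lambda>xs. c' xs + \<psi> xs)"
    \<comment> \<open>near \<open>x\<^sub>0\<close> the coboundary of \<open>\<gamma>\<close> vanishes on all tuples, so a cone with vertex \<open>x\<^sub>0\<close> is a primitive\<close>
    define \<beta> where "\<beta> = (\<lambda>ys. \<gamma> (x0 # ys))"
    have \<gamma>: "\<gamma> xs = coboundary \<beta> xs" if xs: "length xs = Suc n" "set xs \<subseteq> M \<inter> N" for xs
    proof -
      have "coboundary \<gamma> (x0 # xs) = \<phi> (x0 # xs) + coboundary \<psi> (x0 # xs)"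
        using xs UVN(5,6) by (auto simp: \<gamma>_def coboundary_add \<phi>_def)
      also have "\<dots> = 0"
        using M xs by (intro M(3)[rule_format]) auto
      finally show ?thesis
        by (simp add: coboundary_Cons \<beta>_def add_eq_0_iff_bit)
    qed
    have "openin X (M \<inter> N)" "x0 \<in> M \<inter> N"
      using M UVN by auto
    then obtain j where j: "continuous_map Z (subtopology X (M \<inter> N - {x0})) j" "\<forall>z\<in>topspace Z. r (j z) = z"
      using sections by blast
    have "continuous_map Z (subtopology X ?X') j"
      using j(1) openin_subset[OF M(1)] by (auto simp: continuous_map_in_subtopology)
    note \<psi>j = locally_zero_pullback[OF \<psi>(1) this]
    have "locally_zero n Z (\<lambda>xs. c xs + coboundary (\<lambda>ys. \<beta> (map j ys)) xs)"
    proof (rule locally_zero_cong[OF \<psi>j])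
      fix xs assume xs: "length xs = Suc n" "set xs \<subseteq> topspace Z"
      have "set (map j xs) \<subseteq> M \<inter> N"
        using continuous_map_image_subset_topspace[OF j(1)] xs(2) by auto
      then have "coboundary \<beta> (map j xs) = \<gamma> (map j xs)"
        using \<gamma>[of "map j xs"] xs(1) by simp
      moreover have "map r (map j xs) = xs"
        using j(2) xs(2) by (simp add: map_idI subset_iff)
      ultimately show "\<psi> (map j xs) = c xs + coboundary (\<lambda>ys. \<beta> (map j ys)) xs"
        unfolding coboundary_pullback by (simp only: \<gamma>_def c'_def bit_add_self)
    qed
    then show False using nontriv by blast
  qed
  then have "cohomology_class (Suc n) X ?X' \<phi> \<noteq> \<one>\<^bsub>cohomology (Suc n) X ?X'\<^esub>"
    by (metis cohomology_class_trivial_iff)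
  moreover have "cohomology_class (Suc n) X ?X' \<phi> \<in> carrier (cohomology (Suc n) X ?X')"
    unfolding carrier_cohomology using cocycle by blast
  ultimately show ?thesis
    by (auto simp: trivial_group_def)
qed

section \<open>Scalings and the critical group\<close>

lemma scaling_radial_projection:
  assumes sc: "is_scaling sc s" and I: "is_scaled_functional sc s I"
    and r_def: "r = (\<lambda>u. sc u (I u powr (- (1 / s))))"
  shows "I 0 = 0"
    and "continuous_on (UNIV - {0}) r"
    and "u \<noteq> 0 \<Longrightarrow> I (r u) = 1"
    and "u \<noteq> 0 \<Longrightarrow> sc (r u) (I u powr (1 / s)) = u"
    and "I u = 1 \<Longrightarrow> t > 0 \<Longrightarrow> r (sc u t) = u"
proof -
  have s: "s > 0"
    and sc_cont: "continuous_on (UNIV \<times> {0..}) (\<lambda>(u, t). sc u t)"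
    and sc_sc: "\<And>u t t'. t \<ge> 0 \<Longrightarrow> t' \<ge> 0 \<Longrightarrow> sc (sc u t) t' = sc u (t * t')"
    and sc01: "\<And>u. sc u 0 = 0" "\<And>u. sc u 1 = u"
    using sc unfolding is_scaling_def by auto
  have I_cont: "continuous_on UNIV I"
    and I_sc: "\<And>u t. t \<ge> 0 \<Longrightarrow> I (sc u t) = t powr s * I u"
    and I_pos: "\<And>u. u \<noteq> 0 \<Longrightarrow> I u > 0"
    using I unfolding is_scaled_functional_def by auto
  show "I 0 = 0"
    using I_sc[of 0 0] sc01(1)[of 0] by simp
  have "continuous_on (UNIV - {0}) (\<lambda>u. (u, I u powr (- (1 / s))))"
    using I_pos continuous_on_subset[OF I_cont]
    by (intro continuous_intros) (auto simp: less_imp_neq[THEN not_sym])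
  then have "continuous_on (UNIV - {0}) (\<lambda>u. (\<lambda>(u, t). sc u t) (u, I u powr (- (1 / s))))"
    by (rule continuous_on_compose2[OF sc_cont]) auto
  then show "continuous_on (UNIV - {0}) r"
    by (simp add: r_def)
  {
    assume u: "u \<noteq> 0"
    have "(I u powr (- (1 / s))) powr s = I u powr (- 1)"
      using s by (simp only: powr_powr) simp
    then show "I (r u) = 1"
      using I_pos[OF u] by (simp add: r_def I_sc powr_neg_one)
    have "I u powr (- (1 / s)) * I u powr (1 / s) = 1"
      using I_pos[OF u] by (simp flip: powr_add)
    then show "sc (r u) (I u powr (1 / s)) = u"
      by (simp add: r_def sc_sc sc01)
  }
  assume u: "I u = 1" and t: "t > 0"
  have "t * (t powr s) powr (- (1 / s)) = 1"
    using s t by (simp add: powr_powr powr_minus)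
  then show "r (sc u t) = u"
    using t by (simp add: r_def I_sc u sc_sc sc01)
qed

text \<open>
  The scaled vectors \<open>sc u t\<close> tend to \<open>0\<close> as \<open>t \<rightarrow> 0\<close> for every \<open>u\<close>, but uniformity in \<open>u\<close> is not part of
  the definition of a scaling. A parameter depending continuously on \<open>u\<close> is obtained from the distance
  to the closed set of pairs at which the scaled vector lies outside the neighbourhood.
\<close>

lemma scaling_into_neighbourhood:
  fixes sc :: "'a::banach \<Rightarrow> real \<Rightarrow> 'a"
  assumes sc: "is_scaling sc s" and T: "open T" "0 \<in> T" and "\<rho> > 0"
  obtains \<tau> where "continuous_on UNIV \<tau>" "\<And>u. 0 < \<tau> u" "\<And>u. \<tau> u \<le> \<rho>" "\<And>u. sc u (\<tau> u) \<in> T"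
proof -
  have sc_cont: "continuous_on (UNIV \<times> {0..}) (\<lambda>(u, t). sc u t)" and sc0: "\<And>u. sc u 0 = 0"
    using sc unfolding is_scaling_def by auto
  have "continuous_on UNIV (\<lambda>p :: 'a \<times> real. (fst p, \<bar>snd p\<bar>))"
    by (intro continuous_intros)
  then have "continuous_on UNIV (\<lambda>p. (\<lambda>(u, t). sc u t) (fst p, \<bar>snd p\<bar>))"
    by (rule continuous_on_compose2[OF sc_cont]) auto
  then have "open ((\<lambda>p. sc (fst p) \<bar>snd p\<bar>) -` T)"
    using T(1) by (simp add: open_vimage)
  moreover have "open ((UNIV :: 'a set) \<times> {..<1::real})"
    by (intro open_Times) auto
  ultimately have "open ((\<lambda>p. sc (fst p) \<bar>snd p\<bar>) -` T \<inter> UNIV \<times> {..<1})"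
    by (rule open_Int)
  \<comment> \<open>all pairs with \<open>t \<ge> 1\<close> are included because \<open>infdist\<close> to the empty set would be zero\<close>
  define C where "C = - ((\<lambda>p. sc (fst p) \<bar>snd p\<bar>) -` T \<inter> (UNIV :: 'a set) \<times> {..<1::real})"
  have C: "closed C" "C \<noteq> {}" "\<And>u. (u, 0) \<notin> C"
  proof -
    show "closed C"
      unfolding C_def by (rule closed_Compl) fact
    have "(0, 1) \<in> C" by (simp add: C_def)
    then show "C \<noteq> {}" by blast
    show "(u, 0) \<notin> C" for u using T(2) by (simp add: C_def sc0)
  qed
  define \<tau> where "\<tau> = (\<lambda>u. min \<rho> (infdist (u, 0) C / 2))"
  have pos: "infdist (u, 0) C > 0" for u
    by (rule infdist_pos_not_in_closed[OF C])
  show ?thesis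
  proof (rule that)
    show "continuous_on UNIV \<tau>"
      unfolding \<tau>_def by (intro continuous_intros) auto
    show "0 < \<tau> u" "\<tau> u \<le> \<rho>" for u
      using pos[of u] \<open>\<rho> > 0\<close> by (auto simp: \<tau>_def)
    show "sc u (\<tau> u) \<in> T" for u
    proof (rule ccontr)
      assume "sc u (\<tau> u) \<notin> T"
      then have "(u, \<tau> u) \<in> C"
        using \<open>\<And>u. 0 < \<tau> u\<close>[of u] by (simp add: C_def)
      then have "infdist (u, 0) C \<le> dist (u, 0) (u, \<tau> u)"
        by (rule infdist_le)
      also have "\<dots> = \<tau> u"
        using \<open>\<And>u. 0 < \<tau> u\<close>[of u] by (simp add: dist_Pair_Pair dist_real_def)
      also have "\<dots> < infdist (u, 0) C"
        using pos[of u] by (simp add: \<tau>_def)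
      finally show False by simp
    qed
  qed
qed

theorem theorem1p10:
  fixes sc :: "'a::banach \<Rightarrow> real \<Rightarrow> 'a"
    and s :: real
    and I \<Phi> :: "'a \<Rightarrow> real"
    and k :: nat
  assumes "reflexive TYPE('a)"
    and "is_scaling sc s"
    and "is_scaled_functional sc s I"
    and "C1_functional \<Phi>"
    and "k \<ge> 1"
    and "scaled_local_linking sc I \<Phi> k"
  shows "\<not> trivial_group (critical_group k \<Phi>)"
proof -
  obtain A B \<rho> where AB: "closedin (top_of_set (level_one I)) A" "symmetric_set A" "symmetric_set B"
      "A \<noteq> {}" "B \<noteq> {}" "A \<inter> B = {}"
    and index: "cohomological_index A = enat k" "cohomological_index (level_one I - B) = enat k"
    and \<rho>: "\<rho> > 0"
    and "\<forall>u\<in>A. \<forall>t. 0 \<le> t \<and> t \<le> \<rho> \<longrightarrow> \<Phi> (sc u t) \<le> 0"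
    and "\<forall>u\<in>B. \<forall>t. 0 < t \<and> t \<le> \<rho> \<longrightarrow> \<Phi> (sc u t) > 0"
    using assms(6) unfolding scaled_local_linking_def
    by (elim conjE exE) (rule that)
  then have \<Phi>A: "\<And>u t. u \<in> A \<Longrightarrow> 0 \<le> t \<Longrightarrow> t \<le> \<rho> \<Longrightarrow> \<Phi> (sc u t) \<le> 0"
    and \<Phi>B: "\<And>u t. u \<in> B \<Longrightarrow> 0 < t \<Longrightarrow> t \<le> \<rho> \<Longrightarrow> \<Phi> (sc u t) > 0"
    by blast+
  obtain n where n: "k = Suc n"
    using assms(5) by (cases k) auto
  have s: "s > 0" and sc0: "\<And>u. sc u 0 = 0"
    and sc_cont: "continuous_on (UNIV \<times> {0..}) (\<lambda>(u, t). sc u t)"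
    using assms(2) unfolding is_scaling_def by auto
  have I_cont: "continuous_on UNIV I" and I_even: "\<And>u. I (- u) = I u"
    and I_sc: "\<And>u t. t \<ge> 0 \<Longrightarrow> I (sc u t) = t powr s * I u"
    and I_pos: "\<And>u. u \<noteq> 0 \<Longrightarrow> I u > 0"
    using assms(3) unfolding is_scaled_functional_def by auto
  define r where "r = (\<lambda>u. sc u (I u powr (- (1 / s))))"
  note radial = scaling_radial_projection[OF assms(2,3) r_def]
  have A_level: "I u = 1" if "u \<in> A" for u
    using closedin_subset[OF AB(1)] that by (auto simp: level_one_def)
  have \<Phi>0: "\<Phi> 0 \<le> 0"
    using AB(4) \<Phi>A[of _ 0] \<rho> sc0 by force
  let ?D = "level_one I - B"
  have "A \<subseteq> ?D"
    using AB A_level by (auto simp: level_one_def)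
  moreover have "symmetric_set ?D"
  proof -
    have "uminus ` level_one I = level_one I"
    proof (intro equalityI subsetI)
      show "u \<in> level_one I" if "u \<in> uminus ` level_one I" for u
        using that I_even by (auto simp: level_one_def)
      show "u \<in> uminus ` level_one I" if "u \<in> level_one I" for u
        using that I_even by (intro image_eqI[of _ _ "- u"]) (auto simp: level_one_def)
    qed
    then show ?thesis
      using AB(3) by (simp add: symmetric_set_def image_set_diff)
  qed
  moreover have "0 \<notin> ?D"
    using radial(1) by (simp add: level_one_def)
  ultimately obtain c where c: "locally_zero (Suc n) (top_of_set ?D) (coboundary c)"
    "\<And>\<beta>. \<not> locally_zero n (top_of_set A) (\<lambda>xs. c xs + coboundary \<beta> xs)"
    using index_separating_class[of A ?D n] AB(2,4) index unfolding n by blast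
  let ?X = "top_of_set {u. \<Phi> u \<le> 0}"
  \<comment> \<open>\<open>I (sc v t) < R\<close> means \<open>t < \<rho>\<close> for \<open>v\<close> in the level set\<close>
  define R where "R = \<rho> powr s"
  have "R > 0" using \<rho> by (simp add: R_def)
  have open_sub: "openin ?X {u. \<Phi> u \<le> 0 \<and> I u < q}" and closed_sub: "closedin ?X {u. \<Phi> u \<le> 0 \<and> I u \<le> q}" for q
  proof -
    have "openin ?X ({u. \<Phi> u \<le> 0} \<inter> I -` {..<q})" "closedin ?X ({u. \<Phi> u \<le> 0} \<inter> I -` {..q})"
      using I_cont by (auto intro!: openin_open_Int closedin_closed_Int open_vimage closed_vimage)
    then show "openin ?X {u. \<Phi> u \<le> 0 \<and> I u < q}" "closedin ?X {u. \<Phi> u \<le> 0 \<and> I u \<le> q}"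
      by (simp_all add: vimage_def Int_def)
  qed
  have "\<not> trivial_group (cohomology (Suc n) ?X (topspace ?X - {0}))"
  proof (rule local_cohomology_nontrivial[where U = "{u. \<Phi> u \<le> 0 \<and> I u < R}"
        and V = "{u. \<Phi> u \<le> 0 \<and> I u \<le> R / 2}" and N = "{u. \<Phi> u \<le> 0 \<and> I u < R / 2}"
        and Y = "top_of_set ?D" and Z = "top_of_set A" and r = r and c = c])
    show "openin ?X {u. \<Phi> u \<le> 0 \<and> I u < R}" "openin ?X {u. \<Phi> u \<le> 0 \<and> I u < R / 2}"
      by (rule open_sub)+
    show "closedin ?X {u. \<Phi> u \<le> 0 \<and> I u \<le> R / 2}"
      by (rule closed_sub)
    show "closedin ?X {0}"
      using \<Phi>0 by (simp add: closedin_closed_subset)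
    show "continuous_map (subtopology ?X ({u. \<Phi> u \<le> 0 \<and> I u < R} - {0})) (top_of_set ?D) r"
    proof -
      let ?U = "{u. \<Phi> u \<le> 0 \<and> I u < R} - {0}"
      have "r u \<in> ?D" if u: "u \<in> ?U" for u
      proof -
        have "u \<noteq> 0" "I u > 0" using u I_pos by auto
        define t where "t = I u powr (1 / s)"
        have "t \<le> R powr (1 / s)"
          unfolding t_def using u \<open>I u > 0\<close> s by (intro powr_mono2) auto
        also have "\<dots> = \<rho>"
          using s \<rho> by (simp add: R_def powr_powr)
        finally have t: "0 < t" "t \<le> \<rho>"
          using \<open>I u > 0\<close> by (simp_all add: t_def)
        have "r u \<notin> B"
          using \<Phi>B[OF _ t, of "r u"] radial(4)[OF \<open>u \<noteq> 0\<close>] u by (auto simp: t_def)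
        then show ?thesis
          using radial(3)[OF \<open>u \<noteq> 0\<close>] by (simp add: level_one_def)
      qed
      moreover have "continuous_on ?U r"
        by (rule continuous_on_subset[OF radial(2)]) auto
      moreover have "{u. \<Phi> u \<le> 0} \<inter> ?U = ?U" by blast
      then have "subtopology ?X ?U = top_of_set ?U"
        by (simp only: subtopology_subtopology)
      ultimately show ?thesis by auto
    qed
    show "\<exists>j. continuous_map (top_of_set A) (subtopology ?X (W - {0})) j \<and> (\<forall>z\<in>topspace (top_of_set A). r (j z) = z)"
      if W: "openin ?X W" "0 \<in> W" for W
    proof -
      obtain T where T: "open T" "W = {u. \<Phi> u \<le> 0} \<inter> T"
        using W(1) by (auto simp: openin_open)
      obtain \<tau> where \<tau>: "continuous_on UNIV \<tau>" "\<And>u. 0 < \<tau> u" "\<And>u. \<tau> u \<le> \<rho>" "\<And>u. sc u (\<tau> u) \<in> T"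
        using scaling_into_neighbourhood[OF assms(2) T(1) _ \<rho>] W(2) T(2) by blast
      define j where "j = (\<lambda>u. sc u (\<tau> u))"
      have "continuous_on A (\<lambda>u. (u, \<tau> u))"
        by (intro continuous_intros continuous_on_subset[OF \<tau>(1)]) auto
      then have "continuous_on A (\<lambda>u. (\<lambda>(u, t). sc u t) (u, \<tau> u))"
        by (rule continuous_on_compose2[OF sc_cont]) (use \<tau>(2) in \<open>auto intro: less_imp_le\<close>)
      then have "continuous_on A j" by (simp add: j_def)
      moreover have "j u \<in> W - {0}" if "u \<in> A" for u
      proof -
        have "\<Phi> (j u) \<le> 0"
          unfolding j_def using \<Phi>A[OF that] \<tau>(2,3) less_imp_le by blast
        moreover have "I (j u) > 0"
          unfolding j_def using \<tau>(2)[of u] A_level[OF that] by (simp add: I_sc less_imp_le)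
        then have "j u \<noteq> 0" using radial(1) by force
        ultimately show ?thesis
          using \<tau>(4)[of u] by (simp add: T(2) j_def)
      qed
      moreover have "{u. \<Phi> u \<le> 0} \<inter> (W - {0}) = W - {0}"
        using T(2) by blast
      then have "subtopology ?X (W - {0}) = top_of_set (W - {0})"
        by (simp only: subtopology_subtopology)
      moreover have "r (j u) = u" if "u \<in> A" for u
        unfolding j_def by (rule radial(5)[OF A_level[OF that] \<tau>(2)])
      ultimately show ?thesis
        by (intro exI[of _ j]) auto
    qed
  qed (use \<Phi>0 \<open>R > 0\<close> radial(1) c in auto)
  then show ?thesis
    by (simp add: critical_group_def n)
qed

end
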